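(* For a left $R$-module $M$, the following statements are equivalent. (1) $M$ is $\infty$-$C$-cotorsionfree and $\infty$-$C$-cospherical. (2) $M\in \mathcal{B}_C(R)$.
   Context: $R$ and $S$ are fixed associative unital rings; $\mathrm{Mod}\, R$ denotes the left $R$-modules. ${}_RC_S$ is a fixed semidualizing $(R,S)$-bimodule, i.e.: ${}_RC$ and $C_S$ each admit a projective resolution (over $R$, resp. over $S$ on the right) with all terms finitely generated; the homothety maps $R\to \mathrm{Hom}_{S}(C,C)$ and $S\to \mathrm{Hom}_R(C,C)$ are isomorphisms; and $\mathrm{Ext}^{i}_R(C,C)=0=\mathrm{Ext}^{i}_{S}(C,C)$ for all $i\geq 1$. Write $(-)_*=\mathrm{Hom}_R(C,-)$, a functor from left $R$-modules to left $S$-modules, and let $\theta_M: C\otimes_S M_*\to M$ be the evaluation map $\theta_M(x\otimes f)=f(x)$. For $M\in\mathrm{Mod}\, R$ let $0\to M\to I^0(M)\xrightarrow{f^0} I^1(M)\xrightarrow{f^1}\cdots$ be its minimal injective resolution. The cotranspose of $M$ is the left $S$-module $\mathrm{cTr}_C M:=\mathrm{Coker}(f^0_*: I^0(M)_*\to I^1(M)_* )$. $M$ is $n$-$C$-cotorsionfree ($n\ge1$) if $\mathrm{Tor}^S_i(C,\mathrm{cTr}_C M)=0$ for all $1\leq i\leq n$, and $\infty$-$C$-cotorsionfree if this holds for all $n$. $M$ is $n$-$C$-cospherical if $\mathrm{Ext}_R^i(C,M)=0$ for all $1\le i\le n$, and $\infty$-$C$-cospherical if this holds for all $n$. The Bass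 class $\mathcal{B}_C(R)$ with respect to $C$ consists of all left $R$-modules $M$ such that (B1) $\mathrm{Ext}_R^{i}(C,M)=0$ for all $i\ge1$; (B2) $\mathrm{Tor}^S_{i}(C,\mathrm{Hom}_R(C,M))=0$ for all $i\geq1$; (B3) $\theta_M$ is an isomorphism. *)

theory Defs
  imports "HOL-Library.FSet" "HOL-Algebra.Elementary_Groups" "HOL-Algebra.Free_Abelian_Groups"
    "HOL-Algebra.AbelCoset" "HOL-Algebra.Module"
begin

text \<open>
  Rings are the (not necessarily commutative, possibly trivial) rings of HOL-Algebra.  The locale
  \<^locale>\<open>module\<close> there insists on a commutative ring, so left modules are introduced here; they reuse
  the record type of \<^locale>\<open>module\<close>, whose ring fields \<^term>\<open>mult\<close> and \<^term>\<open>one\<close> play no role.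
  A right \<open>S\<close>-module is a left module over \<open>opp_ring S\<close>.
\<close>

section \<open>Modules\<close>

locale left_module = R?: ring R + M?: abelian_group M
  for R :: "('r, 'x) ring_scheme" and M :: "('r, 'm, 'y) module_scheme" (structure) +
  assumes smult_closed [simp, intro]:
      "\<lbrakk>a \<in> carrier R; x \<in> carrier M\<rbrakk> \<Longrightarrow> a \<odot>\<^bsub>M\<^esub> x \<in> carrier M"
    and smult_l_distr:
      "\<lbrakk>a \<in> carrier R; b \<in> carrier R; x \<in> carrier M\<rbrakk> \<Longrightarrow>
        (a \<oplus>\<^bsub>R\<^esub> b) \<odot>\<^bsub>M\<^esub> x = a \<odot>\<^bsub>M\<^esub> x \<oplus>\<^bsub>M\<^esub> b \<odot>\<^bsub>M\<^esub> x"
    and smult_r_distr: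
      "\<lbrakk>a \<in> carrier R; x \<in> carrier M; y \<in> carrier M\<rbrakk> \<Longrightarrow>
        a \<odot>\<^bsub>M\<^esub> (x \<oplus>\<^bsub>M\<^esub> y) = a \<odot>\<^bsub>M\<^esub> x \<oplus>\<^bsub>M\<^esub> a \<odot>\<^bsub>M\<^esub> y"
    and smult_assoc1:
      "\<lbrakk>a \<in> carrier R; b \<in> carrier R; x \<in> carrier M\<rbrakk> \<Longrightarrow>
        (a \<otimes>\<^bsub>R\<^esub> b) \<odot>\<^bsub>M\<^esub> x = a \<odot>\<^bsub>M\<^esub> (b \<odot>\<^bsub>M\<^esub> x)"
    and smult_one [simp]:
      "x \<in> carrier M \<Longrightarrow> \<one>\<^bsub>R\<^esub> \<odot>\<^bsub>M\<^esub> x = x"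

definition opp_ring :: "'r ring \<Rightarrow> 'r ring" where
  "opp_ring R = R\<lparr>mult := \<lambda>x y. y \<otimes>\<^bsub>R\<^esub> x\<rparr>"

definition mod_hom ::
  "'r ring \<Rightarrow> ('r, 'a, 'x) module_scheme \<Rightarrow> ('r, 'b, 'y) module_scheme \<Rightarrow> ('a \<Rightarrow> 'b) set" where
  "mod_hom R A B = {f \<in> carrier A \<rightarrow> carrier B.
     (\<forall>x \<in> carrier A. \<forall>y \<in> carrier A. f (x \<oplus>\<^bsub>A\<^esub> y) = f x \<oplus>\<^bsub>B\<^esub> f y) \<and>
     (\<forall>r \<in> carrier R. \<forall>x \<in> carrier A. f (r \<odot>\<^bsub>A\<^esub> x) = r \<odot>\<^bsub>B\<^esub> f x)}"

definition mod_iso ::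
  "'r ring \<Rightarrow> ('r, 'a, 'x) module_scheme \<Rightarrow> ('r, 'b, 'y) module_scheme \<Rightarrow> ('a \<Rightarrow> 'b) set" where
  "mod_iso R A B = {f \<in> mod_hom R A B. bij_betw f (carrier A) (carrier B)}"

definition fin_gen_module :: "'r ring \<Rightarrow> ('r, 'a, 'x) module_scheme \<Rightarrow> bool" where
  "fin_gen_module R A \<longleftrightarrow>
     (\<exists>X. X \<subseteq> carrier A \<and> finite X \<and> (\<forall>N. submodule N R A \<longrightarrow> X \<subseteq> N \<longrightarrow> N = carrier A))"

definition module_of_group :: "('a, 'x) monoid_scheme \<Rightarrow> ('r \<Rightarrow> 'a \<Rightarrow> 'a) \<Rightarrow> ('r, 'a) module" where
  "module_of_group G act =
     \<lparr>carrier = carrier G, mult = undefined, one = undefined,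
      zero = \<one>\<^bsub>G\<^esub>, add = mult G, smult = act\<rparr>"

definition quot_module :: "('r, 'a, 'x) module_scheme \<Rightarrow> 'a set \<Rightarrow> ('r, 'a set) module" where
  "quot_module A N = module_of_group (A A_Mod N) (\<lambda>r X. \<Union>x\<in>X. N +>\<^bsub>A\<^esub> (r \<odot>\<^bsub>A\<^esub> x))"


section \<open>Injective and projective modules\<close>

text \<open>
  HOL cannot quantify over all types inside a definition.  The two lifting properties are therefore
  required for modules over fixed types only; lemmas \<open>injective_moduleD\<close> (Baer's criterion) and
  \<open>projective_moduleD\<close> below show that they then hold for modules over arbitrary types.
\<close>

definition injective_module :: "'r ring \<Rightarrow> ('r, 'i) module \<Rightarrow> bool" where
  "injective_module R I \<longleftrightarrow> left_module R I \<and>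
     (\<forall>(A :: ('r, 'r) module) (B :: ('r, 'r) module) j g.
        left_module R A \<longrightarrow> left_module R B \<longrightarrow>
        j \<in> mod_hom R A B \<longrightarrow> inj_on j (carrier A) \<longrightarrow> g \<in> mod_hom R A I \<longrightarrow>
        (\<exists>h \<in> mod_hom R B I. \<forall>x \<in> carrier A. h (j x) = g x))"

definition projective_module :: "'r ring \<Rightarrow> ('r, 'p) module \<Rightarrow> bool" where
  "projective_module R P \<longleftrightarrow> left_module R P \<and>
     (\<forall>(A :: ('r, 'p \<Rightarrow> 'r) module) (B :: ('r, 'p) module) e g.
        left_module R A \<longrightarrow> left_module R B \<longrightarrow>
        e \<in> mod_hom R A B \<longrightarrow> e ` carrier A = carrier B \<longrightarrow> g \<in> mod_hom R P B \<longrightarrow>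
        (\<exists>h \<in> mod_hom R P A. \<forall>x \<in> carrier P. e (h x) = g x))"

definition projective_resolution ::
  "'r ring \<Rightarrow> ('r, 'a, 'x) module_scheme \<Rightarrow>
   (nat \<Rightarrow> ('r, 'p) module) \<Rightarrow> (nat \<Rightarrow> 'p \<Rightarrow> 'p) \<Rightarrow> ('p \<Rightarrow> 'a) \<Rightarrow> bool" where
  "projective_resolution R A P d \<epsilon> \<longleftrightarrow>
     (\<forall>n. projective_module R (P n)) \<and>
     (\<forall>n. d n \<in> mod_hom R (P (Suc n)) (P n)) \<and> \<epsilon> \<in> mod_hom R (P 0) A \<and>
     \<epsilon> ` carrier (P 0) = carrier A \<and>
     d 0 ` carrier (P 1) = a_kernel (P 0) A \<epsilon> \<and>
     (\<forall>n. d (Suc n) ` carrier (P (Suc (Suc n))) = a_kernel (P (Suc n)) (P n) (d n))"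

text \<open>
  A finitely generated projective module is isomorphic to a direct summand of some \<open>R\<^sup>k\<close>, hence to a
  module whose elements are functions \<^typ>\<open>nat \<Rightarrow> 'r\<close>; so fixing this type for the terms of
  the resolution is no restriction.
\<close>

definition has_fg_projective_resolution :: "'r ring \<Rightarrow> ('r, 'a, 'x) module_scheme \<Rightarrow> bool" where
  "has_fg_projective_resolution R A \<longleftrightarrow>
     (\<exists>(P :: nat \<Rightarrow> ('r, nat \<Rightarrow> 'r) module) d \<epsilon>.
        projective_resolution R A P d \<epsilon> \<and> (\<forall>n. fin_gen_module R (P n)))"

definition essential_submodule :: "'r ring \<Rightarrow> ('r, 'a, 'x) module_scheme \<Rightarrow> 'a set \<Rightarrow> bool" where
  "essential_submodule R A K \<longleftrightarrow> submodule K R A \<and>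
     (\<forall>N. submodule N R A \<longrightarrow> N \<inter> K = {\<zero>\<^bsub>A\<^esub>} \<longrightarrow> N = {\<zero>\<^bsub>A\<^esub>})"

text \<open>
  The resolution \<open>0 \<rightarrow> M \<rightarrow> I\<^sup>0 \<rightarrow> I\<^sup>1 \<rightarrow> \<dots>\<close> with augmentation \<open>\<eta>\<close> is minimal: \<open>I\<^sup>0\<close> is an injective
  envelope of \<open>M\<close> and each \<open>I\<^sup>n\<^sup>+\<^sup>1\<close> one of the image of \<open>f\<^sup>n\<close>.
\<close>

definition minimal_injective_resolution ::
  "'r ring \<Rightarrow> ('r, 'm) module \<Rightarrow>
   (nat \<Rightarrow> ('r, 'i) module) \<Rightarrow> ('m \<Rightarrow> 'i) \<Rightarrow> (nat \<Rightarrow> 'i \<Rightarrow> 'i) \<Rightarrow> bool" where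
  "minimal_injective_resolution R M I \<eta> f \<longleftrightarrow>
     (\<forall>n. injective_module R (I n)) \<and>
     \<eta> \<in> mod_hom R M (I 0) \<and> (\<forall>n. f n \<in> mod_hom R (I n) (I (Suc n))) \<and>
     inj_on \<eta> (carrier M) \<and>
     \<eta> ` carrier M = a_kernel (I 0) (I 1) (f 0) \<and>
     (\<forall>n. f n ` carrier (I n) = a_kernel (I (Suc n)) (I (Suc (Suc n))) (f (Suc n))) \<and>
     essential_submodule R (I 0) (\<eta> ` carrier M) \<and>
     (\<forall>n. essential_submodule R (I (Suc n)) (f n ` carrier (I n)))"


section \<open>Free modules and the standard free resolution\<close>

definition free_module :: "'r ring \<Rightarrow> 'x set \<Rightarrow> ('r, 'x \<Rightarrow> 'r) module" where
  "free_module R X =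
     \<lparr>carrier = {v. finite {x. v x \<noteq> \<zero>\<^bsub>R\<^esub>} \<and> {x. v x \<noteq> \<zero>\<^bsub>R\<^esub>} \<subseteq> X \<and> range v \<subseteq> carrier R},
      mult = undefined, one = undefined,
      zero = (\<lambda>_. \<zero>\<^bsub>R\<^esub>), add = (\<lambda>v w x. v x \<oplus>\<^bsub>R\<^esub> w x), smult = (\<lambda>r v x. r \<otimes>\<^bsub>R\<^esub> v x)\<rparr>"

definition free_lift ::
  "'r ring \<Rightarrow> ('r, 'a, 'y) module_scheme \<Rightarrow> ('x \<Rightarrow> 'a) \<Rightarrow> ('x \<Rightarrow> 'r) \<Rightarrow> 'a" where
  "free_lift R A \<phi> v = (\<Oplus>\<^bsub>A\<^esub>x \<in> {x. v x \<noteq> \<zero>\<^bsub>R\<^esub>}. v x \<odot>\<^bsub>A\<^esub> \<phi> x)"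

text \<open>
  The standard resolution of \<open>A\<close> has \<open>P\<^sub>0\<close> free on the elements of \<open>A\<close>, \<open>P\<^sub>1\<close> free on
  the elements of the kernel of \<open>P\<^sub>0 \<rightarrow> A\<close>, \<open>P\<^sub>2\<close> free on the elements of the kernel of \<open>P\<^sub>1 \<rightarrow> P\<^sub>0\<close>, and
  so on.  To house all terms in one type, an element of a free module that serves as a generator of
  the next one is encoded by its finite graph.  Lemma \<open>projective_resolution_std_res\<close> confirms that
  this is a projective resolution.
\<close>

datatype ('a, 'r) gen = Base (base: 'a) | Syz "(('a, 'r) gen \<times> 'r) fset"

definition syz :: "'r ring \<Rightarrow> (('a, 'r) gen \<Rightarrow> 'r) \<Rightarrow> ('a, 'r) gen" where
  "syz R v = Syz (Abs_fset {(x, v x) | x. v x \<noteq> \<zero>\<^bsub>R\<^esub>})"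

definition unsyz :: "'r ring \<Rightarrow> ('a, 'r) gen \<Rightarrow> ('a, 'r) gen \<Rightarrow> 'r" where
  "unsyz R = inv_into {v. finite {x. v x \<noteq> \<zero>\<^bsub>R\<^esub>}} (syz R)"

fun std_gens :: "'r ring \<Rightarrow> ('r, 'a, 'x) module_scheme \<Rightarrow> nat \<Rightarrow> ('a, 'r) gen set" where
  "std_gens R A 0 = Base ` carrier A"
| "std_gens R A (Suc 0) =
     syz R ` a_kernel (free_module R (std_gens R A 0)) A (free_lift R A base)"
| "std_gens R A (Suc (Suc n)) =
     syz R ` a_kernel (free_module R (std_gens R A (Suc n))) (free_module R (std_gens R A n))
       (free_lift R (free_module R (std_gens R A n)) (unsyz R))"

definition std_res ::
  "'r ring \<Rightarrow> ('r, 'a, 'x) module_scheme \<Rightarrow> nat \<Rightarrow> ('r, ('a, 'r) gen \<Rightarrow> 'r) module" where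
  "std_res R A n = free_module R (std_gens R A n)"

definition std_aug ::
  "'r ring \<Rightarrow> ('r, 'a, 'x) module_scheme \<Rightarrow> (('a, 'r) gen \<Rightarrow> 'r) \<Rightarrow> 'a" where
  "std_aug R A = free_lift R A base"

definition std_diff ::
  "'r ring \<Rightarrow> ('r, 'a, 'x) module_scheme \<Rightarrow> nat \<Rightarrow> (('a, 'r) gen \<Rightarrow> 'r) \<Rightarrow> ('a, 'r) gen \<Rightarrow> 'r" where
  "std_diff R A n = free_lift R (std_res R A n) (unsyz R)"


subsection \<open>Adequacy of the above notions\<close>

lemma mod_homD:
  assumes "f \<in> mod_hom R A B"
  shows mod_hom_closed: "x \<in> carrier A \<Longrightarrow> f x \<in> carrier B"
    and mod_hom_add: "\<lbrakk>x \<in> carrier A; y \<in> carrier A\<rbrakk> \<Longrightarrow> f (x \<oplus>\<^bsub>A\<^esub> y) = f x \<oplus>\<^bsub>B\<^esub> f y"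
    and mod_hom_smult: "\<lbrakk>r \<in> carrier R; x \<in> carrier A\<rbrakk> \<Longrightarrow> f (r \<odot>\<^bsub>A\<^esub> x) = r \<odot>\<^bsub>B\<^esub> f x"
  using assms by (auto simp: mod_hom_def)

lemma mod_homI:
  assumes "\<And>x. x \<in> carrier A \<Longrightarrow> f x \<in> carrier B"
    and "\<And>x y. \<lbrakk>x \<in> carrier A; y \<in> carrier A\<rbrakk> \<Longrightarrow> f (x \<oplus>\<^bsub>A\<^esub> y) = f x \<oplus>\<^bsub>B\<^esub> f y"
    and "\<And>r x. \<lbrakk>r \<in> carrier R; x \<in> carrier A\<rbrakk> \<Longrightarrow> f (r \<odot>\<^bsub>A\<^esub> x) = r \<odot>\<^bsub>B\<^esub> f x"
  shows "f \<in> mod_hom R A B"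
  using assms by (auto simp: mod_hom_def)

lemma mod_hom_comp:
  "\<lbrakk>f \<in> mod_hom R A B; g \<in> mod_hom R B D\<rbrakk> \<Longrightarrow> (\<lambda>x. g (f x)) \<in> mod_hom R A D"
  by (auto simp: mod_hom_def Pi_iff)

lemma mod_hom_zero:
  assumes "left_module R A" "left_module R B" "f \<in> mod_hom R A B"
  shows "f \<zero>\<^bsub>A\<^esub> = \<zero>\<^bsub>B\<^esub>"
proof -
  interpret A: left_module R A by fact
  interpret B: left_module R B by fact
  have "f \<zero>\<^bsub>A\<^esub> \<oplus>\<^bsub>B\<^esub> f \<zero>\<^bsub>A\<^esub> = f \<zero>\<^bsub>A\<^esub>"
    using mod_hom_add[OF assms(3), of "\<zero>\<^bsub>A\<^esub>" "\<zero>\<^bsub>A\<^esub>"] by simp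
  then show ?thesis
    using mod_hom_closed[OF assms(3), of "\<zero>\<^bsub>A\<^esub>"] by (metis A.M.zero_closed B.M.add.r_cancel_one)
qed

context left_module begin

lemma smult_l_null: "x \<in> carrier M \<Longrightarrow> \<zero>\<^bsub>R\<^esub> \<odot>\<^bsub>M\<^esub> x = \<zero>\<^bsub>M\<^esub>"
  by (metis M.add.r_cancel_one R.zero_closed R.l_zero smult_closed smult_l_distr)

lemma smult_r_null: "a \<in> carrier R \<Longrightarrow> a \<odot>\<^bsub>M\<^esub> \<zero>\<^bsub>M\<^esub> = \<zero>\<^bsub>M\<^esub>"
  by (metis M.add.r_cancel_one M.zero_closed M.l_zero smult_closed smult_r_distr)

lemma smult_l_minus:
  "\<lbrakk>a \<in> carrier R; x \<in> carrier M\<rbrakk> \<Longrightarrow> (\<ominus>\<^bsub>R\<^esub> a) \<odot>\<^bsub>M\<^esub> x = \<ominus>\<^bsub>M\<^esub> (a \<odot>\<^bsub>M\<^esub> x)"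
  by (metis M.minus_equality R.add.inv_closed R.l_neg smult_closed smult_l_distr smult_l_null)

lemma finsum_smult:
  assumes "finite F" "a \<in> carrier R" "f \<in> F \<rightarrow> carrier M"
  shows "a \<odot>\<^bsub>M\<^esub> (\<Oplus>\<^bsub>M\<^esub>i\<in>F. f i) = (\<Oplus>\<^bsub>M\<^esub>i\<in>F. a \<odot>\<^bsub>M\<^esub> f i)"
  using assms by (induction F) (auto simp: smult_r_null smult_r_distr Pi_iff)

end

lemma mod_hom_finsum:
  assumes "left_module R A" "left_module R B" "g \<in> mod_hom R A B"
    and "finite F" "f \<in> F \<rightarrow> carrier A"
  shows "g (\<Oplus>\<^bsub>A\<^esub>i\<in>F. f i) = (\<Oplus>\<^bsub>B\<^esub>i\<in>F. g (f i))"
proof -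
  interpret A: left_module R A by fact
  interpret B: left_module R B by fact
  show ?thesis
    using assms(4,5)
    by (induction F) (auto simp: mod_hom_zero[OF assms(1-3)] mod_hom_add[OF assms(3)]
        mod_hom_closed[OF assms(3)] Pi_iff)
qed

lemma free_module_simps:
  "v \<in> carrier (free_module R X) \<longleftrightarrow>
     finite {x. v x \<noteq> \<zero>\<^bsub>R\<^esub>} \<and> (\<forall>x. v x \<noteq> \<zero>\<^bsub>R\<^esub> \<longrightarrow> x \<in> X) \<and> (\<forall>x. v x \<in> carrier R)"
  "\<zero>\<^bsub>free_module R X\<^esub> = (\<lambda>_. \<zero>\<^bsub>R\<^esub>)"
  "v \<oplus>\<^bsub>free_module R X\<^esub> w = (\<lambda>x. v x \<oplus>\<^bsub>R\<^esub> w x)"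
  "r \<odot>\<^bsub>free_module R X\<^esub> v = (\<lambda>x. r \<otimes>\<^bsub>R\<^esub> v x)"
  by (auto simp: free_module_def)

lemma left_module_free_module:
  assumes "ring R"
  shows "left_module R (free_module R X)"
proof -
  interpret ring R by fact
  let ?F = "free_module R X"
  have sub: "v \<in> carrier ?F"
    if "w1 \<in> carrier ?F" "w2 \<in> carrier ?F" "\<And>x. v x \<in> carrier R"
      "\<And>x. w1 x = \<zero>\<^bsub>R\<^esub> \<Longrightarrow> w2 x = \<zero>\<^bsub>R\<^esub> \<Longrightarrow> v x = \<zero>\<^bsub>R\<^esub>" for v w1 w2
  proof -
    have *: "{x. v x \<noteq> \<zero>\<^bsub>R\<^esub>} \<subseteq> {x. w1 x \<noteq> \<zero>\<^bsub>R\<^esub>} \<union> {x. w2 x \<noteq> \<zero>\<^bsub>R\<^esub>}" using that(4) by auto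
    have "finite {x. v x \<noteq> \<zero>\<^bsub>R\<^esub>}"
      by (rule finite_subset[OF *]) (use that(1,2) in \<open>simp add: free_module_simps\<close>)
    moreover have "v x \<noteq> \<zero>\<^bsub>R\<^esub> \<Longrightarrow> x \<in> X" for x
      using that(4)[of x] that(1,2) unfolding free_module_simps by blast
    ultimately show ?thesis using that(3) by (simp add: free_module_simps)
  qed
  have cl: "v x \<in> carrier R" if "v \<in> carrier ?F" for v x
    using that by (simp add: free_module_simps)
  have ag: "abelian_group ?F"
  proof (rule abelian_groupI)
    fix v w assume v: "v \<in> carrier ?F" and w: "w \<in> carrier ?F"
    show "v \<oplus>\<^bsub>?F\<^esub> w \<in> carrier ?F"
      by (rule sub[OF v w]) (simp_all add: free_module_simps(2-) cl v w)
    show "v \<oplus>\<^bsub>?F\<^esub> w = w \<oplus>\<^bsub>?F\<^esub> v"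
      by (simp add: free_module_simps(2-) a_comm cl v w)
  next
    fix u v w assume "u \<in> carrier ?F" "v \<in> carrier ?F" "w \<in> carrier ?F"
    then show "u \<oplus>\<^bsub>?F\<^esub> v \<oplus>\<^bsub>?F\<^esub> w = u \<oplus>\<^bsub>?F\<^esub> (v \<oplus>\<^bsub>?F\<^esub> w)"
      by (simp add: free_module_simps(2-) a_assoc cl)
  next
    fix v assume v: "v \<in> carrier ?F"
    show "\<zero>\<^bsub>?F\<^esub> \<oplus>\<^bsub>?F\<^esub> v = v" by (simp add: free_module_simps(2-) cl v)
    have "(\<lambda>x. \<ominus>\<^bsub>R\<^esub> v x) \<in> carrier ?F" by (rule sub[OF v v]) (simp_all add: cl v)
    moreover have "(\<lambda>x. \<ominus>\<^bsub>R\<^esub> v x) \<oplus>\<^bsub>?F\<^esub> v = \<zero>\<^bsub>?F\<^esub>" by (simp add: free_module_simps(2-) cl v l_neg)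
    ultimately show "\<exists>w\<in>carrier ?F. w \<oplus>\<^bsub>?F\<^esub> v = \<zero>\<^bsub>?F\<^esub>" by blast
  qed (simp add: free_module_simps)
  have "left_module_axioms R ?F"
  proof (rule left_module_axioms.intro)
    fix a v assume a: "a \<in> carrier R" and v: "v \<in> carrier ?F"
    show "a \<odot>\<^bsub>?F\<^esub> v \<in> carrier ?F"
      by (rule sub[OF v v]) (simp_all add: free_module_simps(2-) cl a v)
  qed (simp_all add: free_module_simps(2-) cl l_distr r_distr m_assoc)
  with ag show ?thesis
    by (simp add: left_module_def ring_axioms)
qed

lemma free_lift_alt:
  assumes "left_module R A" "v \<in> carrier (free_module R X)" "\<phi> \<in> X \<rightarrow> carrier A"
    and "finite F" "{x. v x \<noteq> \<zero>\<^bsub>R\<^esub>} \<subseteq> F" "F \<subseteq> X"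
  shows "free_lift R A \<phi> v = (\<Oplus>\<^bsub>A\<^esub>x\<in>F. v x \<odot>\<^bsub>A\<^esub> \<phi> x)"
proof -
  interpret A: left_module R A by fact
  show ?thesis
    unfolding free_lift_def
    by (rule A.M.add.finprod_mono_neutral_cong_left)
       (use assms in \<open>auto simp: free_module_def A.smult_l_null range_subsetD Pi_iff\<close>)
qed

lemma free_lift_hom:
  assumes "left_module R A" "\<phi> \<in> X \<rightarrow> carrier A"
  shows "free_lift R A \<phi> \<in> mod_hom R (free_module R X) A"
proof -
  interpret A: left_module R A by fact
  interpret F: left_module R "free_module R X"
    by (rule left_module_free_module) (rule A.ring_axioms)
  let ?s = "\<lambda>v. {x. v x \<noteq> \<zero>\<^bsub>R\<^esub>}"
  have s: "finite (?s v)" "?s v \<subseteq> X" "v x \<in> carrier R" if "v \<in> carrier (free_module R X)" for v x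
    using that by (auto simp: free_module_def)
  show ?thesis
  proof (rule mod_homI)
    fix v assume v: "v \<in> carrier (free_module R X)"
    then show "free_lift R A \<phi> v \<in> carrier A"
      unfolding free_lift_def using s[OF v] assms(2) by (intro A.M.finsum_closed) (auto simp: Pi_iff)
  next
    fix v w assume v: "v \<in> carrier (free_module R X)" and w: "w \<in> carrier (free_module R X)"
    let ?F = "?s v \<union> ?s w"
    have F: "finite ?F" "?F \<subseteq> X" using s[OF v] s[OF w] by auto
    have vw: "v \<oplus>\<^bsub>free_module R X\<^esub> w = (\<lambda>x. v x \<oplus>\<^bsub>R\<^esub> w x)" by (simp add: free_module_def)
    have vwF: "?s (v \<oplus>\<^bsub>free_module R X\<^esub> w) \<subseteq> ?F" by (auto simp: vw)
    note alt = free_lift_alt[OF assms(1) _ assms(2) F(1) _ F(2)]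
    have "free_lift R A \<phi> (v \<oplus>\<^bsub>free_module R X\<^esub> w)
        = (\<Oplus>\<^bsub>A\<^esub>x\<in>?F. (v x \<oplus>\<^bsub>R\<^esub> w x) \<odot>\<^bsub>A\<^esub> \<phi> x)"
      using alt[OF F.M.a_closed[OF v w] vwF] by (simp add: vw)
    also have "\<dots> = (\<Oplus>\<^bsub>A\<^esub>x\<in>?F. v x \<odot>\<^bsub>A\<^esub> \<phi> x \<oplus>\<^bsub>A\<^esub> w x \<odot>\<^bsub>A\<^esub> \<phi> x)"
      by (rule A.M.finsum_cong')
        (use F s[OF v] s[OF w] assms(2) in \<open>auto simp: A.smult_l_distr Pi_iff\<close>)
    also have "\<dots> = (\<Oplus>\<^bsub>A\<^esub>x\<in>?F. v x \<odot>\<^bsub>A\<^esub> \<phi> x) \<oplus>\<^bsub>A\<^esub> (\<Oplus>\<^bsub>A\<^esub>x\<in>?F. w x \<odot>\<^bsub>A\<^esub> \<phi> x)"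
      by (rule A.M.finsum_addf) (use F s[OF v] s[OF w] assms(2) in \<open>auto simp: Pi_iff subset_iff\<close>)
    also have "\<dots> = free_lift R A \<phi> v \<oplus>\<^bsub>A\<^esub> free_lift R A \<phi> w"
      using alt[OF v] alt[OF w] by simp
    finally show "free_lift R A \<phi> (v \<oplus>\<^bsub>free_module R X\<^esub> w) = free_lift R A \<phi> v \<oplus>\<^bsub>A\<^esub> free_lift R A \<phi> w" .
  next
    fix r v assume r: "r \<in> carrier R" and v: "v \<in> carrier (free_module R X)"
    have rv: "r \<odot>\<^bsub>free_module R X\<^esub> v = (\<lambda>x. r \<otimes>\<^bsub>R\<^esub> v x)" by (simp add: free_module_def)
    have rvF: "?s (r \<odot>\<^bsub>free_module R X\<^esub> v) \<subseteq> ?s v" using r by (auto simp: rv)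
    note alt = free_lift_alt[OF assms(1) _ assms(2) s(1)[OF v] _ s(2)[OF v]]
    have "free_lift R A \<phi> (r \<odot>\<^bsub>free_module R X\<^esub> v) = (\<Oplus>\<^bsub>A\<^esub>x\<in>?s v. (r \<otimes>\<^bsub>R\<^esub> v x) \<odot>\<^bsub>A\<^esub> \<phi> x)"
      using alt[OF F.smult_closed[OF r v] rvF] by (simp add: rv)
    also have "\<dots> = (\<Oplus>\<^bsub>A\<^esub>x\<in>?s v. r \<odot>\<^bsub>A\<^esub> (v x \<odot>\<^bsub>A\<^esub> \<phi> x))"
      by (rule A.M.finsum_cong') (use r s[OF v] assms(2) in \<open>auto simp: A.smult_assoc1 Pi_iff\<close>)
    also have "\<dots> = r \<odot>\<^bsub>A\<^esub> free_lift R A \<phi> v"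
      unfolding free_lift_def by (rule A.finsum_smult[symmetric]) (use r s[OF v] assms(2) in auto)
    finally show "free_lift R A \<phi> (r \<odot>\<^bsub>free_module R X\<^esub> v) = r \<odot>\<^bsub>A\<^esub> free_lift R A \<phi> v" .
  qed
qed

definition free_unit :: "'r ring \<Rightarrow> 'x \<Rightarrow> 'x \<Rightarrow> 'r" where
  "free_unit R x = (\<lambda>y. if y = x then \<one>\<^bsub>R\<^esub> else \<zero>\<^bsub>R\<^esub>)"

lemma free_unit_closed: "ring R \<Longrightarrow> x \<in> X \<Longrightarrow> free_unit R x \<in> carrier (free_module R X)"
  by (auto simp: free_module_def free_unit_def ring.ring_simprules split: if_splits)

lemma free_lift_unit:
  assumes "left_module R A" "\<phi> \<in> X \<rightarrow> carrier A" "x \<in> X"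
  shows "free_lift R A \<phi> (free_unit R x) = \<phi> x"
proof -
  interpret A: left_module R A by fact
  have "free_lift R A \<phi> (free_unit R x) = (\<Oplus>\<^bsub>A\<^esub>y\<in>{x}. free_unit R x y \<odot>\<^bsub>A\<^esub> \<phi> y)"
    by (rule free_lift_alt[OF assms(1) free_unit_closed[OF A.ring_axioms assms(3)] assms(2)])
      (use assms(3) in \<open>auto simp: free_unit_def\<close>)
  also have "\<dots> = \<phi> x" using assms by (auto simp: free_unit_def Pi_iff)
  finally show ?thesis .
qed

lemma hom_free_lift:
  assumes "left_module R A" "left_module R B" "g \<in> mod_hom R A B" "\<phi> \<in> X \<rightarrow> carrier A"
    and v: "v \<in> carrier (free_module R X)"
  shows "g (free_lift R A \<phi> v) = free_lift R B (\<lambda>x. g (\<phi> x)) v"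
proof -
  interpret A: left_module R A by fact
  interpret B: left_module R B by fact
  have s: "finite {x. v x \<noteq> \<zero>\<^bsub>R\<^esub>}" "{x. v x \<noteq> \<zero>\<^bsub>R\<^esub>} \<subseteq> X" "v x \<in> carrier R" for x
    using v by (auto simp: free_module_def)
  have "g (free_lift R A \<phi> v) = (\<Oplus>\<^bsub>B\<^esub>x\<in>{x. v x \<noteq> \<zero>\<^bsub>R\<^esub>}. g (v x \<odot>\<^bsub>A\<^esub> \<phi> x))"
    unfolding free_lift_def by (rule mod_hom_finsum[OF assms(1-3)]) (use s assms(4) in auto)
  also have "\<dots> = free_lift R B (\<lambda>x. g (\<phi> x)) v"
    unfolding free_lift_def by (rule B.M.finsum_cong')
      (use s assms(4) in \<open>auto simp: mod_hom_smult[OF assms(3)] Pi_iff mod_hom_closed[OF assms(3)]\<close>)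
  finally show ?thesis .
qed

lemma projective_if_split:
  assumes P: "left_module R P" "\<psi> \<in> X \<rightarrow> carrier P"
    and s: "s \<in> mod_hom R P (free_module R X)"
    and split: "\<And>p. p \<in> carrier P \<Longrightarrow> free_lift R P \<psi> (s p) = p"
    and AB: "left_module R A" "left_module R B" "e \<in> mod_hom R A B" "e ` carrier A = carrier B"
    and g: "g \<in> mod_hom R P B"
  shows "\<exists>h \<in> mod_hom R P A. \<forall>x \<in> carrier P. e (h x) = g x"
proof -
  define \<phi> where "\<phi> x = (SOME a. a \<in> carrier A \<and> e a = g (\<psi> x))" for x
  have \<phi>: "\<phi> x \<in> carrier A \<and> e (\<phi> x) = g (\<psi> x)" if "x \<in> X" for x
  proof -
    have "g (\<psi> x) \<in> e ` carrier A" using mod_hom_closed[OF g] P(2) that AB(4) by auto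
    then show ?thesis unfolding \<phi>_def by (intro someI_ex[of "\<lambda>a. a \<in> carrier A \<and> e a = g (\<psi> x)"]) auto
  qed
  then have \<phi>A: "\<phi> \<in> X \<rightarrow> carrier A" by auto
  show ?thesis
  proof (rule bexI[of _ "\<lambda>p. free_lift R A \<phi> (s p)"], intro ballI)
    fix p assume p: "p \<in> carrier P"
    then have sp: "s p \<in> carrier (free_module R X)" by (rule mod_hom_closed[OF s])
    interpret B: left_module R B by fact
    have "e (free_lift R A \<phi> (s p)) = free_lift R B (\<lambda>x. e (\<phi> x)) (s p)"
      by (rule hom_free_lift[OF AB(1-3) \<phi>A sp])
    also have "\<dots> = free_lift R B (\<lambda>x. g (\<psi> x)) (s p)"
      unfolding free_lift_def
      by (rule B.M.finsum_cong')
        (use sp \<phi> P(2) in \<open>auto simp: free_module_simps(1) Pi_iff intro!: B.smult_closed mod_hom_closed[OF g]\<close>)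
    also have "\<dots> = g (free_lift R P \<psi> (s p))"
      by (rule hom_free_lift[OF P(1) AB(2) g P(2) sp, symmetric])
    finally show "e (free_lift R A \<phi> (s p)) = g p" using split[OF p] by simp
  qed (rule mod_hom_comp[OF s free_lift_hom[OF AB(1) \<phi>A]])
qed

lemma projective_moduleD:
  fixes P :: "('r, 'p) module" and A :: "('r, 'a, 'x) module_scheme" and B :: "('r, 'b, 'y) module_scheme"
  assumes P: "projective_module R P"
    and AB: "left_module R A" "left_module R B" "e \<in> mod_hom R A B" "e ` carrier A = carrier B"
    and g: "g \<in> mod_hom R P B"
  shows "\<exists>h \<in> mod_hom R P A. \<forall>x \<in> carrier P. e (h x) = g x"
proof -
  have Pm: "left_module R P" using P by (simp add: projective_module_def)
  interpret P: left_module R P by (rule Pm)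
  let ?F = "free_module R (carrier P)"
  have F: "left_module R ?F" by (rule left_module_free_module) (rule P.ring_axioms)
  have idc: "(\<lambda>p. p) \<in> carrier P \<rightarrow> carrier P" by simp
  have \<pi>: "free_lift R P (\<lambda>p. p) \<in> mod_hom R ?F P" by (rule free_lift_hom[OF Pm idc])
  have "free_lift R P (\<lambda>p. p) ` carrier ?F = carrier P"
  proof
    show "free_lift R P (\<lambda>p. p) ` carrier ?F \<subseteq> carrier P" using mod_hom_closed[OF \<pi>] by auto
    show "carrier P \<subseteq> free_lift R P (\<lambda>p. p) ` carrier ?F"
    proof
      fix p assume "p \<in> carrier P"
      then show "p \<in> free_lift R P (\<lambda>p. p) ` carrier ?F"
        using free_lift_unit[OF Pm idc] free_unit_closed[OF P.ring_axioms] by (metis imageI)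
    qed
  qed
  moreover have "(\<lambda>p. p) \<in> mod_hom R P P" by (auto simp: mod_hom_def)
  ultimately obtain s where "s \<in> mod_hom R P ?F" "\<And>p. p \<in> carrier P \<Longrightarrow> free_lift R P (\<lambda>p. p) (s p) = p"
    using P F Pm \<pi> unfolding projective_module_def by blast
  from projective_if_split[OF Pm idc this AB g] show ?thesis .
qed

lemma projective_free_module:
  assumes "ring R"
  shows "projective_module R (free_module R X)"
proof -
  let ?F = "free_module R X"
  have F: "left_module R ?F" by (rule left_module_free_module[OF assms])
  interpret F: left_module R ?F by (rule F)
  have u: "free_unit R \<in> X \<rightarrow> carrier ?F" using free_unit_closed[OF assms] by auto
  have finsum: "(\<Oplus>\<^bsub>?F\<^esub>x\<in>G. w x) y = (\<Oplus>\<^bsub>R\<^esub>x\<in>G. w x y)"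
    if "finite G" "w \<in> G \<rightarrow> carrier ?F" for G w y
    using that
  proof (induction G)
    case (insert a G)
    then have "(\<lambda>x. w x y) \<in> G \<rightarrow> carrier R" "w a y \<in> carrier R" "w \<in> G \<rightarrow> carrier ?F" "w a \<in> carrier ?F"
      by (auto simp: free_module_simps(1) Pi_iff)
    with insert show ?case
      by (simp add: free_module_simps(2-))
  qed (simp add: free_module_simps)
  have split: "free_lift R ?F (free_unit R) v = v" if v: "v \<in> carrier ?F" for v
  proof
    fix y
    have s: "finite {x. v x \<noteq> \<zero>\<^bsub>R\<^esub>}" "{x. v x \<noteq> \<zero>\<^bsub>R\<^esub>} \<subseteq> X" "v x \<in> carrier R" for x
      using v by (auto simp: free_module_def)
    have "free_lift R ?F (free_unit R) v y
        = (\<Oplus>\<^bsub>R\<^esub>x\<in>{x. v x \<noteq> \<zero>\<^bsub>R\<^esub>}. (v x \<odot>\<^bsub>?F\<^esub> free_unit R x) y)"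
      unfolding free_lift_def by (rule finsum) (use s u in auto)
    also have "\<dots> = (\<Oplus>\<^bsub>R\<^esub>x\<in>{x. v x \<noteq> \<zero>\<^bsub>R\<^esub>}. if y = x then v x else \<zero>\<^bsub>R\<^esub>)"
      by (rule F.R.finsum_cong') (use s in \<open>auto simp: free_module_def free_unit_def\<close>)
    also have "\<dots> = v y"
    proof (cases "v y = \<zero>\<^bsub>R\<^esub>")
      case True
      then have "(\<Oplus>\<^bsub>R\<^esub>x\<in>{x. v x \<noteq> \<zero>\<^bsub>R\<^esub>}. if y = x then v x else \<zero>\<^bsub>R\<^esub>)
          = (\<Oplus>\<^bsub>R\<^esub>x\<in>{x. v x \<noteq> \<zero>\<^bsub>R\<^esub>}. \<zero>\<^bsub>R\<^esub>)"
        by (intro F.R.finsum_cong') auto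
      with True show ?thesis by simp
    next
      case False
      then show ?thesis using F.R.add.finprod_singleton[of y _ v] s by simp
    qed
    finally show "free_lift R ?F (free_unit R) v y = v y" .
  qed
  have "(\<lambda>v. v) \<in> mod_hom R ?F ?F" by (auto simp: mod_hom_def)
  then show ?thesis
    unfolding projective_module_def
    using F projective_if_split[OF F u _ split] by blast
qed

lemma inj_on_syz: "inj_on (syz R) {v. finite {x. v x \<noteq> \<zero>\<^bsub>R\<^esub>}}"
proof (rule inj_onI)
  fix v w :: "('a, 'b) gen \<Rightarrow> 'b"
  assume "v \<in> {v. finite {x. v x \<noteq> \<zero>\<^bsub>R\<^esub>}}" "w \<in> {v. finite {x. v x \<noteq> \<zero>\<^bsub>R\<^esub>}}"
    and eq: "syz R v = syz R w"
  then have fin: "finite {(x, v x) | x. v x \<noteq> \<zero>\<^bsub>R\<^esub>}" "finite {(x, w x) | x. w x \<noteq> \<zero>\<^bsub>R\<^esub>}"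
    by (auto simp: setcompr_eq_image)
  from eq have graph: "{(x, v x) | x. v x \<noteq> \<zero>\<^bsub>R\<^esub>} = {(x, w x) | x. w x \<noteq> \<zero>\<^bsub>R\<^esub>}"
    unfolding syz_def using fin by (simp add: Abs_fset_inject)
  show "v = w"
  proof
    fix x
    show "v x = w x"
    proof (cases "v x = \<zero>\<^bsub>R\<^esub> \<and> w x = \<zero>\<^bsub>R\<^esub>")
      case False
      then have "(x, v x) \<in> {(x, v x) | x. v x \<noteq> \<zero>\<^bsub>R\<^esub>} \<or> (x, w x) \<in> {(x, w x) | x. w x \<noteq> \<zero>\<^bsub>R\<^esub>}"
        by blast
      then have "(x, v x) \<in> {(x, w x) | x. w x \<noteq> \<zero>\<^bsub>R\<^esub>} \<or> (x, w x) \<in> {(x, v x) | x. v x \<noteq> \<zero>\<^bsub>R\<^esub>}"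
        by (simp only: graph)
      then show ?thesis by auto
    qed simp
  qed
qed

lemma unsyz_syz:
  assumes "finite {x. v x \<noteq> \<zero>\<^bsub>R\<^esub>}"
  shows "unsyz R (syz R v) = v"
proof -
  have "v \<in> {v. finite {x. v x \<noteq> \<zero>\<^bsub>R\<^esub>}}" by (rule CollectI, rule assms)
  then show ?thesis unfolding unsyz_def by (rule inv_into_f_f[OF inj_on_syz])
qed

lemma cover_kernel:
  assumes R: "ring R" and B: "left_module R B" and f: "f \<in> mod_hom R (free_module R X) B"
  defines "K \<equiv> a_kernel (free_module R X) B f"
  defines "d \<equiv> free_lift R (free_module R X) (unsyz R)"
  shows "d \<in> mod_hom R (free_module R (syz R ` K)) (free_module R X)"
    and "d ` carrier (free_module R (syz R ` K)) = K"
proof -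
  let ?F = "free_module R X" and ?G = "free_module R (syz R ` K)"
  have F: "left_module R ?F" by (rule left_module_free_module[OF R])
  interpret B: left_module R B by (rule B)
  have K: "k \<in> K \<longleftrightarrow> k \<in> carrier ?F \<and> f k = \<zero>\<^bsub>B\<^esub>" for k
    by (auto simp: K_def a_kernel_def kernel_def)
  have un: "unsyz R (syz R k) = k" if "k \<in> K" for k
    by (rule unsyz_syz) (use that in \<open>simp add: K free_module_simps(1)\<close>)
  have \<phi>: "unsyz R \<in> syz R ` K \<rightarrow> carrier ?F" by (auto simp: un K)
  show d: "d \<in> mod_hom R ?G ?F" unfolding d_def by (rule free_lift_hom[OF F \<phi>])
  show "d ` carrier ?G = K"
  proof
    show "d ` carrier ?G \<subseteq> K"
    proof clarify
      fix v assume v: "v \<in> carrier ?G"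
      have "f (d v) = free_lift R B (\<lambda>x. f (unsyz R x)) v"
        unfolding d_def by (rule hom_free_lift[OF F B f \<phi> v])
      also have "\<dots> = (\<Oplus>\<^bsub>B\<^esub>x\<in>{x. v x \<noteq> \<zero>\<^bsub>R\<^esub>}. \<zero>\<^bsub>B\<^esub>)"
        unfolding free_lift_def
        by (rule B.M.finsum_cong')
          (use v in \<open>auto simp: free_module_simps(1) un K B.smult_r_null\<close>)
      finally have "f (d v) = \<zero>\<^bsub>B\<^esub>" by simp
      then show "d v \<in> K" using mod_hom_closed[OF d v] by (simp add: K)
    qed
    show "K \<subseteq> d ` carrier ?G"
    proof
      fix k assume k: "k \<in> K"
      then have "d (free_unit R (syz R k)) = k"
        unfolding d_def using free_lift_unit[OF F \<phi>] un[OF k] by simp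
      moreover have "free_unit R (syz R k) \<in> carrier ?G" by (rule free_unit_closed[OF R]) (use k in simp)
      ultimately show "k \<in> d ` carrier ?G" by (metis imageI)
    qed
  qed
qed

theorem projective_resolution_std_res:
  assumes "left_module R A"
  shows "projective_resolution R A (std_res R A) (std_diff R A) (std_aug R A)"
proof -
  interpret A: left_module R A by fact
  have R: "ring R" by (rule A.ring_axioms)
  have base: "base \<in> std_gens R A 0 \<rightarrow> carrier A" by auto
  have aug: "std_aug R A \<in> mod_hom R (std_res R A 0) A"
    unfolding std_aug_def std_res_def by (rule free_lift_hom[OF assms base])
  have surj: "std_aug R A ` carrier (std_res R A 0) = carrier A"
  proof
    show "std_aug R A ` carrier (std_res R A 0) \<subseteq> carrier A" using mod_hom_closed[OF aug] by auto
    show "carrier A \<subseteq> std_aug R A ` carrier (std_res R A 0)"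
    proof
      fix a assume "a \<in> carrier A"
      then have "Base a \<in> std_gens R A 0" by simp
      then show "a \<in> std_aug R A ` carrier (std_res R A 0)"
        using free_lift_unit[OF assms base] free_unit_closed[OF R] unfolding std_aug_def std_res_def
        by (metis gen.sel imageI)
    qed
  qed
  have d0: "std_diff R A 0 \<in> mod_hom R (std_res R A 1) (std_res R A 0)"
      "std_diff R A 0 ` carrier (std_res R A 1) = a_kernel (std_res R A 0) A (std_aug R A)"
    using cover_kernel[OF R assms aug[unfolded std_res_def]]
    by (simp_all add: std_res_def std_diff_def std_aug_def)
  have dn: "std_diff R A n \<in> mod_hom R (std_res R A (Suc n)) (std_res R A n)" for n
  proof (induction n)
    case 0
    show ?case using d0 by simp
  next
    case (Suc n)
    show ?case
      using cover_kernel(1)[OF R left_module_free_module[OF R] Suc[unfolded std_res_def]]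
      by (simp add: std_res_def std_diff_def)
  qed
  have "std_diff R A (Suc n) ` carrier (std_res R A (Suc (Suc n)))
      = a_kernel (std_res R A (Suc n)) (std_res R A n) (std_diff R A n)" for n
    using cover_kernel(2)[OF R left_module_free_module[OF R] dn[unfolded std_res_def]]
    by (simp add: std_res_def std_diff_def)
  moreover have "projective_module R (std_res R A n)" for n
    unfolding std_res_def by (rule projective_free_module[OF R])
  ultimately show ?thesis
    unfolding projective_resolution_def using aug surj d0 dn by simp
qed

lemma injective_moduleD:
  fixes I :: "('r, 'i) module" and A :: "('r, 'a, 'x) module_scheme" and B :: "('r, 'b, 'y) module_scheme"
  assumes I: "injective_module R I"
    and A: "left_module R A" and B: "left_module R B"
    and j: "j \<in> mod_hom R A B" "inj_on j (carrier A)"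
    and g: "g \<in> mod_hom R A I"
  shows "\<exists>h \<in> mod_hom R B I. \<forall>x \<in> carrier A. h (j x) = g x"
proof -
  have Im: "left_module R I" using I by (simp add: injective_module_def)
  interpret I: left_module R I by (rule Im)
  interpret A: left_module R A by (rule A)
  interpret B: left_module R B by (rule B)
  define ok where "ok G \<longleftrightarrow> G \<subseteq> carrier B \<times> carrier I \<and>
      (\<forall>x y x' y'. (x, y) \<in> G \<longrightarrow> (x', y') \<in> G \<longrightarrow> (x \<oplus>\<^bsub>B\<^esub> x', y \<oplus>\<^bsub>I\<^esub> y') \<in> G) \<and>
      (\<forall>r x y. r \<in> carrier R \<longrightarrow> (x, y) \<in> G \<longrightarrow> (r \<odot>\<^bsub>B\<^esub> x, r \<odot>\<^bsub>I\<^esub> y) \<in> G) \<and>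
      (\<forall>x y y'. (x, y) \<in> G \<longrightarrow> (x, y') \<in> G \<longrightarrow> y = y') \<and>
      (\<forall>a \<in> carrier A. (j a, g a) \<in> G)" for G
  have okadd: "(x \<oplus>\<^bsub>B\<^esub> x', y \<oplus>\<^bsub>I\<^esub> y') \<in> G" if "ok G" "(x, y) \<in> G" "(x', y') \<in> G" for G x y x' y'
    using that unfolding ok_def by metis
  have oksm: "(r \<odot>\<^bsub>B\<^esub> x, r \<odot>\<^bsub>I\<^esub> y) \<in> G" if "ok G" "(x, y) \<in> G" "r \<in> carrier R" for G x y r
    using that unfolding ok_def by metis
  have okun: "y = y'" if "ok G" "(x, y) \<in> G" "(x, y') \<in> G" for G x y y'
    using that unfolding ok_def by metis
  have okg: "(j a, g a) \<in> G" if "ok G" "a \<in> carrier A" for G a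
    using that unfolding ok_def by metis
  have "\<exists>G \<in> Collect ok. \<forall>G' \<in> Collect ok. G \<subseteq> G' \<longrightarrow> G' = G"
  proof (rule subset_Zorn_nonempty)
    have "ok ((\<lambda>a. (j a, g a)) ` carrier A)"
      unfolding ok_def
    proof (intro conjI allI impI ballI)
      fix x y x' y'
      assume "(x, y) \<in> (\<lambda>a. (j a, g a)) ` carrier A" "(x', y') \<in> (\<lambda>a. (j a, g a)) ` carrier A"
      then obtain a a' where a: "a \<in> carrier A" "a' \<in> carrier A" "x = j a" "y = g a" "x' = j a'" "y' = g a'"
        by auto
      then show "(x \<oplus>\<^bsub>B\<^esub> x', y \<oplus>\<^bsub>I\<^esub> y') \<in> (\<lambda>a. (j a, g a)) ` carrier A"
        by (intro image_eqI[of _ _ "a \<oplus>\<^bsub>A\<^esub> a'"]) (simp_all add: mod_hom_add[OF j(1)] mod_hom_add[OF g])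
    next
      fix r x y assume r: "r \<in> carrier R" and "(x, y) \<in> (\<lambda>a. (j a, g a)) ` carrier A"
      then obtain a where "a \<in> carrier A" "x = j a" "y = g a" by auto
      with r show "(r \<odot>\<^bsub>B\<^esub> x, r \<odot>\<^bsub>I\<^esub> y) \<in> (\<lambda>a. (j a, g a)) ` carrier A"
        by (intro image_eqI[of _ _ "r \<odot>\<^bsub>A\<^esub> a"]) (simp_all add: mod_hom_smult[OF j(1)] mod_hom_smult[OF g])
    next
      show "(\<lambda>a. (j a, g a)) ` carrier A \<subseteq> carrier B \<times> carrier I"
        using mod_hom_closed[OF j(1)] mod_hom_closed[OF g] by auto
    next
      fix x y y' assume "(x, y) \<in> (\<lambda>a. (j a, g a)) ` carrier A" "(x, y') \<in> (\<lambda>a. (j a, g a)) ` carrier A"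
      then show "y = y'" using inj_onD[OF j(2)] by auto
    qed auto
    then show "Collect ok \<noteq> {}" by blast
  next
    fix Ch assume "Ch \<noteq> {}" and "subset.chain (Collect ok) Ch"
    then have ok: "\<And>G. G \<in> Ch \<Longrightarrow> ok G" and lin: "\<And>G G'. G \<in> Ch \<Longrightarrow> G' \<in> Ch \<Longrightarrow> G \<subseteq> G' \<or> G' \<subseteq> G"
      by (auto simp: subset_chain_def)
    have two: "\<exists>G \<in> Ch. p \<in> G \<and> q \<in> G" if "p \<in> \<Union>Ch" "q \<in> \<Union>Ch" for p q
    proof -
      from that obtain G G' where "G \<in> Ch" "p \<in> G" "G' \<in> Ch" "q \<in> G'" by blast
      with lin[of G G'] show ?thesis by blast
    qed
    have "ok (\<Union>Ch)"
      unfolding ok_def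
    proof (intro conjI allI impI ballI)
      show "\<Union>Ch \<subseteq> carrier B \<times> carrier I"
      proof (rule Union_least)
        fix G assume "G \<in> Ch"
        then show "G \<subseteq> carrier B \<times> carrier I" by (rule ok[unfolded ok_def, THEN conjunct1])
      qed
    next
      fix x y x' y' assume "(x, y) \<in> \<Union>Ch" "(x', y') \<in> \<Union>Ch"
      then obtain G where "G \<in> Ch" "(x, y) \<in> G" "(x', y') \<in> G" using two by blast
      then show "(x \<oplus>\<^bsub>B\<^esub> x', y \<oplus>\<^bsub>I\<^esub> y') \<in> \<Union>Ch" using okadd[OF ok] by blast
    next
      fix r x y assume "r \<in> carrier R" "(x, y) \<in> \<Union>Ch"
      then obtain G where "G \<in> Ch" "(x, y) \<in> G" "r \<in> carrier R" by blast
      then show "(r \<odot>\<^bsub>B\<^esub> x, r \<odot>\<^bsub>I\<^esub> y) \<in> \<Union>Ch" using oksm[OF ok] by blast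
    next
      fix x y y' assume "(x, y) \<in> \<Union>Ch" "(x, y') \<in> \<Union>Ch"
      then obtain G where "G \<in> Ch" "(x, y) \<in> G" "(x, y') \<in> G" using two by blast
      then show "y = y'" using okun[OF ok] by blast
    next
      fix a assume "a \<in> carrier A"
      show "(j a, g a) \<in> \<Union>Ch"
      proof -
        from \<open>Ch \<noteq> {}\<close> obtain G where "G \<in> Ch" by blast
        with \<open>a \<in> carrier A\<close> show ?thesis using okg[OF ok] by blast
      qed
    qed
    then show "\<Union>Ch \<in> Collect ok" by simp
  qed
  then obtain G where "ok G" and max: "\<And>G'. ok G' \<Longrightarrow> G \<subseteq> G' \<Longrightarrow> G' = G" by blast
  have Gc: "x \<in> carrier B \<and> y \<in> carrier I" if "(x, y) \<in> G" for x y
    using \<open>ok G\<close>[unfolded ok_def, THEN conjunct1] that by blast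
  note Gadd = okadd[OF \<open>ok G\<close>] and Guniq = okun[OF \<open>ok G\<close>] and Gg = okg[OF \<open>ok G\<close>]
  have Gsm: "(r \<odot>\<^bsub>B\<^esub> x, r \<odot>\<^bsub>I\<^esub> y) \<in> G" if "r \<in> carrier R" "(x, y) \<in> G" for r x y
    by (rule oksm[OF \<open>ok G\<close> that(2,1)])
  have Gzero: "(\<zero>\<^bsub>B\<^esub>, \<zero>\<^bsub>I\<^esub>) \<in> G"
    using Gg[OF A.M.zero_closed] mod_hom_zero[OF A B j(1)] mod_hom_zero[OF A Im g] by simp
  have Gneg: "(\<ominus>\<^bsub>B\<^esub> x, \<ominus>\<^bsub>I\<^esub> y) \<in> G" if "(x, y) \<in> G" for x y
    using Gsm[of "\<ominus>\<^bsub>R\<^esub> \<one>\<^bsub>R\<^esub>", OF _ that] Gc[OF that] by (simp add: B.smult_l_minus I.smult_l_minus)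
  have total: "\<exists>y. (b, y) \<in> G" if b: "b \<in> carrier B" for b
  proof -
    define L where "L = {r \<in> carrier R. \<exists>y. (r \<odot>\<^bsub>B\<^esub> b, y) \<in> G}"
    define t where "t r = (THE y. (r \<odot>\<^bsub>B\<^esub> b, y) \<in> G)" for r
    have t: "(r \<odot>\<^bsub>B\<^esub> b, t r) \<in> G" if "r \<in> L" for r
      unfolding t_def by (rule theI') (use that Guniq in \<open>auto simp: L_def\<close>)
    have t_eq: "t r = y" if "(r \<odot>\<^bsub>B\<^esub> b, y) \<in> G" for r y
      unfolding t_def using that Guniq by blast
    have LI: "r \<in> L" if "r \<in> carrier R" "(r \<odot>\<^bsub>B\<^esub> b, y) \<in> G" for r y
      using that by (auto simp: L_def)
    have LR: "r \<in> L \<Longrightarrow> r \<in> carrier R" for r by (simp add: L_def)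
    have add: "((r \<oplus>\<^bsub>R\<^esub> r') \<odot>\<^bsub>B\<^esub> b, t r \<oplus>\<^bsub>I\<^esub> t r') \<in> G" if "r \<in> L" "r' \<in> L" for r r'
      using Gadd[OF t[OF that(1)] t[OF that(2)]] b LR[OF that(1)] LR[OF that(2)] by (simp add: B.smult_l_distr)
    have sm: "((s \<otimes>\<^bsub>R\<^esub> r) \<odot>\<^bsub>B\<^esub> b, s \<odot>\<^bsub>I\<^esub> t r) \<in> G" if "r \<in> L" "s \<in> carrier R" for r s
      using Gsm[OF that(2) t[OF that(1)]] b LR[OF that(1)] that(2) by (simp add: B.smult_assoc1)
    have Ladd: "r \<oplus>\<^bsub>R\<^esub> r' \<in> L" if "r \<in> L" "r' \<in> L" for r r'
      by (rule LI[OF _ add[OF that]]) (use LR that in simp)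
    have Lsm: "s \<otimes>\<^bsub>R\<^esub> r \<in> L" if "r \<in> L" "s \<in> carrier R" for r s
      by (rule LI[OF _ sm[OF that]]) (use LR that in simp)
    have Lzero: "\<zero>\<^bsub>R\<^esub> \<in> L"
      by (rule LI[of _ "\<zero>\<^bsub>I\<^esub>"]) (use b Gzero in \<open>simp_all add: B.smult_l_null\<close>)
    define reg :: "'r set \<Rightarrow> ('r, 'r) module" where
      "reg J = \<lparr>carrier = J, mult = undefined, one = undefined, zero = \<zero>\<^bsub>R\<^esub>, add = add R, smult = mult R\<rparr>" for J
    have reg: "left_module R (reg J)"
      if "J \<subseteq> carrier R" "\<zero>\<^bsub>R\<^esub> \<in> J" "\<And>r r'. r \<in> J \<Longrightarrow> r' \<in> J \<Longrightarrow> r \<oplus>\<^bsub>R\<^esub> r' \<in> J"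
        "\<And>r s. r \<in> J \<Longrightarrow> s \<in> carrier R \<Longrightarrow> s \<otimes>\<^bsub>R\<^esub> r \<in> J" for J
    proof -
      have c: "r \<in> carrier R" if "r \<in> J" for r using that \<open>J \<subseteq> carrier R\<close> by blast
      have neg: "\<ominus>\<^bsub>R\<^esub> r \<in> J" if "r \<in> J" for r
        using \<open>\<And>r s. r \<in> J \<Longrightarrow> s \<in> carrier R \<Longrightarrow> s \<otimes>\<^bsub>R\<^esub> r \<in> J\<close>[OF that, of "\<ominus>\<^bsub>R\<^esub> \<one>\<^bsub>R\<^esub>"] c[OF that]
        by (simp add: I.R.l_minus)
      have "abelian_group (reg J)"
      proof (rule abelian_groupI)
        fix r assume "r \<in> carrier (reg J)"
        then have r: "r \<in> J" by (simp add: reg_def)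
        show "\<exists>s\<in>carrier (reg J). s \<oplus>\<^bsub>reg J\<^esub> r = \<zero>\<^bsub>reg J\<^esub>"
          by (rule bexI[of _ "\<ominus>\<^bsub>R\<^esub> r"]) (use r neg c in \<open>simp_all add: reg_def I.R.l_neg\<close>)
      qed (simp_all add: reg_def that c I.R.a_ac)
      moreover have "left_module_axioms R (reg J)"
        by (rule left_module_axioms.intro)
          (simp_all add: reg_def that c I.R.l_distr I.R.r_distr I.R.m_assoc)
      ultimately show ?thesis by (simp add: left_module_def I.ring_axioms)
    qed
    have "left_module R (reg L)" by (rule reg) (use LR Lzero Ladd Lsm in auto)
    moreover have "left_module R (reg (carrier R))" by (rule reg) auto
    moreover have "(\<lambda>r. r) \<in> mod_hom R (reg L) (reg (carrier R))"
      by (rule mod_homI) (simp_all add: reg_def LR)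
    moreover have "inj_on (\<lambda>r. r) (carrier (reg L))" by simp
    moreover have "t \<in> mod_hom R (reg L) I"
      by (rule mod_homI) (use t Gc add sm in \<open>auto simp: reg_def intro!: t_eq\<close>)
    ultimately have "\<exists>u \<in> mod_hom R (reg (carrier R)) I. \<forall>r \<in> carrier (reg L). u r = t r"
      using I[unfolded injective_module_def, THEN conjunct2, rule_format,
          of "reg L" "reg (carrier R)" "\<lambda>r. r" t] by blast
    then obtain u where u: "u \<in> mod_hom R (reg (carrier R)) I" "\<And>r. r \<in> L \<Longrightarrow> u r = t r"
      by (auto simp: reg_def)
    define y0 where "y0 = u \<one>\<^bsub>R\<^esub>"
    have y0: "y0 \<in> carrier I" unfolding y0_def by (rule mod_hom_closed[OF u(1)]) (simp add: reg_def)
    have Gy0: "(r \<odot>\<^bsub>B\<^esub> b, r \<odot>\<^bsub>I\<^esub> y0) \<in> G" if "r \<in> L" for r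
    proof -
      have "u (r \<otimes>\<^bsub>R\<^esub> \<one>\<^bsub>R\<^esub>) = r \<odot>\<^bsub>I\<^esub> y0"
        unfolding y0_def using mod_hom_smult[OF u(1), of r "\<one>\<^bsub>R\<^esub>"] LR[OF that] by (simp add: reg_def)
      then show ?thesis using t[OF that] u(2)[OF that] LR[OF that] by simp
    qed
    define G' where "G' = {(x \<oplus>\<^bsub>B\<^esub> r \<odot>\<^bsub>B\<^esub> b, y \<oplus>\<^bsub>I\<^esub> r \<odot>\<^bsub>I\<^esub> y0) | x y r. (x, y) \<in> G \<and> r \<in> carrier R}"
    have G'I: "(x \<oplus>\<^bsub>B\<^esub> r \<odot>\<^bsub>B\<^esub> b, y \<oplus>\<^bsub>I\<^esub> r \<odot>\<^bsub>I\<^esub> y0) \<in> G'" if "(x, y) \<in> G" "r \<in> carrier R" for x y r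
      using that unfolding G'_def by blast
    have sub: "G \<subseteq> G'"
    proof clarify
      fix x y assume "(x, y) \<in> G"
      with G'I[OF this I.R.zero_closed] show "(x, y) \<in> G'"
        using Gc[of x y] b y0 by (simp add: B.smult_l_null I.smult_l_null)
    qed
    have "ok G'"
      unfolding ok_def
    proof (intro conjI allI impI ballI)
      show "G' \<subseteq> carrier B \<times> carrier I" using Gc b y0 by (auto simp: G'_def)
    next
      fix x y x' y' assume "(x, y) \<in> G'" "(x', y') \<in> G'"
      then obtain p q r p' q' r' where *: "x = p \<oplus>\<^bsub>B\<^esub> r \<odot>\<^bsub>B\<^esub> b" "y = q \<oplus>\<^bsub>I\<^esub> r \<odot>\<^bsub>I\<^esub> y0" "(p, q) \<in> G" "r \<in> carrier R"
        "x' = p' \<oplus>\<^bsub>B\<^esub> r' \<odot>\<^bsub>B\<^esub> b" "y' = q' \<oplus>\<^bsub>I\<^esub> r' \<odot>\<^bsub>I\<^esub> y0" "(p', q') \<in> G" "r' \<in> carrier R"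
        unfolding G'_def by blast
      have "x \<oplus>\<^bsub>B\<^esub> x' = (p \<oplus>\<^bsub>B\<^esub> p') \<oplus>\<^bsub>B\<^esub> (r \<oplus>\<^bsub>R\<^esub> r') \<odot>\<^bsub>B\<^esub> b"
        using * Gc[OF *(3)] Gc[OF *(7)] b by (simp add: B.smult_l_distr B.M.a_ac)
      moreover have "y \<oplus>\<^bsub>I\<^esub> y' = (q \<oplus>\<^bsub>I\<^esub> q') \<oplus>\<^bsub>I\<^esub> (r \<oplus>\<^bsub>R\<^esub> r') \<odot>\<^bsub>I\<^esub> y0"
        using * Gc[OF *(3)] Gc[OF *(7)] y0 by (simp add: I.smult_l_distr I.M.a_ac)
      ultimately show "(x \<oplus>\<^bsub>B\<^esub> x', y \<oplus>\<^bsub>I\<^esub> y') \<in> G'"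
        using G'I[OF Gadd[OF *(3,7)], of "r \<oplus>\<^bsub>R\<^esub> r'"] * by simp
    next
      fix s x y assume s: "s \<in> carrier R" and "(x, y) \<in> G'"
      then obtain p q r where *: "x = p \<oplus>\<^bsub>B\<^esub> r \<odot>\<^bsub>B\<^esub> b" "y = q \<oplus>\<^bsub>I\<^esub> r \<odot>\<^bsub>I\<^esub> y0" "(p, q) \<in> G" "r \<in> carrier R"
        unfolding G'_def by blast
      then show "(s \<odot>\<^bsub>B\<^esub> x, s \<odot>\<^bsub>I\<^esub> y) \<in> G'"
        using G'I[OF Gsm[OF s *(3)], of "s \<otimes>\<^bsub>R\<^esub> r"] s Gc[OF *(3)] b y0
        by (simp add: B.smult_r_distr I.smult_r_distr B.smult_assoc1 I.smult_assoc1)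
    next
      fix x y y' assume "(x, y) \<in> G'" "(x, y') \<in> G'"
      then obtain p q r p' q' r' where *: "x = p \<oplus>\<^bsub>B\<^esub> r \<odot>\<^bsub>B\<^esub> b" "y = q \<oplus>\<^bsub>I\<^esub> r \<odot>\<^bsub>I\<^esub> y0" "(p, q) \<in> G" "r \<in> carrier R"
        "x = p' \<oplus>\<^bsub>B\<^esub> r' \<odot>\<^bsub>B\<^esub> b" "y' = q' \<oplus>\<^bsub>I\<^esub> r' \<odot>\<^bsub>I\<^esub> y0" "(p', q') \<in> G" "r' \<in> carrier R"
        unfolding G'_def by blast
      note c = Gc[OF *(3)] Gc[OF *(7)] *(4,8) b y0
      let ?s = "r \<oplus>\<^bsub>R\<^esub> \<ominus>\<^bsub>R\<^esub> r'"
      have s: "?s \<in> carrier R" using c by simp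
      have diff: "(p' \<oplus>\<^bsub>B\<^esub> \<ominus>\<^bsub>B\<^esub> p, q' \<oplus>\<^bsub>I\<^esub> \<ominus>\<^bsub>I\<^esub> q) \<in> G" by (rule Gadd[OF *(7) Gneg[OF *(3)]])
      have "?s \<odot>\<^bsub>B\<^esub> b = r \<odot>\<^bsub>B\<^esub> b \<oplus>\<^bsub>B\<^esub> \<ominus>\<^bsub>B\<^esub> (r' \<odot>\<^bsub>B\<^esub> b)"
        using c by (simp add: B.smult_l_distr B.smult_l_minus)
      also have "\<dots> = p' \<oplus>\<^bsub>B\<^esub> \<ominus>\<^bsub>B\<^esub> p"
      proof -
        have "r \<odot>\<^bsub>B\<^esub> b = \<ominus>\<^bsub>B\<^esub> p \<oplus>\<^bsub>B\<^esub> (p' \<oplus>\<^bsub>B\<^esub> r' \<odot>\<^bsub>B\<^esub> b)"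
          using *(1,5) c by (metis B.M.r_neg1 B.smult_closed)
        also have "\<dots> = (p' \<oplus>\<^bsub>B\<^esub> \<ominus>\<^bsub>B\<^esub> p) \<oplus>\<^bsub>B\<^esub> r' \<odot>\<^bsub>B\<^esub> b"
          using c by (simp add: B.M.a_ac)
        finally show ?thesis using c by (simp add: B.M.a_assoc B.M.r_neg)
      qed
      finally have eq: "?s \<odot>\<^bsub>B\<^esub> b = p' \<oplus>\<^bsub>B\<^esub> \<ominus>\<^bsub>B\<^esub> p" .
      have "?s \<in> L" by (rule LI[OF s]) (use diff eq in simp)
      from Gy0[OF this] have "?s \<odot>\<^bsub>I\<^esub> y0 = q' \<oplus>\<^bsub>I\<^esub> \<ominus>\<^bsub>I\<^esub> q"
        using diff eq Guniq by metis
      then have e2: "r \<odot>\<^bsub>I\<^esub> y0 \<oplus>\<^bsub>I\<^esub> \<ominus>\<^bsub>I\<^esub> (r' \<odot>\<^bsub>I\<^esub> y0) = q' \<oplus>\<^bsub>I\<^esub> \<ominus>\<^bsub>I\<^esub> q"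
        using c by (simp add: I.smult_l_distr I.smult_l_minus)
      have "y = q \<oplus>\<^bsub>I\<^esub> (r \<odot>\<^bsub>I\<^esub> y0 \<oplus>\<^bsub>I\<^esub> \<ominus>\<^bsub>I\<^esub> (r' \<odot>\<^bsub>I\<^esub> y0)) \<oplus>\<^bsub>I\<^esub> r' \<odot>\<^bsub>I\<^esub> y0"
        using c by (simp add: *(2) I.M.a_assoc I.M.l_neg)
      also have "\<dots> = q \<oplus>\<^bsub>I\<^esub> (q' \<oplus>\<^bsub>I\<^esub> \<ominus>\<^bsub>I\<^esub> q) \<oplus>\<^bsub>I\<^esub> r' \<odot>\<^bsub>I\<^esub> y0" by (simp only: e2)
      also have "q \<oplus>\<^bsub>I\<^esub> (q' \<oplus>\<^bsub>I\<^esub> \<ominus>\<^bsub>I\<^esub> q) = q'"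
        using c by (metis I.M.a_comm I.M.a_inv_closed I.M.r_neg2)
      finally show "y = y'" by (simp add: *(6))
    next
      fix a assume "a \<in> carrier A"
      then show "(j a, g a) \<in> G'" using Gg sub by blast
    qed
    then have "G' = G" using max sub by blast
    moreover have "(b, y0) \<in> G'"
      using G'I[OF Gzero I.R.one_closed] b y0 by simp
    ultimately show ?thesis by blast
  qed
  define h where "h b = (THE y. (b, y) \<in> G)" for b
  have h: "(b, h b) \<in> G" if "b \<in> carrier B" for b
    unfolding h_def by (rule theI') (use total[OF that] Guniq in blast)
  have h_eq: "h b = y" if "(b, y) \<in> G" for b y
    unfolding h_def using that Guniq by blast
  have "h \<in> mod_hom R B I"
    by (rule mod_homI) (use h Gc Gadd Gsm in \<open>auto intro!: h_eq\<close>)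
  moreover have "h (j x) = g x" if "x \<in> carrier A" for x by (rule h_eq[OF Gg[OF that]])
  ultimately show ?thesis by blast
qed


section \<open>Hom and Ext\<close>

definition hom_group ::
  "'r ring \<Rightarrow> ('r, 'a, 'x) module_scheme \<Rightarrow> ('r, 'b, 'y) module_scheme \<Rightarrow> ('a \<Rightarrow> 'b) monoid" where
  "hom_group R A B =
     \<lparr>carrier = mod_hom R A B \<inter> extensional (carrier A),
      mult = (\<lambda>f g. \<lambda>x \<in> carrier A. f x \<oplus>\<^bsub>B\<^esub> g x),
      one = (\<lambda>x \<in> carrier A. \<zero>\<^bsub>B\<^esub>)\<rparr>"

definition ext_diff ::
  "'r ring \<Rightarrow> ('r, 'a, 'x) module_scheme \<Rightarrow> nat \<Rightarrow>
   ((('a, 'r) gen \<Rightarrow> 'r) \<Rightarrow> 'b) \<Rightarrow> (('a, 'r) gen \<Rightarrow> 'r) \<Rightarrow> 'b" where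
  "ext_diff R A n \<phi> = (\<lambda>v \<in> carrier (std_res R A (Suc n)). \<phi> (std_diff R A n v))"

text \<open>\<open>Ext R A B i\<close> is the \<open>i\<close>-th cohomology group of \<open>Hom\<^sub>R(P\<^sub>\<bullet>, B)\<close>, \<open>P\<^sub>\<bullet>\<close> the standard resolution of \<open>A\<close>.\<close>

definition Ext ::
  "'r ring \<Rightarrow> ('r, 'a, 'x) module_scheme \<Rightarrow> ('r, 'b, 'y) module_scheme \<Rightarrow> nat \<Rightarrow>
   ((('a, 'r) gen \<Rightarrow> 'r) \<Rightarrow> 'b) set monoid" where
  "Ext R A B i =
     (let H = (\<lambda>n. hom_group R (std_res R A n) B)
      in (H i)\<lparr>carrier := kernel (H i) (H (Suc i)) (ext_diff R A i)\<rparr> Mod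
           (case i of 0 \<Rightarrow> {\<one>\<^bsub>H 0\<^esub>} | Suc j \<Rightarrow> ext_diff R A j ` carrier (H j)))"


section \<open>Tensor products and Tor\<close>

text \<open>
  \<open>tensor S A N\<close> is the abelian group \<open>A \<otimes>\<^sub>S N\<close>, written multiplicatively, for a right \<open>S\<close>-module \<open>A\<close>
  (so \<open>s \<odot>\<^bsub>A\<^esub> a\<close> is \<open>as\<close>) and a left \<open>S\<close>-module \<open>N\<close>.
\<close>

definition tensor_rels ::
  "'s ring \<Rightarrow> ('s, 'a, 'x) module_scheme \<Rightarrow> ('s, 'n, 'y) module_scheme \<Rightarrow> ('a \<times> 'n \<Rightarrow>\<^sub>0 int) set" where
  "tensor_rels S A N =
     {frag_of (a \<oplus>\<^bsub>A\<^esub> a', n) - frag_of (a, n) - frag_of (a', n) | a a' n.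
        a \<in> carrier A \<and> a' \<in> carrier A \<and> n \<in> carrier N} \<union>
     {frag_of (a, n \<oplus>\<^bsub>N\<^esub> n') - frag_of (a, n) - frag_of (a, n') | a n n'.
        a \<in> carrier A \<and> n \<in> carrier N \<and> n' \<in> carrier N} \<union>
     {frag_of (s \<odot>\<^bsub>A\<^esub> a, n) - frag_of (a, s \<odot>\<^bsub>N\<^esub> n) | s a n.
        s \<in> carrier S \<and> a \<in> carrier A \<and> n \<in> carrier N}"

definition tensor_null ::
  "'s ring \<Rightarrow> ('s, 'a, 'x) module_scheme \<Rightarrow> ('s, 'n, 'y) module_scheme \<Rightarrow> ('a \<times> 'n \<Rightarrow>\<^sub>0 int) set" where
  "tensor_null S A N =
     generate (free_Abelian_group (carrier A \<times> carrier N)) (tensor_rels S A N)"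

definition tensor ::
  "'s ring \<Rightarrow> ('s, 'a, 'x) module_scheme \<Rightarrow> ('s, 'n, 'y) module_scheme \<Rightarrow>
   ('a \<times> 'n \<Rightarrow>\<^sub>0 int) set monoid" where
  "tensor S A N = free_Abelian_group (carrier A \<times> carrier N) Mod tensor_null S A N"

text \<open>\<open>tensor_map S A' N f\<close> is \<open>f \<otimes> N : A \<otimes>\<^sub>S N \<rightarrow> A' \<otimes>\<^sub>S N\<close> for \<open>f : A \<rightarrow> A'\<close>.\<close>

definition tensor_map ::
  "'s ring \<Rightarrow> ('s, 'b, 'x) module_scheme \<Rightarrow> ('s, 'n, 'y) module_scheme \<Rightarrow> ('a \<Rightarrow> 'b) \<Rightarrow>
   ('a \<times> 'n \<Rightarrow>\<^sub>0 int) set \<Rightarrow> ('b \<times> 'n \<Rightarrow>\<^sub>0 int) set" where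
  "tensor_map S A' N f X =
     (\<Union>z\<in>X. tensor_null S A' N #>\<^bsub>free_Abelian_group (carrier A' \<times> carrier N)\<^esub>
        frag_extend (\<lambda>(a, n). frag_of (f a, n)) z)"

text \<open>
  \<open>Tor S A N i\<close> is the \<open>i\<close>-th homology group of \<open>P\<^sub>\<bullet> \<otimes>\<^sub>S N\<close>, \<open>P\<^sub>\<bullet>\<close> the standard resolution of the
  right \<open>S\<close>-module \<open>A\<close>.
\<close>

definition Tor ::
  "'s ring \<Rightarrow> ('s, 'a, 'x) module_scheme \<Rightarrow> ('s, 'n, 'y) module_scheme \<Rightarrow> nat \<Rightarrow>
   ((('a, 's) gen \<Rightarrow> 's) \<times> 'n \<Rightarrow>\<^sub>0 int) set set monoid" where
  "Tor S A N i =
     (let P = std_res (opp_ring S) A;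
          T = (\<lambda>n. tensor S (P n) N);
          \<delta> = (\<lambda>n. tensor_map S (P n) N (std_diff (opp_ring S) A n))
      in (T i)\<lparr>carrier := (case i of 0 \<Rightarrow> carrier (T 0) | Suc j \<Rightarrow> kernel (T i) (T j) (\<delta> j))\<rparr> Mod
           (\<delta> i ` carrier (T (Suc i))))"


section \<open>Semidualizing bimodules\<close>

text \<open>The record itself is the left \<open>R\<close>-module; \<^term>\<open>rsmult\<close> is the right action of \<open>S\<close>.\<close>

record ('r, 's, 'c) bimodule = "('r, 'c) module" +
  rsmult :: "'c \<Rightarrow> 's \<Rightarrow> 'c"

definition right_module :: "('r, 's, 'c) bimodule \<Rightarrow> ('s, 'c) module" where
  "right_module C = module_of_group (add_monoid C) (\<lambda>s x. rsmult C x s)"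

definition is_bimodule :: "'r ring \<Rightarrow> 's ring \<Rightarrow> ('r, 's, 'c) bimodule \<Rightarrow> bool" where
  "is_bimodule R S C \<longleftrightarrow>
     left_module R C \<and> left_module (opp_ring S) (right_module C) \<and>
     (\<forall>r \<in> carrier R. \<forall>x \<in> carrier C. \<forall>s \<in> carrier S.
        rsmult C (r \<odot>\<^bsub>C\<^esub> x) s = r \<odot>\<^bsub>C\<^esub> rsmult C x s)"

definition left_homothety :: "('r, 's, 'c) bimodule \<Rightarrow> 'r \<Rightarrow> 'c \<Rightarrow> 'c" where
  "left_homothety C r = (\<lambda>x \<in> carrier C. r \<odot>\<^bsub>C\<^esub> x)"

definition right_homothety :: "('r, 's, 'c) bimodule \<Rightarrow> 's \<Rightarrow> 'c \<Rightarrow> 'c" where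
  "right_homothety C s = (\<lambda>x \<in> carrier C. rsmult C x s)"

definition semidualizing :: "'r ring \<Rightarrow> 's ring \<Rightarrow> ('r, 's, 'c) bimodule \<Rightarrow> bool" where
  "semidualizing R S C \<longleftrightarrow> is_bimodule R S C \<and>
     has_fg_projective_resolution R C \<and>
     has_fg_projective_resolution (opp_ring S) (right_module C) \<and>
     left_homothety C \<in> iso (add_monoid R) (hom_group (opp_ring S) (right_module C) (right_module C)) \<and>
     right_homothety C \<in> iso (add_monoid S) (hom_group R C C) \<and>
     (\<forall>i\<ge>1. trivial_group (Ext R C C i)) \<and>
     (\<forall>i\<ge>1. trivial_group (Ext (opp_ring S) (right_module C) (right_module C) i))"


section \<open>The Bass class and cotorsionfree modules\<close>

text \<open>\<open>star R C M\<close> is the left \<open>S\<close>-module \<open>M\<^sub>* = Hom\<^sub>R(C, M)\<close>, with \<open>(sf)(x) = f(xs)\<close>.\<close>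

definition star ::
  "'r ring \<Rightarrow> ('r, 's, 'c) bimodule \<Rightarrow> ('r, 'm) module \<Rightarrow> ('s, 'c \<Rightarrow> 'm) module" where
  "star R C M = module_of_group (hom_group R C M) (\<lambda>s f. \<lambda>x \<in> carrier C. f (rsmult C x s))"

definition star_map :: "('r, 's, 'c) bimodule \<Rightarrow> ('m \<Rightarrow> 'k) \<Rightarrow> ('c \<Rightarrow> 'm) \<Rightarrow> 'c \<Rightarrow> 'k" where
  "star_map C g f = (\<lambda>x \<in> carrier C. g (f x))"

definition tensor_left_module ::
  "'s ring \<Rightarrow> ('r, 's, 'c) bimodule \<Rightarrow> ('s, 'n) module \<Rightarrow> ('r, ('c \<times> 'n \<Rightarrow>\<^sub>0 int) set) module" where
  "tensor_left_module S C N =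
     module_of_group (tensor S (right_module C) N)
       (\<lambda>r. tensor_map S (right_module C) N (\<lambda>x. r \<odot>\<^bsub>C\<^esub> x))"

text \<open>
  An element of the tensor product is a coset of formal sums of pairs; all representatives
  have the same value \<open>\<Sum> k\<^sub>i f\<^sub>i(x\<^sub>i)\<close>, which is the value of \<open>\<theta>\<^sub>M\<close>.
\<close>

definition theta :: "('r, 'm) module \<Rightarrow> ('c \<times> ('c \<Rightarrow> 'm) \<Rightarrow>\<^sub>0 int) set \<Rightarrow> 'm" where
  "theta M X = the_elem
     ((\<lambda>z. \<Oplus>\<^bsub>M\<^esub>p \<in> Poly_Mapping.keys z. [Poly_Mapping.lookup z p] \<cdot>\<^bsub>M\<^esub> (snd p (fst p))) ` X)"

definition Bass_class ::
  "'r ring \<Rightarrow> 's ring \<Rightarrow> ('r, 's, 'c) bimodule \<Rightarrow> ('r, 'm) module set" where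
  "Bass_class R S C = {M. left_module R M \<and>
     (\<forall>i\<ge>1. trivial_group (Ext R C M i)) \<and>
     (\<forall>i\<ge>1. trivial_group (Tor S (right_module C) (star R C M) i)) \<and>
     theta M \<in> mod_iso R (tensor_left_module S C (star R C M)) M}"

definition cospherical :: "'r ring \<Rightarrow> ('r, 's, 'c) bimodule \<Rightarrow> nat \<Rightarrow> ('r, 'm) module \<Rightarrow> bool" where
  "cospherical R C n M \<longleftrightarrow> (\<forall>i. 1 \<le> i \<and> i \<le> n \<longrightarrow> trivial_group (Ext R C M i))"

definition inf_cospherical :: "'r ring \<Rightarrow> ('r, 's, 'c) bimodule \<Rightarrow> ('r, 'm) module \<Rightarrow> bool" where
  "inf_cospherical R C M \<longleftrightarrow> (\<forall>n\<ge>1. cospherical R C n M)"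

text \<open>
  The cotranspose depends on the minimal injective resolution of the module, which is unique only
  up to isomorphism; it and the notions derived from it take the resolution \<open>(I, f)\<close> as argument.
\<close>

definition cTr ::
  "'r ring \<Rightarrow> ('r, 's, 'c) bimodule \<Rightarrow> (nat \<Rightarrow> ('r, 'i) module) \<Rightarrow> (nat \<Rightarrow> 'i \<Rightarrow> 'i) \<Rightarrow>
   ('s, ('c \<Rightarrow> 'i) set) module" where
  "cTr R C I f = quot_module (star R C (I 1)) (star_map C (f 0) ` carrier (star R C (I 0)))"

definition cotorsionfree ::
  "'r ring \<Rightarrow> 's ring \<Rightarrow> ('r, 's, 'c) bimodule \<Rightarrow> nat \<Rightarrow>
   (nat \<Rightarrow> ('r, 'i) module) \<Rightarrow> (nat \<Rightarrow> 'i \<Rightarrow> 'i) \<Rightarrow> bool" where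
  "cotorsionfree R S C n I f \<longleftrightarrow>
     (\<forall>i. 1 \<le> i \<and> i \<le> n \<longrightarrow> trivial_group (Tor S (right_module C) (cTr R C I f) i))"

definition inf_cotorsionfree ::
  "'r ring \<Rightarrow> 's ring \<Rightarrow> ('r, 's, 'c) bimodule \<Rightarrow>
   (nat \<Rightarrow> ('r, 'i) module) \<Rightarrow> (nat \<Rightarrow> 'i \<Rightarrow> 'i) \<Rightarrow> bool" where
  "inf_cotorsionfree R S C I f \<longleftrightarrow> (\<forall>n\<ge>1. cotorsionfree R S C n I f)"

end

theory Submission
  imports Defs
begin

text \<open>
  The sequence \<open>0 \<rightarrow> M\<^sub>* \<rightarrow> I\<^sup>0\<^sub>* \<rightarrow> I\<^sup>1\<^sub>* \<rightarrow> cTr M \<rightarrow> 0\<close> is exact, and its two middle terms are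
  Tor-acyclic with bijective \<open>\<theta>\<close>.  Dimension shifting through the image of \<open>I\<^sup>0\<^sub>*\<close> in \<open>I\<^sup>1\<^sub>*\<close> then identifies
  \<open>Tor\<^sub>1(C, cTr M)\<close> with the cokernel of \<open>\<theta>\<^sub>M\<close>, \<open>Tor\<^sub>2(C, cTr M)\<close> with its kernel, and
  \<open>Tor\<^sub>i\<^sub>+\<^sub>2(C, cTr M)\<close> with \<open>Tor\<^sub>i(C, M\<^sub>*)\<close>.  For an injective \<open>I\<close> the acyclicity of \<open>I\<^sub>*\<close> comes from the
  isomorphism \<open>P \<otimes> Hom(C, I) \<cong> Hom(Hom(P, C), I)\<close> for finitely generated projective \<open>P\<close> and from
  \<open>Ext(C, C) = 0\<close>; a comparison of resolutions transfers it to the standard resolution.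

  Tensor products are handled through formal sums of pairs modulo \<^const>\<open>tensor_null\<close>: an equation in
  the tensor product is the statement that a difference of formal sums lies in the null subgroup.
\<close>

section \<open>Formal sums of pairs\<close>

text \<open>Why the low Tor groups see \<open>theta\<close>: let L be the image of Hom(C,I^0) in
  Hom(C,I^1). As \<open>theta\<close> is natural and bijective at I^0 and I^1, the map C \<otimes>
  Hom(C,M) -> C \<otimes> Hom(C,I^0) becomes \<open>theta\<close> at M followed by the embedding of
  M in I^0, so both have the same kernel. Likewise C \<otimes> L is I^0 modulo the image of C
  \<otimes> Hom(C,M), while the kernel of I^0 -> I^1 is M; so C \<otimes> L -> C \<otimes>
  Hom(C,I^1) is injective exactly when \<open>theta\<close> at M is onto. The obstacle is that Ext
  and Tor are computed from the standard free resolution, whose terms are rarely finitely generated,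
  whereas surjectivity of P \<otimes> Hom(C,I) -> Hom(Hom(P,C),I) is obtained from a finite dual
  basis of P. Hence the vanishing of Ext(C,C) is moved from the standard resolution to a finitely
  generated one, exactness is proved there, and the vanishing of Tor is moved back.\<close>

lemma opp_ring_simps [simp]:
  "carrier (opp_ring S) = carrier S" "\<zero>\<^bsub>opp_ring S\<^esub> = \<zero>\<^bsub>S\<^esub>" "\<one>\<^bsub>opp_ring S\<^esub> = \<one>\<^bsub>S\<^esub>"
  "x \<oplus>\<^bsub>opp_ring S\<^esub> y = x \<oplus>\<^bsub>S\<^esub> y" "x \<otimes>\<^bsub>opp_ring S\<^esub> y = y \<otimes>\<^bsub>S\<^esub> x"
  by (simp_all add: opp_ring_def)

lemma left_module_abelian_group: "left_module R M \<Longrightarrow> abelian_group M"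
  by (simp add: left_module_def)

lemma left_module_zero_closed: "left_module R M \<Longrightarrow> \<zero>\<^bsub>M\<^esub> \<in> carrier M"
  by (rule abelian_monoid.zero_closed) (simp add: left_module_def abelian_group_def)

definition frags :: "('s, 'a, 'x) module_scheme \<Rightarrow> ('t, 'n, 'y) module_scheme \<Rightarrow> ('a \<times> 'n \<Rightarrow>\<^sub>0 int) set" where
  "frags A N = {z. Poly_Mapping.keys z \<subseteq> carrier A \<times> carrier N}"

text \<open>The map f \<otimes> g on representatives. It is additive for arbitrary functions f and
  g, so it may also be applied to set-theoretic sections that are not linear.\<close>

definition frag_map :: "('a \<Rightarrow> 'b) \<Rightarrow> ('n \<Rightarrow> 'k) \<Rightarrow> ('a \<times> 'n \<Rightarrow>\<^sub>0 int) \<Rightarrow> ('b \<times> 'k \<Rightarrow>\<^sub>0 int)" where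
  "frag_map f g = frag_extend (\<lambda>(a, n). frag_of (f a, g n))"

lemma frags_of [simp]: "frag_of (a, n) \<in> frags A N \<longleftrightarrow> a \<in> carrier A \<and> n \<in> carrier N"
  by (simp add: frags_def)

lemma frags_0 [simp]: "0 \<in> frags A N" by (simp add: frags_def)

lemma frags_add: "z \<in> frags A N \<Longrightarrow> w \<in> frags A N \<Longrightarrow> z + w \<in> frags A N"
  unfolding frags_def using keys_add by fastforce

lemma frags_minus [simp]: "- z \<in> frags A N \<longleftrightarrow> z \<in> frags A N"
  by (simp add: frags_def)

lemma frags_diff: "z \<in> frags A N \<Longrightarrow> w \<in> frags A N \<Longrightarrow> z - w \<in> frags A N"
  unfolding frags_def using keys_diff by fastforce

lemma frags_sum: "(\<And>x. x \<in> G \<Longrightarrow> h x \<in> frags A N) \<Longrightarrow> sum h G \<in> frags A N"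
  by (induction G rule: infinite_finite_induct) (auto simp: frags_add)

lemma frags_induct [consumes 1, case_names zero of diff]:
  assumes "z \<in> frags A N" "P 0" "\<And>a n. a \<in> carrier A \<Longrightarrow> n \<in> carrier N \<Longrightarrow> P (frag_of (a, n))"
    and "\<And>z w. z \<in> frags A N \<Longrightarrow> w \<in> frags A N \<Longrightarrow> P z \<Longrightarrow> P w \<Longrightarrow> P (z - w)"
  shows "P z"
  by (rule free_Abelian_group_induct[of z "carrier A \<times> carrier N"])
    (use assms in \<open>auto simp: frags_def\<close>)

lemma frag_map_simps [simp]:
  "frag_map f g 0 = 0" "frag_map f g (frag_of (a, n)) = frag_of (f a, g n)"
  "frag_map f g (- z) = - frag_map f g z"
  "frag_map f g (z + w) = frag_map f g z + frag_map f g w"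
  "frag_map f g (z - w) = frag_map f g z - frag_map f g w"
  by (simp_all add: frag_map_def frag_extend_minus frag_extend_add frag_extend_diff)

lemma frag_map_sum: "frag_map f g (sum h G) = (\<Sum>x\<in>G. frag_map f g (h x))"
  by (induction G rule: infinite_finite_induct) auto

lemma frag_map_frags:
  assumes "z \<in> frags A N" "\<And>a. a \<in> carrier A \<Longrightarrow> f a \<in> carrier A'" "\<And>n. n \<in> carrier N \<Longrightarrow> g n \<in> carrier N'"
  shows "frag_map f g z \<in> frags A' N'"
  using assms(1) by (induction rule: frags_induct) (auto simp: assms(2,3) frags_diff)

lemma frag_map_comp:
  "frag_map f' g' (frag_map f g z) = frag_map (\<lambda>x. f' (f x)) (\<lambda>x. g' (g x)) z"
  by (rule frag_induction[of z UNIV]) auto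

lemma frag_map_cong:
  assumes "z \<in> frags A N" "\<And>a. a \<in> carrier A \<Longrightarrow> f a = f' a" "\<And>n. n \<in> carrier N \<Longrightarrow> g n = g' n"
  shows "frag_map f g z = frag_map f' g' z"
  using assms(1) by (induction rule: frags_induct) (auto simp: assms(2,3))

lemma frag_map_ident: "z \<in> frags A N \<Longrightarrow> (\<And>a. a \<in> carrier A \<Longrightarrow> f a = a) \<Longrightarrow>
    (\<And>n. n \<in> carrier N \<Longrightarrow> g n = n) \<Longrightarrow> frag_map f g z = z"
  by (induction rule: frags_induct) auto

lemma frag_map_surj:
  assumes "z \<in> frags A' N'" "f ` carrier A = carrier A'" "g ` carrier N = carrier N'"
  shows "\<exists>w \<in> frags A N. frag_map f g w = z"
  using assms(1)
proof (induction rule: frags_induct)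
  case zero show ?case by (rule bexI[of _ 0]) auto
next
  case (of a n)
  then obtain b m where "b \<in> carrier A" "m \<in> carrier N" "a = f b" "n = g m" using assms by blast
  then show ?case by (intro bexI[of _ "frag_of (b, m)"]) auto
next
  case (diff z w)
  then obtain z' w' where "z' \<in> frags A N" "w' \<in> frags A N" "frag_map f g z' = z" "frag_map f g w' = w" by blast
  then show ?case by (intro bexI[of _ "z' - w'"]) (auto simp: frags_diff)
qed

lemma tensor_rels_frags:
  assumes "left_module (opp_ring S) A" "left_module S N"
  shows "tensor_rels S A N \<subseteq> frags A N"
proof -
  interpret A: left_module "opp_ring S" A by fact
  interpret N: left_module S N by fact
  show ?thesis
    unfolding tensor_rels_def
    using A.smult_closed by (auto intro!: frags_diff)
qed

context
  fixes S :: "'s ring" and A :: "('s, 'a, 'x) module_scheme" and N :: "('s, 'n, 'y) module_scheme"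
  assumes A: "left_module (opp_ring S) A" and N: "left_module S N"
begin

interpretation A: left_module "opp_ring S" A by (rule A)
interpretation N: left_module S N by (rule N)

lemma subgroup_tensor_null: "subgroup (tensor_null S A N) (free_Abelian_group (carrier A \<times> carrier N))"
  unfolding tensor_null_def
  by (rule group.generate_is_subgroup)
    (use tensor_rels_frags[OF A N] in \<open>auto simp: frags_def\<close>)

lemma tensor_null_frags: "z \<in> tensor_null S A N \<Longrightarrow> z \<in> frags A N"
  using subgroup.subset[OF subgroup_tensor_null] by (auto simp: frags_def free_Abelian_group_def)

lemma tensor_null_0: "0 \<in> tensor_null S A N"
  using subgroup.one_closed[OF subgroup_tensor_null] by simp

lemma tensor_null_add: "z \<in> tensor_null S A N \<Longrightarrow> w \<in> tensor_null S A N \<Longrightarrow> z + w \<in> tensor_null S A N"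
  using subgroup.m_closed[OF subgroup_tensor_null] by simp

lemma tensor_null_minus: "z \<in> tensor_null S A N \<Longrightarrow> - z \<in> tensor_null S A N"
  using subgroup.m_inv_closed[OF subgroup_tensor_null, of z] tensor_null_frags[of z]
  by (simp add: frags_def)

lemma tensor_null_diff: "z \<in> tensor_null S A N \<Longrightarrow> w \<in> tensor_null S A N \<Longrightarrow> z - w \<in> tensor_null S A N"
  using tensor_null_add[OF _ tensor_null_minus, of z w] by simp

lemma tensor_null_sum: "(\<And>x. x \<in> G \<Longrightarrow> h x \<in> tensor_null S A N) \<Longrightarrow> sum h G \<in> tensor_null S A N"
  by (induction G rule: infinite_finite_induct) (auto simp: tensor_null_0 tensor_null_add)

lemma tensor_null_rel_left: "\<lbrakk>a \<in> carrier A; b \<in> carrier A; n \<in> carrier N\<rbrakk> \<Longrightarrow>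
    frag_of (a \<oplus>\<^bsub>A\<^esub> b, n) - frag_of (a, n) - frag_of (b, n) \<in> tensor_null S A N"
  unfolding tensor_null_def by (rule generate.incl) (auto simp: tensor_rels_def)

lemma tensor_null_rel_right: "\<lbrakk>a \<in> carrier A; m \<in> carrier N; n \<in> carrier N\<rbrakk> \<Longrightarrow>
    frag_of (a, m \<oplus>\<^bsub>N\<^esub> n) - frag_of (a, m) - frag_of (a, n) \<in> tensor_null S A N"
  unfolding tensor_null_def by (rule generate.incl) (auto simp: tensor_rels_def)

lemma tensor_null_rel_smult: "\<lbrakk>s \<in> carrier S; a \<in> carrier A; n \<in> carrier N\<rbrakk> \<Longrightarrow>
    frag_of (s \<odot>\<^bsub>A\<^esub> a, n) - frag_of (a, s \<odot>\<^bsub>N\<^esub> n) \<in> tensor_null S A N"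
  unfolding tensor_null_def by (rule generate.incl) (auto simp: tensor_rels_def)

lemma tensor_null_zero_left: "n \<in> carrier N \<Longrightarrow> frag_of (\<zero>\<^bsub>A\<^esub>, n) \<in> tensor_null S A N"
  using tensor_null_minus[OF tensor_null_rel_left[of "\<zero>\<^bsub>A\<^esub>" "\<zero>\<^bsub>A\<^esub>" n]] by simp

lemma tensor_null_zero_right: "a \<in> carrier A \<Longrightarrow> frag_of (a, \<zero>\<^bsub>N\<^esub>) \<in> tensor_null S A N"
  using tensor_null_minus[OF tensor_null_rel_right[of a "\<zero>\<^bsub>N\<^esub>" "\<zero>\<^bsub>N\<^esub>"]] by simp

lemma tensor_null_minus_left:
  assumes "a \<in> carrier A" "n \<in> carrier N"
  shows "frag_of (\<ominus>\<^bsub>A\<^esub> a, n) + frag_of (a, n) \<in> tensor_null S A N"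
proof -
  have "frag_of (\<zero>\<^bsub>A\<^esub>, n) - frag_of (\<ominus>\<^bsub>A\<^esub> a, n) - frag_of (a, n) \<in> tensor_null S A N"
    using tensor_null_rel_left[of "\<ominus>\<^bsub>A\<^esub> a" a n] assms by (simp add: A.M.l_neg)
  from tensor_null_diff[OF tensor_null_zero_left[OF assms(2)] this] show ?thesis
    by (simp add: algebra_simps)
qed

lemma tensor_null_minus_right:
  assumes "a \<in> carrier A" "n \<in> carrier N"
  shows "frag_of (a, \<ominus>\<^bsub>N\<^esub> n) + frag_of (a, n) \<in> tensor_null S A N"
proof -
  have "frag_of (a, \<zero>\<^bsub>N\<^esub>) - frag_of (a, \<ominus>\<^bsub>N\<^esub> n) - frag_of (a, n) \<in> tensor_null S A N"
    using tensor_null_rel_right[of a "\<ominus>\<^bsub>N\<^esub> n" n] assms by (simp add: N.M.l_neg)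
  from tensor_null_diff[OF tensor_null_zero_right[OF assms(1)] this] show ?thesis
    by (simp add: algebra_simps)
qed

text \<open>Closure under differences replaces the product and inverse rules of
  \<open>generate\<close>. The case \<open>diff\<close> also supplies membership in
  \<open>frags A N\<close>, because evaluations of formal sums are additive only there.\<close>

lemma tensor_null_induct [consumes 1, case_names zero add_left add_right smult diff]:
  assumes "z \<in> tensor_null S A N" "P 0"
    and l: "\<And>a b n. \<lbrakk>a \<in> carrier A; b \<in> carrier A; n \<in> carrier N\<rbrakk> \<Longrightarrow>
        P (frag_of (a \<oplus>\<^bsub>A\<^esub> b, n) - frag_of (a, n) - frag_of (b, n))"
    and r: "\<And>a m n. \<lbrakk>a \<in> carrier A; m \<in> carrier N; n \<in> carrier N\<rbrakk> \<Longrightarrow>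
        P (frag_of (a, m \<oplus>\<^bsub>N\<^esub> n) - frag_of (a, m) - frag_of (a, n))"
    and s: "\<And>s a n. \<lbrakk>s \<in> carrier S; a \<in> carrier A; n \<in> carrier N\<rbrakk> \<Longrightarrow>
        P (frag_of (s \<odot>\<^bsub>A\<^esub> a, n) - frag_of (a, s \<odot>\<^bsub>N\<^esub> n))"
    and d: "\<And>z w. z \<in> frags A N \<Longrightarrow> w \<in> frags A N \<Longrightarrow> P z \<Longrightarrow> P w \<Longrightarrow> P (z - w)"
  shows "P z"
proof -
  have rel: "P y" if "y \<in> tensor_rels S A N" for y
    using that unfolding tensor_rels_def by (auto intro: l r s)
  have "z \<in> frags A N \<and> P z" using assms(1) unfolding tensor_null_def
  proof (induction rule: generate.induct)
    case one then show ?case using assms(2) by simp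
  next
    case (incl h) then show ?case using rel tensor_rels_frags[OF A N] by auto
  next
    case (inv h)
    then have "h \<in> frags A N" using tensor_rels_frags[OF A N] by auto
    then show ?case using d[of 0 h] rel[OF inv] assms(2) by (auto simp: frags_def)
  next
    case (eng h1 h2)
    then have "P (- h2)" using d[of 0 h2] assms(2) by simp
    with eng have "P (h1 + h2)" using d[of h1 "- h2"] by simp
    then show ?case using eng by (simp add: frags_add)
  qed
  then show ?thesis ..
qed

end

lemma frag_map_null:
  assumes "left_module (opp_ring S) A" "left_module S N" "left_module (opp_ring S) A'" "left_module S N'"
    and f: "f \<in> mod_hom (opp_ring S) A A'" and g: "g \<in> mod_hom S N N'"
    and z: "z \<in> tensor_null S A N"
  shows "frag_map f g z \<in> tensor_null S A' N'"
  using z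
proof (induction rule: tensor_null_induct[OF assms(1,2), consumes 1, case_names zero add_left add_right smult diff])
  case (smult s a n)
  then show ?case
    using tensor_null_rel_smult[OF assms(3,4), of s "f a" "g n"]
      mod_homD[OF f] mod_homD[OF g] by (simp)
qed (use mod_homD[OF f] mod_homD[OF g] in
  \<open>auto simp: tensor_null_0[OF assms(3,4)] tensor_null_diff[OF assms(3,4)]
     intro: tensor_null_rel_left[OF assms(3,4)] tensor_null_rel_right[OF assms(3,4)]\<close>)

text \<open>Handles composites that vanish in one factor: consecutive differentials on the left,
  consecutive maps of an exact sequence on the right.\<close>

lemma frag_map_null_if_zero:
  assumes "left_module (opp_ring S) A'" "left_module S N'" "z \<in> frags A N"
    and "\<And>a n. a \<in> carrier A \<Longrightarrow> n \<in> carrier N \<Longrightarrow> f a \<in> carrier A' \<and> g n \<in> carrier N' \<and> (f a = \<zero>\<^bsub>A'\<^esub> \<or> g n = \<zero>\<^bsub>N'\<^esub>)"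
  shows "frag_map f g z \<in> tensor_null S A' N'"
  using assms(3)
proof (induction rule: frags_induct)
  case (of a n)
  then show ?case using assms(4)[of a n]
    by (auto simp: tensor_null_zero_left[OF assms(1,2)] tensor_null_zero_right[OF assms(1,2)])
qed (auto simp: tensor_null_0[OF assms(1,2)] tensor_null_diff[OF assms(1,2)])

section \<open>Evaluation of formal sums in an abelian group\<close>

definition frag_eval :: "('g, 'x) ring_scheme \<Rightarrow> ('p \<Rightarrow> 'g) \<Rightarrow> ('p \<Rightarrow>\<^sub>0 int) \<Rightarrow> 'g" where
  "frag_eval G \<beta> z = (\<Oplus>\<^bsub>G\<^esub>p \<in> Poly_Mapping.keys z. [Poly_Mapping.lookup z p] \<cdot>\<^bsub>G\<^esub> \<beta> p)"

context abelian_group begin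

lemma add_int_pow_closed: "x \<in> carrier G \<Longrightarrow> [(k::int)] \<cdot> x \<in> carrier G"
  by (rule add.int_pow_closed)

lemma frag_eval_alt:
  assumes "Poly_Mapping.keys z \<subseteq> F" "finite F" "\<beta> \<in> F \<rightarrow> carrier G"
  shows "frag_eval G \<beta> z = (\<Oplus>p \<in> F. [Poly_Mapping.lookup z p] \<cdot> \<beta> p)"
  unfolding frag_eval_def
proof (rule add.finprod_mono_neutral_cong_left[OF assms(2,1)])
  fix i assume "i \<in> F - Poly_Mapping.keys z"
  then have "Poly_Mapping.lookup z i = 0" by (simp add: in_keys_iff)
  then show "[Poly_Mapping.lookup z i] \<cdot> \<beta> i = \<zero>" by (simp add: add_pow_def)
qed (use assms in \<open>auto intro!: add_int_pow_closed simp: Pi_iff\<close>)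

lemma frag_eval_closed: "(\<And>p. p \<in> Poly_Mapping.keys z \<Longrightarrow> \<beta> p \<in> carrier G) \<Longrightarrow> frag_eval G \<beta> z \<in> carrier G"
  unfolding frag_eval_def by (auto intro!: finsum_closed add_int_pow_closed)

lemma frag_eval_0: "frag_eval G \<beta> 0 = \<zero>"
  by (simp add: frag_eval_def)

lemma frag_eval_of: "\<beta> p \<in> carrier G \<Longrightarrow> frag_eval G \<beta> (frag_of p) = \<beta> p"
  using frag_eval_alt[of "frag_of p" "{p}" \<beta>] add.int_pow_1[of "\<beta> p"] by (simp add: add_pow_def)

lemma frag_eval_add:
  assumes "\<And>p. p \<in> Poly_Mapping.keys z \<union> Poly_Mapping.keys w \<Longrightarrow> \<beta> p \<in> carrier G"
  shows "frag_eval G \<beta> (z + w) = frag_eval G \<beta> z \<oplus> frag_eval G \<beta> w"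
proof -
  let ?F = "Poly_Mapping.keys z \<union> Poly_Mapping.keys w"
  have \<beta>: "\<beta> \<in> ?F \<rightarrow> carrier G" using assms by auto
  have "frag_eval G \<beta> (z + w) = (\<Oplus>p\<in>?F. [Poly_Mapping.lookup (z + w) p] \<cdot> \<beta> p)"
    by (rule frag_eval_alt) (use \<beta> keys_add[of z w] in auto)
  also have "\<dots> = (\<Oplus>p\<in>?F. [Poly_Mapping.lookup z p] \<cdot> \<beta> p \<oplus> [Poly_Mapping.lookup w p] \<cdot> \<beta> p)"
    by (rule finsum_cong')
      (use assms in \<open>auto simp: Poly_Mapping.lookup_add add.int_pow_mult intro!: add_int_pow_closed a_closed\<close>)
  also have "\<dots> = (\<Oplus>p\<in>?F. [Poly_Mapping.lookup z p] \<cdot> \<beta> p) \<oplus> (\<Oplus>p\<in>?F. [Poly_Mapping.lookup w p] \<cdot> \<beta> p)"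
    by (rule finsum_addf) (use assms in \<open>auto intro!: add_int_pow_closed\<close>)
  also have "\<dots> = frag_eval G \<beta> z \<oplus> frag_eval G \<beta> w"
    using frag_eval_alt[of z ?F \<beta>] frag_eval_alt[of w ?F \<beta>] \<beta> by simp
  finally show ?thesis .
qed

lemma frag_eval_diff:
  assumes "\<And>p. p \<in> Poly_Mapping.keys z \<union> Poly_Mapping.keys w \<Longrightarrow> \<beta> p \<in> carrier G"
  shows "frag_eval G \<beta> (z - w) = frag_eval G \<beta> z \<ominus> frag_eval G \<beta> w"
proof -
  have "frag_eval G \<beta> z = frag_eval G \<beta> (z - w) \<oplus> frag_eval G \<beta> w"
    using frag_eval_add[of "z - w" w \<beta>] assms keys_diff[of z w] by fastforce
  moreover have "frag_eval G \<beta> (z - w) \<in> carrier G" "frag_eval G \<beta> w \<in> carrier G"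
    using assms keys_diff[of z w] by (auto intro!: frag_eval_closed)
  ultimately show ?thesis by (simp add: minus_eq a_assoc r_neg)
qed

end

text \<open>Stated for abelian groups rather than modules, since evaluation of Hom(C,M) at a point
  leads from an S-module to an R-module.\<close>

lemma additive_map:
  assumes "abelian_group G" "abelian_group H" "g \<in> carrier G \<rightarrow> carrier H"
    and add: "\<And>x y. x \<in> carrier G \<Longrightarrow> y \<in> carrier G \<Longrightarrow> g (x \<oplus>\<^bsub>G\<^esub> y) = g x \<oplus>\<^bsub>H\<^esub> g y"
  shows additive_map_zero: "g \<zero>\<^bsub>G\<^esub> = \<zero>\<^bsub>H\<^esub>"
    and additive_map_diff: "x \<in> carrier G \<Longrightarrow> y \<in> carrier G \<Longrightarrow> g (x \<ominus>\<^bsub>G\<^esub> y) = g x \<ominus>\<^bsub>H\<^esub> g y"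
    and additive_map_minus: "x \<in> carrier G \<Longrightarrow> g (\<ominus>\<^bsub>G\<^esub> x) = \<ominus>\<^bsub>H\<^esub> g x"
proof -
  interpret G: abelian_group G by fact
  interpret H: abelian_group H by fact
  interpret g: group_hom "add_monoid G" "add_monoid H" g
    by unfold_locales (use assms(3) add in \<open>auto simp: hom_def\<close>)
  show "g \<zero>\<^bsub>G\<^esub> = \<zero>\<^bsub>H\<^esub>" using g.hom_one by simp
  show m: "g (\<ominus>\<^bsub>G\<^esub> x) = \<ominus>\<^bsub>H\<^esub> g x" if "x \<in> carrier G" for x
    using g.hom_inv[of x] that by (simp add: a_inv_def)
  show "g (x \<ominus>\<^bsub>G\<^esub> y) = g x \<ominus>\<^bsub>H\<^esub> g y" if "x \<in> carrier G" "y \<in> carrier G"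
    using that by (simp add: a_minus_def add m)
qed

lemma frag_eval_frags:
  assumes "abelian_group G" "\<beta> \<in> carrier A \<times> carrier N \<rightarrow> carrier G"
  shows frag_eval_frags_closed: "z \<in> frags A N \<Longrightarrow> frag_eval G \<beta> z \<in> carrier G"
    and frag_eval_frags_add: "z \<in> frags A N \<Longrightarrow> w \<in> frags A N \<Longrightarrow>
        frag_eval G \<beta> (z + w) = frag_eval G \<beta> z \<oplus>\<^bsub>G\<^esub> frag_eval G \<beta> w"
    and frag_eval_frags_diff: "z \<in> frags A N \<Longrightarrow> w \<in> frags A N \<Longrightarrow>
        frag_eval G \<beta> (z - w) = frag_eval G \<beta> z \<ominus>\<^bsub>G\<^esub> frag_eval G \<beta> w"
proof -
  interpret abelian_group G by fact
  have *: "\<beta> p \<in> carrier G" if "z \<in> frags A N" "p \<in> Poly_Mapping.keys z" for z p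
    using that assms(2) by (auto simp: frags_def)
  show "z \<in> frags A N \<Longrightarrow> frag_eval G \<beta> z \<in> carrier G"
    by (rule frag_eval_closed) (rule *)
  show "z \<in> frags A N \<Longrightarrow> w \<in> frags A N \<Longrightarrow>
        frag_eval G \<beta> (z + w) = frag_eval G \<beta> z \<oplus>\<^bsub>G\<^esub> frag_eval G \<beta> w"
    by (rule frag_eval_add) (use * in auto)
  show "z \<in> frags A N \<Longrightarrow> w \<in> frags A N \<Longrightarrow>
        frag_eval G \<beta> (z - w) = frag_eval G \<beta> z \<ominus>\<^bsub>G\<^esub> frag_eval G \<beta> w"
    by (rule frag_eval_diff) (use * in auto)
qed

lemma frag_eval_map:
  fixes A' :: "('s, 'a, 'x) module_scheme" and N' :: "('t, 'n, 'y) module_scheme"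
  assumes "abelian_group G" and z: "z \<in> frags A N"
    and "\<And>a. a \<in> carrier A \<Longrightarrow> f a \<in> carrier A'" "\<And>n. n \<in> carrier N \<Longrightarrow> g n \<in> carrier N'"
    and \<beta>: "\<beta> \<in> carrier A' \<times> carrier N' \<rightarrow> carrier G"
  shows "frag_eval G \<beta> (frag_map f g z) = frag_eval G (\<lambda>p. \<beta> (f (fst p), g (snd p))) z"
proof -
  interpret abelian_group G by fact
  have \<gamma>: "(\<lambda>p. \<beta> (f (fst p), g (snd p))) \<in> carrier A \<times> carrier N \<rightarrow> carrier G"
    using assms by auto
  show ?thesis
    using z
  proof (induction rule: frags_induct)
    case (diff z w)
    have "frag_map f g z \<in> frags A' N'" "frag_map f g w \<in> frags A' N'"
      using diff assms(3,4) by (auto intro!: frag_map_frags)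
    then show ?case using diff
      by (simp add: frag_eval_frags_diff[OF assms(1) \<beta>] frag_eval_frags_diff[OF assms(1) \<gamma>])
  qed (use assms in \<open>auto simp: frag_eval_0 frag_eval_of Pi_iff\<close>)
qed

lemma additive_frag_eval:
  assumes "abelian_group G" "abelian_group H" "g \<in> carrier G \<rightarrow> carrier H"
    and add: "\<And>x y. x \<in> carrier G \<Longrightarrow> y \<in> carrier G \<Longrightarrow> g (x \<oplus>\<^bsub>G\<^esub> y) = g x \<oplus>\<^bsub>H\<^esub> g y"
    and z: "z \<in> frags A N"
    and \<beta>: "\<beta> \<in> carrier A \<times> carrier N \<rightarrow> carrier G"
  shows "g (frag_eval G \<beta> z) = frag_eval H (\<lambda>p. g (\<beta> p)) z"
proof -
  interpret G: abelian_group G by fact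
  interpret H: abelian_group H by fact
  have \<gamma>: "(\<lambda>p. g (\<beta> p)) \<in> carrier A \<times> carrier N \<rightarrow> carrier H"
    using assms by auto
  show ?thesis
    using z
  proof (induction rule: frags_induct)
    case zero show ?case by (simp add: G.frag_eval_0 H.frag_eval_0 additive_map_zero[OF assms(1-4)])
  next
    case (of a n) then show ?case using \<beta> \<gamma> by (simp add: G.frag_eval_of H.frag_eval_of Pi_iff)
  next
    case (diff z w)
    then show ?case
      by (simp add: frag_eval_frags_diff[OF assms(1) \<beta>] frag_eval_frags_diff[OF assms(2) \<gamma>]
          additive_map_diff[OF assms(1-4)] frag_eval_frags_closed[OF assms(1) \<beta>])
  qed
qed

lemma frag_eval_cong:
  assumes "abelian_group G" and z: "z \<in> frags A N"
    and "\<And>a n. a \<in> carrier A \<Longrightarrow> n \<in> carrier N \<Longrightarrow> \<beta> (a, n) = \<gamma> (a, n)"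
    and "\<gamma> \<in> carrier A \<times> carrier N \<rightarrow> carrier G"
  shows "frag_eval G \<beta> z = frag_eval G \<gamma> z"
proof -
  interpret abelian_group G by fact
  have *: "\<beta> p = \<gamma> p \<and> \<gamma> p \<in> carrier G" if "p \<in> Poly_Mapping.keys z" for p
    using that z assms(3,4) by (cases p) (auto simp: frags_def Pi_iff)
  show ?thesis
    unfolding frag_eval_def by (rule finsum_cong') (use * in \<open>auto intro!: add_int_pow_closed\<close>)
qed

text \<open>The universal property of the tensor product: a biadditive balanced \<beta> descends to
  it.\<close>

lemma frag_eval_null:
  assumes G: "abelian_group G" and "left_module (opp_ring S) A" "left_module S N" "z \<in> tensor_null S A N"
    and \<beta>: "\<beta> \<in> carrier A \<times> carrier N \<rightarrow> carrier G"
    and l: "\<And>a b n. \<lbrakk>a \<in> carrier A; b \<in> carrier A; n \<in> carrier N\<rbrakk> \<Longrightarrow>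
        \<beta> (a \<oplus>\<^bsub>A\<^esub> b, n) = \<beta> (a, n) \<oplus>\<^bsub>G\<^esub> \<beta> (b, n)"
    and r: "\<And>a m n. \<lbrakk>a \<in> carrier A; m \<in> carrier N; n \<in> carrier N\<rbrakk> \<Longrightarrow>
        \<beta> (a, m \<oplus>\<^bsub>N\<^esub> n) = \<beta> (a, m) \<oplus>\<^bsub>G\<^esub> \<beta> (a, n)"
    and s: "\<And>s a n. \<lbrakk>s \<in> carrier S; a \<in> carrier A; n \<in> carrier N\<rbrakk> \<Longrightarrow>
        \<beta> (s \<odot>\<^bsub>A\<^esub> a, n) = \<beta> (a, s \<odot>\<^bsub>N\<^esub> n)"
  shows "frag_eval G \<beta> z = \<zero>\<^bsub>G\<^esub>"
proof -
  interpret G: abelian_group G by fact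
  interpret A: left_module "opp_ring S" A by fact
  interpret N: left_module S N by fact
  have \<beta>' [simp]: "\<beta> (a, n) \<in> carrier G" if "a \<in> carrier A" "n \<in> carrier N" for a n
    using \<beta> that by auto
  have ac[simp]: "s \<odot>\<^bsub>A\<^esub> a \<in> carrier A" if "s \<in> carrier S" "a \<in> carrier A" for s a
    using A.smult_closed that by simp
  note ev = frag_eval_frags_diff[OF G \<beta>] frag_eval_frags_closed[OF G \<beta>] G.frag_eval_of
  show ?thesis using assms(4)
  proof (induction rule: tensor_null_induct[OF assms(2,3), consumes 1, case_names zero add_left add_right smult diff])
    case (add_left a b n)
    then show ?case
      by (simp add: ev l frags_diff G.minus_eq G.minus_add G.a_assoc[symmetric])
       (simp add: G.a_assoc G.r_neg G.r_neg1 G.r_neg2 G.a_comm)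
  next
    case (add_right a m n)
    then show ?case
      by (simp add: ev r frags_diff G.minus_eq)
       (simp add: G.a_assoc G.r_neg G.r_neg1 G.r_neg2 G.a_comm)
  next
    case (smult u a n)
    then show ?case
      using s[OF smult] by (simp add: ev G.minus_eq G.r_neg)
  qed (auto simp: G.frag_eval_0 ev G.minus_eq)
qed

lemma a_kernel_eq: "a_kernel A B f = {x \<in> carrier A. f x = \<zero>\<^bsub>B\<^esub>}"
  by (simp add: a_kernel_def kernel_def)

lemma mod_hom_ident: "(\<lambda>x. x) \<in> mod_hom R A A"
  by (simp add: mod_hom_def)

lemma mod_hom_diff:
  assumes "left_module R A" "left_module R B" "f \<in> mod_hom R A B" "x \<in> carrier A" "y \<in> carrier A"
  shows "f (x \<ominus>\<^bsub>A\<^esub> y) = f x \<ominus>\<^bsub>B\<^esub> f y"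
  by (rule additive_map_diff) (use assms mod_homD[OF assms(3)] in \<open>auto simp: left_module_abelian_group\<close>)

section \<open>Right exactness\<close>

text \<open>
  The kernel of \<open>e \<otimes> q\<close> is generated by the tensors \<open>a \<otimes> n\<close> with \<open>e a = 0\<close> or \<open>q n = 0\<close>; \<open>J\<close> stands for
  membership in a subgroup containing these.
\<close>

theorem tensor_right_exact:
  assumes A: "left_module (opp_ring S) A" and N: "left_module S N"
    and A': "left_module (opp_ring S) A'" and N': "left_module S N'"
    and e: "e \<in> mod_hom (opp_ring S) A A'" "e ` carrier A = carrier A'"
    and q: "q \<in> mod_hom S N N'" "q ` carrier N = carrier N'"
    and z: "z \<in> frags A N" "frag_map e q z \<in> tensor_null S A' N'"
    and null: "\<And>y. y \<in> tensor_null S A N \<Longrightarrow> J y"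
    and diff: "\<And>y w. J y \<Longrightarrow> J w \<Longrightarrow> J (y - w)"
    and ker: "\<And>a n. \<lbrakk>a \<in> carrier A; n \<in> carrier N; e a = \<zero>\<^bsub>A'\<^esub> \<or> q n = \<zero>\<^bsub>N'\<^esub>\<rbrakk> \<Longrightarrow> J (frag_of (a, n))"
  shows "J z"
proof -
  interpret A: left_module "opp_ring S" A by fact
  interpret N: left_module S N by fact
  interpret A': left_module "opp_ring S" A' by fact
  interpret N': left_module S N' by fact
  have [simp]: "s \<odot>\<^bsub>A\<^esub> a \<in> carrier A" if "s \<in> carrier S" "a \<in> carrier A" for s a
    using A.smult_closed that by simp
  note n = tensor_null_diff[OF A N] tensor_null_add[OF A N]
  have J0: "J 0" by (rule null) (rule tensor_null_0[OF A N])
  have add: "J (y + w)" if "J y" "J w" for y w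
    using diff[OF that(1) diff[OF J0 that(2)]] by simp
  \<comment> \<open>The difference of a and b lies in the kernel of e, so its tensor with m is in J;
    bilinearity rewrites that tensor as the difference of the two.\<close>
  have congA: "J (frag_of (a, m) - frag_of (b, m))"
    if "a \<in> carrier A" "b \<in> carrier A" "m \<in> carrier N" "e a = e b" for a b m
  proof -
    have "e (a \<ominus>\<^bsub>A\<^esub> b) = \<zero>\<^bsub>A'\<^esub>"
      using that mod_hom_closed[OF e(1)] by (simp add: mod_hom_diff[OF A A' e(1)] A'.M.minus_eq A'.M.r_neg)
    then have "J (frag_of (a \<ominus>\<^bsub>A\<^esub> b, m))" using that by (intro ker) auto
    moreover have "J ((frag_of (a \<ominus>\<^bsub>A\<^esub> b, m) - frag_of (a, m) - frag_of (\<ominus>\<^bsub>A\<^esub> b, m))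
        + (frag_of (\<ominus>\<^bsub>A\<^esub> b, m) + frag_of (b, m)))"
      unfolding A.M.minus_eq using that
      by (intro null n tensor_null_rel_left[OF A N] tensor_null_minus_left[OF A N]) auto
    ultimately show ?thesis
      using diff[of "frag_of (a \<ominus>\<^bsub>A\<^esub> b, m)" "(frag_of (a \<ominus>\<^bsub>A\<^esub> b, m) - frag_of (a, m) - frag_of (\<ominus>\<^bsub>A\<^esub> b, m))
        + (frag_of (\<ominus>\<^bsub>A\<^esub> b, m) + frag_of (b, m))"] by (simp add: algebra_simps)
  qed
  have congN: "J (frag_of (a, m) - frag_of (a, k))"
    if "a \<in> carrier A" "m \<in> carrier N" "k \<in> carrier N" "q m = q k" for a m k
  proof -
    have "q (m \<ominus>\<^bsub>N\<^esub> k) = \<zero>\<^bsub>N'\<^esub>"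
      using that mod_hom_closed[OF q(1)] by (simp add: mod_hom_diff[OF N N' q(1)] N'.M.minus_eq N'.M.r_neg)
    then have "J (frag_of (a, m \<ominus>\<^bsub>N\<^esub> k))" using that by (intro ker) auto
    moreover have "J ((frag_of (a, m \<ominus>\<^bsub>N\<^esub> k) - frag_of (a, m) - frag_of (a, \<ominus>\<^bsub>N\<^esub> k))
        + (frag_of (a, \<ominus>\<^bsub>N\<^esub> k) + frag_of (a, k)))"
      unfolding N.M.minus_eq using that
      by (intro null n tensor_null_rel_right[OF A N] tensor_null_minus_right[OF A N]) auto
    ultimately show ?thesis
      using diff[of "frag_of (a, m \<ominus>\<^bsub>N\<^esub> k)" "(frag_of (a, m \<ominus>\<^bsub>N\<^esub> k) - frag_of (a, m) - frag_of (a, \<ominus>\<^bsub>N\<^esub> k))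
        + (frag_of (a, \<ominus>\<^bsub>N\<^esub> k) + frag_of (a, k))"] by (simp add: algebra_simps)
  qed
  have cong: "J (frag_of (a, m) - frag_of (b, k))"
    if "a \<in> carrier A" "b \<in> carrier A" "m \<in> carrier N" "k \<in> carrier N" "e a = e b" "q m = q k" for a b m k
    using add[OF congA[OF that(1-3,5)] congN[OF that(2-4,6)]] by simp
  \<comment> \<open>Set-theoretic sections of e and q. They need not be linear: \<open>cong\<close>
    makes all choices of preimages equivalent modulo J.\<close>
  define la where "la = inv_into (carrier A) e"
  define ln where "ln = inv_into (carrier N) q"
  have la: "la c \<in> carrier A" "e (la c) = c" if "c \<in> carrier A'" for c
    using that e(2) by (auto simp: la_def inv_into_into f_inv_into_f)
  have ln: "ln c \<in> carrier N" "q (ln c) = c" if "c \<in> carrier N'" for c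
    using that q(2) by (auto simp: ln_def inv_into_into f_inv_into_f)
  note homs = mod_homD[OF e(1)] mod_homD[OF q(1)]
  have lift: "J (y - frag_map la ln (frag_map e q y))" if "y \<in> frags A N" for y
    using that
  proof (induction rule: frags_induct)
    case (diff u w)
    \<comment> \<open>Here \<open>diff\<close> names the induction case; \<open>assms(12)\<close> is
      the closure of J under differences.\<close>
    then show ?case using assms(12)[OF diff(3,4)] by (simp add: algebra_simps)
  qed (use J0 in \<open>auto intro!: cong simp: la ln homs\<close>)
  \<comment> \<open>The sections turn each defining relation of the target into one of the source,
    up to a change of preimages that \<open>cong\<close> allows. Together with \<open>lift\<close>
    this puts z in J.\<close>
  have "J (frag_map la ln y)" if "y \<in> tensor_null S A' N'" for y
    using that
  proof (induction rule: tensor_null_induct[OF A' N', consumes 1, case_names zero add_left add_right smult diff])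
    case (add_left a b m)
    have "J ((frag_of (la (a \<oplus>\<^bsub>A'\<^esub> b), ln m) - frag_of (la a \<oplus>\<^bsub>A\<^esub> la b, ln m))
        + (frag_of (la a \<oplus>\<^bsub>A\<^esub> la b, ln m) - frag_of (la a, ln m) - frag_of (la b, ln m)))"
      by (intro add cong null tensor_null_rel_left[OF A N]) (use add_left in \<open>auto simp: la ln homs\<close>)
    then show ?case by (simp add: algebra_simps)
  next
    case (add_right a m k)
    have "J ((frag_of (la a, ln (m \<oplus>\<^bsub>N'\<^esub> k)) - frag_of (la a, ln m \<oplus>\<^bsub>N\<^esub> ln k))
        + (frag_of (la a, ln m \<oplus>\<^bsub>N\<^esub> ln k) - frag_of (la a, ln m) - frag_of (la a, ln k)))"
      by (intro add cong null tensor_null_rel_right[OF A N]) (use add_right in \<open>auto simp: la ln homs\<close>)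
    then show ?case by (simp add: algebra_simps)
  next
    case (smult s a m)
    then have sa: "s \<odot>\<^bsub>A'\<^esub> a \<in> carrier A'" using A'.smult_closed by simp
    have "J ((frag_of (la (s \<odot>\<^bsub>A'\<^esub> a), ln m) - frag_of (s \<odot>\<^bsub>A\<^esub> la a, ln m))
        + (frag_of (s \<odot>\<^bsub>A\<^esub> la a, ln m) - frag_of (la a, s \<odot>\<^bsub>N\<^esub> ln m))
        + (frag_of (la a, s \<odot>\<^bsub>N\<^esub> ln m) - frag_of (la a, ln (s \<odot>\<^bsub>N'\<^esub> m))))"
      by (intro add cong null tensor_null_rel_smult[OF A N]) (use smult sa in \<open>auto simp: la ln homs\<close>)
    then show ?case by simp
  qed (use J0 diff in auto)
  from add[OF lift[OF z(1)] this[OF z(2)]] show ?thesis by simp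
qed

text \<open>J is membership in the image of d \<otimes> N modulo null sums. With the identity on N,
  the generators to be checked are a \<otimes> n with e a = 0, where a is a value of d, or with n =
  0.\<close>

lemma tensor_right_exact_left:
  assumes A: "left_module (opp_ring S) A" and N: "left_module S N"
    and A': "left_module (opp_ring S) A'" and B: "left_module (opp_ring S) B"
    and e: "e \<in> mod_hom (opp_ring S) A A'" "e ` carrier A = carrier A'"
    and d: "d \<in> mod_hom (opp_ring S) B A" "d ` carrier B = a_kernel A A' e"
    and z: "z \<in> frags A N" "frag_map e (\<lambda>x. x) z \<in> tensor_null S A' N"
  shows "\<exists>w \<in> frags B N. z - frag_map d (\<lambda>x. x) w \<in> tensor_null S A N"
proof (rule tensor_right_exact[OF A N A' N e mod_hom_ident _ z])
  fix y assume "y \<in> tensor_null S A N"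
  then show "\<exists>w\<in>frags B N. y - frag_map d (\<lambda>x. x) w \<in> tensor_null S A N"
    by (intro bexI[of _ 0]) auto
next
  fix y w assume "\<exists>w\<in>frags B N. y - frag_map d (\<lambda>x. x) w \<in> tensor_null S A N"
    "\<exists>w'\<in>frags B N. w - frag_map d (\<lambda>x. x) w' \<in> tensor_null S A N"
  then obtain u v where "u \<in> frags B N" "v \<in> frags B N"
    "y - frag_map d (\<lambda>x. x) u \<in> tensor_null S A N" "w - frag_map d (\<lambda>x. x) v \<in> tensor_null S A N" by blast
  then show "\<exists>w'\<in>frags B N. y - w - frag_map d (\<lambda>x. x) w' \<in> tensor_null S A N"
    using tensor_null_diff[OF A N, of "y - frag_map d (\<lambda>x. x) u" "w - frag_map d (\<lambda>x. x) v"]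
    by (intro bexI[of _ "u - v"]) (auto simp: frags_diff algebra_simps)
next
  fix a n assume an: "a \<in> carrier A" "n \<in> carrier N" "e a = \<zero>\<^bsub>A'\<^esub> \<or> n = \<zero>\<^bsub>N\<^esub>"
  show "\<exists>w\<in>frags B N. frag_of (a, n) - frag_map d (\<lambda>x. x) w \<in> tensor_null S A N"
  proof (cases "n = \<zero>\<^bsub>N\<^esub>")
    case True
    then show ?thesis using tensor_null_zero_right[OF A N an(1)] by (intro bexI[of _ 0]) auto
  next
    case False
    then have "a \<in> d ` carrier B" using an unfolding d(2) by (simp add: a_kernel_eq)
    then obtain b where "b \<in> carrier B" "d b = a" by blast
    then show ?thesis using tensor_null_0[OF A N] an by (intro bexI[of _ "frag_of (b, n)"]) auto
  qed
qed auto

lemma tensor_right_exact_right: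
  assumes A: "left_module (opp_ring S) A" and N: "left_module S N"
    and N': "left_module S N'" and B: "left_module S B"
    and q: "q \<in> mod_hom S N N'" "q ` carrier N = carrier N'"
    and d: "d \<in> mod_hom S B N" "d ` carrier B = a_kernel N N' q"
    and z: "z \<in> frags A N" "frag_map (\<lambda>x. x) q z \<in> tensor_null S A N'"
  shows "\<exists>w \<in> frags A B. z - frag_map (\<lambda>x. x) d w \<in> tensor_null S A N"
proof (rule tensor_right_exact[OF A N A N' mod_hom_ident _ q z])
  fix y assume "y \<in> tensor_null S A N"
  then show "\<exists>w\<in>frags A B. y - frag_map (\<lambda>x. x) d w \<in> tensor_null S A N"
    by (intro bexI[of _ 0]) auto
next
  fix y w assume "\<exists>w\<in>frags A B. y - frag_map (\<lambda>x. x) d w \<in> tensor_null S A N"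
    "\<exists>w'\<in>frags A B. w - frag_map (\<lambda>x. x) d w' \<in> tensor_null S A N"
  then obtain u v where "u \<in> frags A B" "v \<in> frags A B"
    "y - frag_map (\<lambda>x. x) d u \<in> tensor_null S A N" "w - frag_map (\<lambda>x. x) d v \<in> tensor_null S A N" by blast
  then show "\<exists>w'\<in>frags A B. y - w - frag_map (\<lambda>x. x) d w' \<in> tensor_null S A N"
    using tensor_null_diff[OF A N, of "y - frag_map (\<lambda>x. x) d u" "w - frag_map (\<lambda>x. x) d v"]
    by (intro bexI[of _ "u - v"]) (auto simp: frags_diff algebra_simps)
next
  fix a n assume an: "a \<in> carrier A" "n \<in> carrier N" "a = \<zero>\<^bsub>A\<^esub> \<or> q n = \<zero>\<^bsub>N'\<^esub>"
  show "\<exists>w\<in>frags A B. frag_of (a, n) - frag_map (\<lambda>x. x) d w \<in> tensor_null S A N"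
  proof (cases "a = \<zero>\<^bsub>A\<^esub>")
    case True
    then show ?thesis using tensor_null_zero_left[OF A N an(2)] by (intro bexI[of _ 0]) auto
  next
    case False
    then have "n \<in> d ` carrier B" using an unfolding d(2) by (simp add: a_kernel_eq)
    then obtain b where "b \<in> carrier B" "d b = n" by blast
    then show ?thesis using tensor_null_0[OF A N] an by (intro bexI[of _ "frag_of (a, b)"]) auto
  qed
qed auto

lemma submodule_image:
  assumes A: "left_module R A" and B: "left_module R B" and f: "f \<in> mod_hom R A B"
  shows "submodule (f ` carrier A) R B"
proof -
  interpret A: left_module R A by fact
  interpret B: left_module R B by fact
  interpret f: group_hom "add_monoid A" "add_monoid B" f
    by unfold_locales (auto simp: hom_def mod_homD[OF f])
  show ?thesis
  proof (rule submodule.intro)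
    show "subgroup (f ` carrier A) (add_monoid B)" using f.img_is_subgroup by simp
    show "submodule_axioms (f ` carrier A) R B"
      by unfold_locales (auto simp: mod_hom_smult[OF f, symmetric])
  qed
qed

section \<open>Dual bases and flatness of projective modules\<close>

text \<open>
  The coefficients \<open>s p x\<close> are the values at \<open>p\<close> of the functionals dual to the generators \<open>x \<in> X\<close>, so
  that \<open>p = \<Sum> s p x \<cdot> x\<close> for all \<open>p\<close>.
\<close>

definition dual_basis :: "'r ring \<Rightarrow> ('r, 'p) module \<Rightarrow> 'p set \<Rightarrow> ('p \<Rightarrow> 'p \<Rightarrow> 'r) \<Rightarrow> bool" where
  "dual_basis R P X s \<longleftrightarrow> left_module R P \<and> X \<subseteq> carrier P \<and> s \<in> mod_hom R P (free_module R X) \<and>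
     (\<forall>p \<in> carrier P. free_lift R P (\<lambda>x. x) (s p) = p)"

lemma dual_basisD:
  assumes "dual_basis R P X s"
  shows "left_module R P" "X \<subseteq> carrier P" "s \<in> mod_hom R P (free_module R X)"
    "p \<in> carrier P \<Longrightarrow> free_lift R P (\<lambda>x. x) (s p) = p"
  using assms by (simp_all add: dual_basis_def)

lemma dual_basis_coeff_closed:
  assumes "dual_basis R P X s" "p \<in> carrier P"
  shows "s p x \<in> carrier R"
  using mod_hom_closed[OF dual_basisD(3)[OF assms(1)] assms(2)] by (simp add: free_module_simps)

text \<open>A generating set X gives a surjection from the free module on X, and projectivity splits
  it; s is the splitting. X is the whole carrier when only flatness is wanted, and finite for the
  evaluation on Hom(P,C).\<close>

lemma projective_module_dual_basis:
  assumes P: "projective_module R P" and X: "X \<subseteq> carrier P"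
    and gen: "\<And>N. submodule N R P \<Longrightarrow> X \<subseteq> N \<Longrightarrow> N = carrier P"
  shows "\<exists>s. dual_basis R P X s"
proof -
  have Pm: "left_module R P" using P by (simp add: projective_module_def)
  interpret P: left_module R P by (rule Pm)
  have F: "left_module R (free_module R X)" by (rule left_module_free_module) (rule P.ring_axioms)
  have id: "(\<lambda>x. x) \<in> X \<rightarrow> carrier P" using X by auto
  define \<pi> where "\<pi> = free_lift R P (\<lambda>x. x)"
  have \<pi>: "\<pi> \<in> mod_hom R (free_module R X) P" unfolding \<pi>_def by (rule free_lift_hom[OF Pm id])
  have "submodule (\<pi> ` carrier (free_module R X)) R P" by (rule submodule_image[OF F Pm \<pi>])
  moreover have "X \<subseteq> \<pi> ` carrier (free_module R X)"
  proof
    fix x assume "x \<in> X"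
    then show "x \<in> \<pi> ` carrier (free_module R X)"
      using free_lift_unit[OF Pm id] free_unit_closed[OF P.ring_axioms] unfolding \<pi>_def by (metis imageI)
  qed
  ultimately have "\<pi> ` carrier (free_module R X) = carrier P" by (rule gen)
  from projective_moduleD[OF P F Pm \<pi> this mod_hom_ident]
  obtain s where "s \<in> mod_hom R P (free_module R X)" "\<forall>p\<in>carrier P. \<pi> (s p) = p" by blast
  then show ?thesis using Pm X unfolding dual_basis_def \<pi>_def by blast
qed

text \<open>The \<open>x\<close>-th coordinate \<open>p \<otimes> n \<mapsto> x\<^sup>*(p) \<cdot> n\<close> on \<open>P \<otimes> N\<close>.\<close>

definition coord :: "('s, 'n, 'y) module_scheme \<Rightarrow> ('p \<Rightarrow> 'x \<Rightarrow> 's) \<Rightarrow> 'x \<Rightarrow> ('p \<times> 'n \<Rightarrow>\<^sub>0 int) \<Rightarrow> 'n" where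
  "coord N s x = frag_eval N (\<lambda>p. s (fst p) x \<odot>\<^bsub>N\<^esub> snd p)"

lemma tensor_null_finsum_left:
  assumes A: "left_module (opp_ring S) A" and N: "left_module S N"
    and "finite F" "h \<in> F \<rightarrow> carrier A" "n \<in> carrier N"
  shows "frag_of (\<Oplus>\<^bsub>A\<^esub>x\<in>F. h x, n) - (\<Sum>x\<in>F. frag_of (h x, n)) \<in> tensor_null S A N"
proof -
  interpret A: left_module "opp_ring S" A by fact
  show ?thesis
    using assms(3,4)
  proof (induction F)
    case empty then show ?case using tensor_null_zero_left[OF A N assms(5)] by simp
  next
    case (insert x F)
    have "(frag_of (h x \<oplus>\<^bsub>A\<^esub> (\<Oplus>\<^bsub>A\<^esub>x\<in>F. h x), n) - frag_of (h x, n) - frag_of (\<Oplus>\<^bsub>A\<^esub>x\<in>F. h x, n))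
      + (frag_of (\<Oplus>\<^bsub>A\<^esub>x\<in>F. h x, n) - (\<Sum>x\<in>F. frag_of (h x, n))) \<in> tensor_null S A N"
      by (intro tensor_null_add[OF A N] tensor_null_rel_left[OF A N]) (use insert assms(5) in \<open>auto simp: Pi_iff\<close>)
    then show ?case using insert by (simp add: algebra_simps Pi_iff)
  qed
qed

context
  fixes S :: "'s ring" and P :: "('s, 'p) module" and N :: "('s, 'n, 'y) module_scheme" and X s
  assumes db: "dual_basis (opp_ring S) P X s" and N: "left_module S N"
begin

private lemma mod_P: "left_module (opp_ring S) P" and sub_X: "X \<subseteq> carrier P"
  and hom_s: "s \<in> mod_hom (opp_ring S) P (free_module (opp_ring S) X)"
  by (fact dual_basisD(1-3)[OF db])+

private lemma coeff [simp]: "p \<in> carrier P \<Longrightarrow> s p x \<in> carrier S"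
  using dual_basis_coeff_closed[OF db] by simp

interpretation P: left_module "opp_ring S" P by (rule mod_P)
interpretation N: left_module S N by (rule N)

lemma coord_fun: "(\<lambda>p. s (fst p) x \<odot>\<^bsub>N\<^esub> snd p) \<in> carrier P \<times> carrier N \<rightarrow> carrier N"
  using coeff by auto

lemmas coord_closed = frag_eval_frags_closed[OF N.M.abelian_group_axioms coord_fun, folded coord_def]
lemmas coord_diff = frag_eval_frags_diff[OF N.M.abelian_group_axioms coord_fun, folded coord_def]

lemma coord_of: "p \<in> carrier P \<Longrightarrow> n \<in> carrier N \<Longrightarrow> coord N s x (frag_of (p, n)) = s p x \<odot>\<^bsub>N\<^esub> n"
  unfolding coord_def by (subst N.M.frag_eval_of) auto

lemma coord_null:
  assumes "z \<in> tensor_null S P N"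
  shows "coord N s x z = \<zero>\<^bsub>N\<^esub>"
  unfolding coord_def
proof (rule frag_eval_null[OF N.M.abelian_group_axioms mod_P N assms coord_fun])
  fix a b n assume "a \<in> carrier P" "b \<in> carrier P" "n \<in> carrier N"
  then show "s (fst (a \<oplus>\<^bsub>P\<^esub> b, n)) x \<odot>\<^bsub>N\<^esub> snd (a \<oplus>\<^bsub>P\<^esub> b, n) =
      s (fst (a, n)) x \<odot>\<^bsub>N\<^esub> snd (a, n) \<oplus>\<^bsub>N\<^esub> s (fst (b, n)) x \<odot>\<^bsub>N\<^esub> snd (b, n)"
    by (simp add: mod_hom_add[OF hom_s] free_module_simps N.smult_l_distr)
next
  \<comment> \<open>Multiplication in \<open>opp_ring S\<close> is reversed, so the coefficient of u
    a is that of a times u in S. This is what balancing requires.\<close>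
  fix u a n assume "u \<in> carrier S" "a \<in> carrier P" "n \<in> carrier N"
  then show "s (fst (u \<odot>\<^bsub>P\<^esub> a, n)) x \<odot>\<^bsub>N\<^esub> snd (u \<odot>\<^bsub>P\<^esub> a, n) =
      s (fst (a, u \<odot>\<^bsub>N\<^esub> n)) x \<odot>\<^bsub>N\<^esub> snd (a, u \<odot>\<^bsub>N\<^esub> n)"
    by (simp add: mod_hom_smult[OF hom_s] free_module_simps N.smult_assoc1)
qed (simp_all add: N.smult_r_distr)

text \<open>The expansion of z as the sum of x \<otimes> (x-th coordinate of z). X may be infinite,
  so a finite part of it has to be chosen depending on z; asking for all larger finite G lets two
  such choices be merged in the case \<open>diff\<close>.\<close>

lemma coord_expand:
  assumes "z \<in> frags P N"
  shows "\<exists>F. finite F \<and> F \<subseteq> X \<and> (\<forall>G. finite G \<longrightarrow> F \<subseteq> G \<longrightarrow> G \<subseteq> X \<longrightarrow>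
      z - (\<Sum>x\<in>G. frag_of (x, coord N s x z)) \<in> tensor_null S P N)"
  using assms
proof (induction rule: frags_induct)
  case zero
  have "- (\<Sum>x\<in>G. frag_of (x, coord N s x 0)) \<in> tensor_null S P N" if "G \<subseteq> X" for G
    by (intro tensor_null_minus[OF mod_P N] tensor_null_sum[OF mod_P N])
      (use sub_X that tensor_null_zero_right[OF mod_P N] in \<open>auto simp: coord_null[OF tensor_null_0[OF mod_P N]]\<close>)
  then show ?case by auto
next
  case (of a n)
  have sa: "s a \<in> carrier (free_module (opp_ring S) X)" by (rule mod_hom_closed[OF hom_s of(1)])
  have id: "(\<lambda>x. x) \<in> X \<rightarrow> carrier P" using sub_X by auto
  have "frag_of (a, n) - (\<Sum>x\<in>G. frag_of (x, coord N s x (frag_of (a, n)))) \<in> tensor_null S P N"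
    if G: "finite G" "{x. s a x \<noteq> \<zero>\<^bsub>S\<^esub>} \<subseteq> G" "G \<subseteq> X" for G
  proof -
    have a: "a = (\<Oplus>\<^bsub>P\<^esub>x\<in>G. s a x \<odot>\<^bsub>P\<^esub> x)"
      using free_lift_alt[OF mod_P sa id G(1) _ G(3)] G(2) db of(1) by (simp add: dual_basis_def)
    have "frag_of (\<Oplus>\<^bsub>P\<^esub>x\<in>G. s a x \<odot>\<^bsub>P\<^esub> x, n) - (\<Sum>x\<in>G. frag_of (s a x \<odot>\<^bsub>P\<^esub> x, n)) \<in> tensor_null S P N"
      by (rule tensor_null_finsum_left[OF mod_P N]) (use G sub_X of P.smult_closed in auto)
    moreover have "(\<Sum>x\<in>G. frag_of (s a x \<odot>\<^bsub>P\<^esub> x, n) - frag_of (x, s a x \<odot>\<^bsub>N\<^esub> n)) \<in> tensor_null S P N"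
      by (intro tensor_null_sum[OF mod_P N] tensor_null_rel_smult[OF mod_P N]) (use G sub_X of in auto)
    ultimately have "frag_of (a, n) - (\<Sum>x\<in>G. frag_of (x, s a x \<odot>\<^bsub>N\<^esub> n)) \<in> tensor_null S P N"
      unfolding a[symmetric] by (drule_tac tensor_null_add[OF mod_P N]) (auto simp: sum_subtractf)
    then show ?thesis using of by (simp add: coord_of)
  qed
  then show ?case using sa by (intro exI[of _ "{x. s a x \<noteq> \<zero>\<^bsub>S\<^esub>}"]) (auto simp: free_module_simps)
next
  case (diff z w)
  from diff(3) obtain F where F: "finite F" "F \<subseteq> X"
    "\<And>G. \<lbrakk>finite G; F \<subseteq> G; G \<subseteq> X\<rbrakk> \<Longrightarrow> z - (\<Sum>x\<in>G. frag_of (x, coord N s x z)) \<in> tensor_null S P N"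
    by (elim exE conjE) blast
  from diff(4) obtain F' where F': "finite F'" "F' \<subseteq> X"
    "\<And>G. \<lbrakk>finite G; F' \<subseteq> G; G \<subseteq> X\<rbrakk> \<Longrightarrow> w - (\<Sum>x\<in>G. frag_of (x, coord N s x w)) \<in> tensor_null S P N"
    by (elim exE conjE) blast
  have "z - w - (\<Sum>x\<in>G. frag_of (x, coord N s x (z - w))) \<in> tensor_null S P N"
    if G: "finite G" "F \<union> F' \<subseteq> G" "G \<subseteq> X" for G
  proof -
    have 1: "frag_of (x, coord N s x (z - w)) + frag_of (x, coord N s x w) - frag_of (x, coord N s x z) \<in> tensor_null S P N"
      if x: "x \<in> X" for x
    proof -
      note c = coord_closed[OF diff(1)] coord_closed[OF diff(2)] coord_closed[OF frags_diff[OF diff(1,2)]]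
      have "coord N s x z = coord N s x (z - w) \<oplus>\<^bsub>N\<^esub> coord N s x w"
        unfolding coord_diff[OF diff(1,2)] using c
        by (simp add: N.M.minus_eq N.M.a_assoc N.M.l_neg)
      then have "frag_of (x, coord N s x z) - frag_of (x, coord N s x (z - w)) - frag_of (x, coord N s x w) \<in> tensor_null S P N"
        using tensor_null_rel_right[OF mod_P N, of x "coord N s x (z - w)" "coord N s x w"] c x sub_X by auto
      from tensor_null_minus[OF mod_P N this] show ?thesis by (simp add: algebra_simps)
    qed
    have "(\<Sum>x\<in>G. frag_of (x, coord N s x (z - w)) + frag_of (x, coord N s x w) - frag_of (x, coord N s x z)) \<in> tensor_null S P N"
      using G 1 by (intro tensor_null_sum[OF mod_P N]) auto
    from tensor_null_diff[OF mod_P N tensor_null_diff[OF mod_P N F(3)[OF G(1) _ G(3)] F'(3)[OF G(1) _ G(3)]] this]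
    show ?thesis using G by (simp add: sum_subtractf sum.distrib algebra_simps)
  qed
  then show ?case using F(1,2) F'(1,2) by (intro exI[of _ "F \<union> F'"] conjI allI impI) auto
qed

lemma tensor_null_if_coord:
  assumes "z \<in> frags P N" "\<And>x. x \<in> X \<Longrightarrow> coord N s x z = \<zero>\<^bsub>N\<^esub>"
  shows "z \<in> tensor_null S P N"
proof -
  obtain F where F: "F \<subseteq> X" "z - (\<Sum>x\<in>F. frag_of (x, coord N s x z)) \<in> tensor_null S P N"
    using coord_expand[OF assms(1)] by blast
  have "(\<Sum>x\<in>F. frag_of (x, coord N s x z)) \<in> tensor_null S P N"
    by (rule tensor_null_sum[OF mod_P N]) (use F sub_X assms(2) tensor_null_zero_right[OF mod_P N] in \<open>auto simp: subset_iff\<close>)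
  from tensor_null_add[OF mod_P N F(2) this] show ?thesis by simp
qed

end

lemma coord_frag_map:
  assumes db: "dual_basis (opp_ring S) P X s" and N: "left_module S N" and N': "left_module S N'"
    and g: "g \<in> mod_hom S N N'" and z: "z \<in> frags P N"
  shows "coord N' s x (frag_map (\<lambda>p. p) g z) = g (coord N s x z)"
proof -
  have "coord N' s x (frag_map (\<lambda>p. p) g z) = frag_eval N' (\<lambda>p. s (fst p) x \<odot>\<^bsub>N'\<^esub> g (snd p)) z"
    unfolding coord_def
    by (subst frag_eval_map[OF left_module_abelian_group[OF N'] z _ _ coord_fun[OF db N']])
      (auto simp: mod_hom_closed[OF g])
  also have "\<dots> = frag_eval N' (\<lambda>p. g (s (fst p) x \<odot>\<^bsub>N\<^esub> snd p)) z"
    by (rule frag_eval_cong[OF left_module_abelian_group[OF N'] z])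
      (auto simp: mod_homD[OF g] dual_basis_coeff_closed[OF db, simplified] intro!: mod_hom_closed[OF g] left_module.smult_closed[OF N])
  also have "\<dots> = g (coord N s x z)"
    unfolding coord_def
    by (rule additive_frag_eval[symmetric, OF left_module_abelian_group[OF N] left_module_abelian_group[OF N'] _ _ z coord_fun[OF db N]])
      (auto simp: mod_homD[OF g])
  finally show ?thesis .
qed

lemma projective_moduleE:
  assumes "projective_module R P"
  obtains s where "dual_basis R P (carrier P) s"
proof -
  have "N = carrier P" if "submodule N R P" "carrier P \<subseteq> N" for N
    using that subgroup.subset[of N "add_monoid P"] by (auto simp: submodule_def)
  then show ?thesis using projective_module_dual_basis[OF assms, of "carrier P"] that by blast
qed

text \<open>Coordinates commute with g and detect null sums, so injectivity of g on N is
  enough.\<close>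

lemma projective_flat_inj:
  assumes P: "projective_module (opp_ring S) P" and N: "left_module S N" and N': "left_module S N'"
    and g: "g \<in> mod_hom S N N'" "inj_on g (carrier N)"
    and z: "z \<in> frags P N" "frag_map (\<lambda>p. p) g z \<in> tensor_null S P N'"
  shows "z \<in> tensor_null S P N"
proof -
  obtain s where s: "dual_basis (opp_ring S) P (carrier P) s" using P by (rule projective_moduleE)
  interpret N: left_module S N by fact
  show ?thesis
  proof (rule tensor_null_if_coord[OF s N z(1)])
    fix x
    have "g (coord N s x z) = g \<zero>\<^bsub>N\<^esub>"
      using coord_null[OF s N' z(2)] by (simp add: coord_frag_map[OF s N N' g(1) z(1)] mod_hom_zero[OF N N' g(1)])
    then show "coord N s x z = \<zero>\<^bsub>N\<^esub>"
      by (rule inj_onD[OF g(2)]) (auto simp: coord_closed[OF s N z(1)])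
  qed
qed

text \<open>The coordinates of z are killed by h, hence have preimages under g; the expansion of z
  in coordinates reassembles them.\<close>

lemma projective_flat_exact:
  assumes P: "projective_module (opp_ring S) P" and N: "left_module S N" and N': "left_module S N'" and N'': "left_module S N''"
    and g: "g \<in> mod_hom S N N'" and h: "h \<in> mod_hom S N' N''" and gh: "g ` carrier N = a_kernel N' N'' h"
    and z: "z \<in> frags P N'" "frag_map (\<lambda>p. p) h z \<in> tensor_null S P N''"
  shows "\<exists>w \<in> frags P N. z - frag_map (\<lambda>p. p) g w \<in> tensor_null S P N'"
proof -
  obtain s where s: "dual_basis (opp_ring S) P (carrier P) s" using P by (rule projective_moduleE)
  have "coord N' s x z \<in> g ` carrier N" for x
    unfolding gh using coord_null[OF s N'' z(2)]
    by (simp add: coord_frag_map[OF s N' N'' h z(1)] a_kernel_eq coord_closed[OF s N' z(1)])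
  then have "\<exists>m. \<forall>x. m x \<in> carrier N \<and> g (m x) = coord N' s x z"
    by (intro choice) (metis imageE)
  then obtain m where m: "\<And>x. m x \<in> carrier N" "\<And>x. g (m x) = coord N' s x z" by blast
  obtain F where F: "F \<subseteq> carrier P" "z - (\<Sum>x\<in>F. frag_of (x, coord N' s x z)) \<in> tensor_null S P N'"
    using coord_expand[OF s N' z(1)] by blast
  show ?thesis
    by (rule bexI[of _ "\<Sum>x\<in>F. frag_of (x, m x)"]) (use F m in \<open>auto simp: frag_map_sum intro!: frags_sum\<close>)
qed

section \<open>Dimension shifting\<close>

text \<open>
  \<open>tor_vanishes S P d N n\<close> is exactness of \<open>P \<otimes> N\<close> in degree \<open>n + 1\<close>; \<open>tor_inj S P d M N i n\<close> says
  that \<open>i\<close> is injective on the cokernels of \<open>P\<^sub>n\<^sub>+\<^sub>1 \<otimes> - \<rightarrow> P\<^sub>n \<otimes> -\<close>.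
\<close>

definition tor_vanishes ::
  "'s ring \<Rightarrow> (nat \<Rightarrow> ('s, 'p) module) \<Rightarrow> (nat \<Rightarrow> 'p \<Rightarrow> 'p) \<Rightarrow> ('s, 'n, 'y) module_scheme \<Rightarrow> nat \<Rightarrow> bool" where
  "tor_vanishes S P d N n \<longleftrightarrow>
     (\<forall>z \<in> frags (P (Suc n)) N. frag_map (d n) (\<lambda>x. x) z \<in> tensor_null S (P n) N \<longrightarrow>
        (\<exists>w \<in> frags (P (Suc (Suc n))) N. z - frag_map (d (Suc n)) (\<lambda>x. x) w \<in> tensor_null S (P (Suc n)) N))"

definition tor_inj ::
  "'s ring \<Rightarrow> (nat \<Rightarrow> ('s, 'p) module) \<Rightarrow> (nat \<Rightarrow> 'p \<Rightarrow> 'p) \<Rightarrow> ('s, 'm, 'x) module_scheme \<Rightarrow>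
   ('s, 'n, 'y) module_scheme \<Rightarrow> ('m \<Rightarrow> 'n) \<Rightarrow> nat \<Rightarrow> bool" where
  "tor_inj S P d M N i n \<longleftrightarrow>
     (\<forall>z \<in> frags (P n) M.
        (\<exists>w \<in> frags (P (Suc n)) N. frag_map (\<lambda>x. x) i z - frag_map (d n) (\<lambda>x. x) w \<in> tensor_null S (P n) N) \<longrightarrow>
        (\<exists>w \<in> frags (P (Suc n)) M. z - frag_map (d n) (\<lambda>x. x) w \<in> tensor_null S (P n) M))"

text \<open>P is a complex of projectives here; its augmentation to C enters only in degree 0, with
  \<open>tor_inj_0_iff\<close>.\<close>

locale short_exact_tensor =
  fixes S :: "'s ring" and P :: "nat \<Rightarrow> ('s, 'p) module" and d :: "nat \<Rightarrow> 'p \<Rightarrow> 'p"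
    and L :: "('s, 'l) module" and M :: "('s, 'm) module" and N :: "('s, 'n) module"
    and i :: "'l \<Rightarrow> 'm" and q :: "'m \<Rightarrow> 'n"
  assumes proj: "projective_module (opp_ring S) (P n)"
    and d: "d n \<in> mod_hom (opp_ring S) (P (Suc n)) (P n)"
    and dd: "x \<in> carrier (P (Suc (Suc n))) \<Longrightarrow> d n (d (Suc n) x) = \<zero>\<^bsub>P n\<^esub>"
    and L: "left_module S L" and M: "left_module S M" and N: "left_module S N"
    and i: "i \<in> mod_hom S L M" "inj_on i (carrier L)" and iq: "i ` carrier L = a_kernel M N q"
    and q: "q \<in> mod_hom S M N" "q ` carrier M = carrier N"
begin

lemma P: "left_module (opp_ring S) (P n)"
  using proj[of n] by (simp add: projective_module_def)

lemmas null =
  tensor_null_add[OF P L] tensor_null_add[OF P M] tensor_null_add[OF P N]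
  tensor_null_diff[OF P L] tensor_null_diff[OF P M] tensor_null_diff[OF P N]

abbreviation "bd n \<equiv> frag_map (d n) (\<lambda>x. x)"
abbreviation "co g \<equiv> frag_map (\<lambda>x. x) g"

lemma co_bd: "co g (bd n z) = bd n (co g z)"
  by (simp add: frag_map_comp)

lemma bd_frags: "z \<in> frags (P (Suc n)) K \<Longrightarrow> bd n z \<in> frags (P n) K"
  by (rule frag_map_frags) (auto simp: mod_hom_closed[OF d])

lemma co_i_frags: "z \<in> frags (P n) L \<Longrightarrow> co i z \<in> frags (P n) M"
  by (rule frag_map_frags) (auto simp: mod_hom_closed[OF i(1)])

lemma co_q_frags: "z \<in> frags (P n) M \<Longrightarrow> co q z \<in> frags (P n) N"
  by (rule frag_map_frags) (auto simp: mod_hom_closed[OF q(1)])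

lemma bd_null: "left_module S K \<Longrightarrow> z \<in> tensor_null S (P (Suc n)) K \<Longrightarrow> bd n z \<in> tensor_null S (P n) K"
  by (rule frag_map_null[OF P _ P _ d mod_hom_ident])

lemma co_i_null: "z \<in> tensor_null S (P n) L \<Longrightarrow> co i z \<in> tensor_null S (P n) M"
  by (rule frag_map_null[OF P L P M mod_hom_ident i(1)])

lemma co_q_null: "z \<in> tensor_null S (P n) M \<Longrightarrow> co q z \<in> tensor_null S (P n) N"
  by (rule frag_map_null[OF P M P N mod_hom_ident q(1)])

lemma bd_bd: "left_module S K \<Longrightarrow> z \<in> frags (P (Suc (Suc n))) K \<Longrightarrow> bd n (bd (Suc n) z) \<in> tensor_null S (P n) K"
  unfolding frag_map_comp by (rule frag_map_null_if_zero[OF P])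
    (auto simp: dd mod_hom_closed[OF d] left_module_zero_closed[OF P])

lemma co_q_i: "z \<in> frags (P n) L \<Longrightarrow> co q (co i z) \<in> tensor_null S (P n) N"
proof -
  assume "z \<in> frags (P n) L"
  moreover have "i x \<in> a_kernel M N q" if "x \<in> carrier L" for x using that iq by blast
  ultimately show ?thesis
    unfolding frag_map_comp
    by (intro frag_map_null_if_zero[OF P N])
      (auto simp: a_kernel_eq mod_hom_closed[OF q(1)] left_module_zero_closed[OF N])
qed

lemmas co_i_null_D = projective_flat_inj[OF proj L M i]
lemmas co_q_null_D = projective_flat_exact[OF proj L M N i(1) q(1) iq]

lemma lift_q: "z \<in> frags (P n) N \<Longrightarrow> \<exists>w \<in> frags (P n) M. co q w = z"
  by (rule frag_map_surj) (auto simp: q(2))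

text \<open>The connecting map of the snake lemma: when the homology of P \<otimes> M in degree n +
  1 vanishes, that of P \<otimes> N is the kernel of the map induced by i on cokernels in degree n.
  Using cokernels instead of homology makes degree 0 no exception.\<close>

lemma tor_connecting:
  assumes van: "tor_vanishes S P d M n"
  shows "tor_vanishes S P d N n \<longleftrightarrow> tor_inj S P d L M i n"
proof
  assume vN: "tor_vanishes S P d N n"
  show "tor_inj S P d L M i n"
    unfolding tor_inj_def
  proof (intro ballI impI)
    fix z assume z: "z \<in> frags (P n) L"
      and "\<exists>w\<in>frags (P (Suc n)) M. co i z - bd n w \<in> tensor_null S (P n) M"
    then obtain w where w: "w \<in> frags (P (Suc n)) M" "co i z - bd n w \<in> tensor_null S (P n) M" by blast
    have "co q (co i z) - co q (co i z - bd n w) \<in> tensor_null S (P n) N"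
      by (intro null co_q_null w co_q_i z)
    then have "bd n (co q w) \<in> tensor_null S (P n) N" by (simp add: co_bd)
    then obtain u where u: "u \<in> frags (P (Suc (Suc n))) N" "co q w - bd (Suc n) u \<in> tensor_null S (P (Suc n)) N"
      using vN co_q_frags[OF w(1)] unfolding tor_vanishes_def by blast
    obtain v where v: "v \<in> frags (P (Suc (Suc n))) M" "co q v = u" using lift_q[OF u(1)] by blast
    \<comment> \<open>Corrected by the boundary of a lift of u, w vanishes over N and so comes from
      some x over L. Flatness then cancels i from the relation between z and the boundary of
      x.\<close>
    have "co q (w - bd (Suc n) v) \<in> tensor_null S (P (Suc n)) N" using u(2) v(2) by (simp add: co_bd)
    from co_q_null_D[OF frags_diff[OF w(1) bd_frags[OF v(1)]] this]
    obtain x where x: "x \<in> frags (P (Suc n)) L" "w - bd (Suc n) v - co i x \<in> tensor_null S (P (Suc n)) M" by blast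
    have "co i z - bd n w + (bd n (w - bd (Suc n) v - co i x) + bd n (bd (Suc n) v)) \<in> tensor_null S (P n) M"
      by (intro null bd_null bd_bd M w(2) x v)
    then have "co i (z - bd n x) \<in> tensor_null S (P n) M" by (simp add: co_bd algebra_simps)
    from co_i_null_D[OF frags_diff[OF z bd_frags[OF x(1)]] this]
    show "\<exists>w\<in>frags (P (Suc n)) L. z - bd n w \<in> tensor_null S (P n) L" using x(1) by blast
  qed
next
  assume inj: "tor_inj S P d L M i n"
  show "tor_vanishes S P d N n"
    unfolding tor_vanishes_def
  proof (intro ballI impI)
    fix z assume z: "z \<in> frags (P (Suc n)) N" "bd n z \<in> tensor_null S (P n) N"
    obtain y where y: "y \<in> frags (P (Suc n)) M" "co q y = z" using lift_q[OF z(1)] by blast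
    have "co q (bd n y) \<in> tensor_null S (P n) N" using z y by (simp add: co_bd)
    from co_q_null_D[OF bd_frags[OF y(1)] this]
    obtain x where x: "x \<in> frags (P n) L" "bd n y - co i x \<in> tensor_null S (P n) M" by blast
    have "co i x - bd n y \<in> tensor_null S (P n) M" using tensor_null_minus[OF P M x(2)] by simp
    then obtain w where w: "w \<in> frags (P (Suc n)) L" "x - bd n w \<in> tensor_null S (P n) L"
      using inj x(1) y(1) unfolding tor_inj_def by blast
    have "bd n y - co i x + co i (x - bd n w) \<in> tensor_null S (P n) M"
      by (intro null x co_i_null w)
    \<comment> \<open>Subtracting i w leaves the image z of y unchanged modulo null sums and turns y
      into a cycle over M.\<close>
    then have "bd n (y - co i w) \<in> tensor_null S (P n) M" by (simp add: co_bd)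
    then obtain u where u: "u \<in> frags (P (Suc (Suc n))) M"
        "y - co i w - bd (Suc n) u \<in> tensor_null S (P (Suc n)) M"
      using van frags_diff[OF y(1) co_i_frags[OF w(1)]] unfolding tor_vanishes_def by blast
    have "co q (y - co i w - bd (Suc n) u) + co q (co i w) \<in> tensor_null S (P (Suc n)) N"
      by (intro null co_q_null u co_q_i w)
    then show "\<exists>w\<in>frags (P (Suc (Suc n))) N. z - bd (Suc n) w \<in> tensor_null S (P (Suc n)) N"
      using y(2) co_q_frags[OF u(1)] by (intro bexI[of _ "co q u"]) (auto simp: co_bd)
  qed
qed

text \<open>For z over L, i z is a boundary iff it is a cycle, by the vanishing for M, and iff z is
  a cycle, by flatness. So i is injective on cokernels in degree n + 1 exactly when every such cycle
  z is a boundary.\<close>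

lemma tor_inj_Suc_iff:
  assumes van: "tor_vanishes S P d M n"
  shows "tor_inj S P d L M i (Suc n) \<longleftrightarrow> tor_vanishes S P d L n"
proof
  assume inj: "tor_inj S P d L M i (Suc n)"
  show "tor_vanishes S P d L n"
    unfolding tor_vanishes_def
  proof (intro ballI impI)
    fix z assume z: "z \<in> frags (P (Suc n)) L" "bd n z \<in> tensor_null S (P n) L"
    have "bd n (co i z) \<in> tensor_null S (P n) M" using co_i_null[OF z(2)] by (simp add: co_bd)
    then show "\<exists>w\<in>frags (P (Suc (Suc n))) L. z - bd (Suc n) w \<in> tensor_null S (P (Suc n)) L"
      using van inj z(1) co_i_frags[OF z(1)] unfolding tor_vanishes_def tor_inj_def by blast
  qed
next
  assume vL: "tor_vanishes S P d L n"
  show "tor_inj S P d L M i (Suc n)"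
    unfolding tor_inj_def
  proof (intro ballI impI)
    fix z assume z: "z \<in> frags (P (Suc n)) L"
      and "\<exists>w\<in>frags (P (Suc (Suc n))) M. co i z - bd (Suc n) w \<in> tensor_null S (P (Suc n)) M"
    then obtain w where w: "w \<in> frags (P (Suc (Suc n))) M" "co i z - bd (Suc n) w \<in> tensor_null S (P (Suc n)) M" by blast
    have "bd n (co i z - bd (Suc n) w) + bd n (bd (Suc n) w) \<in> tensor_null S (P n) M"
      by (intro null bd_null bd_bd M w)
    then have "co i (bd n z) \<in> tensor_null S (P n) M" by (simp add: co_bd)
    from co_i_null_D[OF bd_frags[OF z] this] show "\<exists>w\<in>frags (P (Suc (Suc n))) L. z - bd (Suc n) w \<in> tensor_null S (P (Suc n)) L"
      using vL z unfolding tor_vanishes_def by blast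
  qed
qed

lemma tor_shift:
  assumes "\<And>n. tor_vanishes S P d M n"
  shows "tor_vanishes S P d N (Suc n) \<longleftrightarrow> tor_vanishes S P d L n"
  using tor_connecting[OF assms] tor_inj_Suc_iff[OF assms] by simp

text \<open>By right exactness, the cokernel in degree 0 is the tensor product with C
  itself.\<close>

lemma tor_inj_0_iff:
  assumes C: "left_module (opp_ring S) C" and \<epsilon>: "\<epsilon> \<in> mod_hom (opp_ring S) (P 0) C" "\<epsilon> ` carrier (P 0) = carrier C"
    and ker: "d 0 ` carrier (P (Suc 0)) = a_kernel (P 0) C \<epsilon>"
  shows "tor_inj S P d L M i 0 \<longleftrightarrow>
    (\<forall>z \<in> frags C L. co i z \<in> tensor_null S C M \<longrightarrow> z \<in> tensor_null S C L)"
proof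
  let ?e = "frag_map \<epsilon> (\<lambda>x. x)"
  have e_bd: "?e (bd 0 w) \<in> tensor_null S C K" if "left_module S K" "w \<in> frags (P (Suc 0)) K" for K :: "('s, 'k) module" and w
  proof -
    have "d 0 x \<in> a_kernel (P 0) C \<epsilon>" if "x \<in> carrier (P (Suc 0))" for x using that ker by auto
    then show ?thesis
      unfolding frag_map_comp using that
      by (intro frag_map_null_if_zero[OF C]) (auto simp: a_kernel_eq left_module_zero_closed[OF C])
  qed
  have e_null: "?e w \<in> tensor_null S C K" if "left_module S K" "w \<in> tensor_null S (P 0) K" for K :: "('s, 'k) module" and w
    by (rule frag_map_null[OF P that(1) C that(1) \<epsilon>(1) mod_hom_ident that(2)])
  have co_e: "co i (?e z) = ?e (co i z)" for z by (simp add: frag_map_comp)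
  {
    assume inj: "tor_inj S P d L M i 0"
    show "\<forall>z \<in> frags C L. co i z \<in> tensor_null S C M \<longrightarrow> z \<in> tensor_null S C L"
    proof (intro ballI impI)
      fix c assume c: "c \<in> frags C L" "co i c \<in> tensor_null S C M"
      obtain z where z: "z \<in> frags (P 0) L" "?e z = c"
        using frag_map_surj[OF c(1) \<epsilon>(2), of "\<lambda>x. x" L] by auto
      have "?e (co i z) \<in> tensor_null S C M" using c(2) z(2) co_e by metis
      from tensor_right_exact_left[OF P M C P \<epsilon> d ker co_i_frags[OF z(1)] this]
      have "\<exists>w\<in>frags (P (Suc 0)) M. co i z - bd 0 w \<in> tensor_null S (P 0) M" by simp
      then obtain w where w: "w \<in> frags (P (Suc 0)) L" "z - bd 0 w \<in> tensor_null S (P 0) L"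
        using inj z(1) unfolding tor_inj_def by blast
      have "?e (z - bd 0 w) + ?e (bd 0 w) \<in> tensor_null S C L"
        by (intro tensor_null_add[OF C L] e_null e_bd L w)
      then show "c \<in> tensor_null S C L" using z(2) by simp
    qed
  next
    assume inj: "\<forall>z \<in> frags C L. co i z \<in> tensor_null S C M \<longrightarrow> z \<in> tensor_null S C L"
    show "tor_inj S P d L M i 0"
      unfolding tor_inj_def
    proof (intro ballI impI)
      fix z assume z: "z \<in> frags (P 0) L"
        and "\<exists>w\<in>frags (P (Suc 0)) M. co i z - bd 0 w \<in> tensor_null S (P 0) M"
      then obtain w where w: "w \<in> frags (P (Suc 0)) M" "co i z - bd 0 w \<in> tensor_null S (P 0) M" by blast
      have "?e (co i z - bd 0 w) + ?e (bd 0 w) \<in> tensor_null S C M"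
        by (intro tensor_null_add[OF C M] e_null e_bd M w)
      then have "co i (?e z) \<in> tensor_null S C M" by (simp add: co_e)
      moreover have "?e z \<in> frags C L"
        by (rule frag_map_frags[OF z]) (auto simp: mod_hom_closed[OF \<epsilon>(1)])
      ultimately have "?e z \<in> tensor_null S C L" using inj by blast
      from tensor_right_exact_left[OF P L C P \<epsilon> d ker z this]
      show "\<exists>w\<in>frags (P (Suc 0)) L. z - bd 0 w \<in> tensor_null S (P 0) L" by simp
    qed
  }
qed

end

lemma left_module_submodule:
  assumes M: "left_module R M" and H: "submodule H R M"
  shows "left_module R (M\<lparr>carrier := H\<rparr>)"
proof -
  interpret M: left_module R M by fact
  interpret H: subgroup H "add_monoid M" using H by (simp add: submodule_def)
  have c: "x \<in> carrier M" if "x \<in> H" for x using that H.subset by auto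
  have "abelian_group (M\<lparr>carrier := H\<rparr>)"
  proof (rule abelian_groupI)
    fix x assume "x \<in> carrier (M\<lparr>carrier := H\<rparr>)"
    then show "\<exists>y\<in>carrier (M\<lparr>carrier := H\<rparr>). y \<oplus>\<^bsub>M\<lparr>carrier := H\<rparr>\<^esub> x = \<zero>\<^bsub>M\<lparr>carrier := H\<rparr>\<^esub>"
      using H.m_inv_closed[of x] c[of x]
      by (intro bexI[of _ "\<ominus>\<^bsub>M\<^esub> x"]) (simp_all add: M.M.l_neg a_inv_def[symmetric])
  qed (use H.m_closed H.one_closed c in \<open>auto simp: M.M.a_ac\<close>)
  then show ?thesis
    unfolding left_module_def left_module_axioms_def
    using submodule.smult_closed[OF H] c M.ring_axioms
    by (auto simp: M.smult_l_distr M.smult_r_distr M.smult_assoc1)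
qed

lemmas left_module_image = left_module_submodule[OF _ submodule_image]

lemma mod_hom_lin:
  assumes B: "left_module R B" and f: "f \<in> mod_hom R A B" and g: "g \<in> mod_hom R A B"
  shows mod_hom_plus: "(\<lambda>x. f x \<oplus>\<^bsub>B\<^esub> g x) \<in> mod_hom R A B"
    and mod_hom_minus: "(\<lambda>x. f x \<ominus>\<^bsub>B\<^esub> g x) \<in> mod_hom R A B"
proof -
  interpret B: left_module R B by fact
  note h = mod_homD[OF f] mod_homD[OF g]
  show "(\<lambda>x. f x \<oplus>\<^bsub>B\<^esub> g x) \<in> mod_hom R A B"
    by (rule mod_homI) (auto simp: h B.M.a_ac B.smult_r_distr)
  have sm: "r \<odot>\<^bsub>B\<^esub> (\<ominus>\<^bsub>B\<^esub> x) = \<ominus>\<^bsub>B\<^esub> (r \<odot>\<^bsub>B\<^esub> x)" if "r \<in> carrier R" "x \<in> carrier B" for r x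
    by (rule additive_map_minus[of B B]) (use that B.M.abelian_group_axioms in \<open>auto simp: B.smult_r_distr\<close>)
  show "(\<lambda>x. f x \<ominus>\<^bsub>B\<^esub> g x) \<in> mod_hom R A B"
    by (rule mod_homI) (auto simp: h B.M.minus_eq B.M.minus_add B.M.a_ac B.smult_r_distr sm)
qed

text \<open>The differentials of a resolution are onto kernels, not onto whole modules, so the
  codomain is cut down to the image of e before lifting.\<close>

lemma projective_lift:
  assumes P: "projective_module R P" and A: "left_module R A" and B: "left_module R B"
    and e: "e \<in> mod_hom R A B" and g: "g \<in> mod_hom R P B"
    and im: "\<And>x. x \<in> carrier P \<Longrightarrow> g x \<in> e ` carrier A"
  shows "\<exists>h \<in> mod_hom R P A. \<forall>x \<in> carrier P. e (h x) = g x"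
proof (rule projective_moduleD[OF P A left_module_image[OF B A B e]])
  show "e \<in> mod_hom R A (B\<lparr>carrier := e ` carrier A\<rparr>)" "g \<in> mod_hom R P (B\<lparr>carrier := e ` carrier A\<rparr>)"
    using e g im by (auto simp: mod_hom_def)
qed simp

section \<open>Comparison of projective resolutions\<close>

lemma projective_resolutionD:
  assumes "projective_resolution R A P d \<epsilon>"
  shows "projective_module R (P n)" "left_module R (P n)" "d n \<in> mod_hom R (P (Suc n)) (P n)" "\<epsilon> \<in> mod_hom R (P 0) A"
    "\<epsilon> ` carrier (P 0) = carrier A" "d 0 ` carrier (P (Suc 0)) = a_kernel (P 0) A \<epsilon>"
    "d (Suc n) ` carrier (P (Suc (Suc n))) = a_kernel (P (Suc n)) (P n) (d n)"
  using assms by (simp_all add: projective_resolution_def projective_module_def)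

lemma projective_resolution_comp_zero:
  assumes "projective_resolution R A P d \<epsilon>"
  shows "x \<in> carrier (P (Suc 0)) \<Longrightarrow> \<epsilon> (d 0 x) = \<zero>\<^bsub>A\<^esub>"
    and "y \<in> carrier (P (Suc (Suc n))) \<Longrightarrow> d n (d (Suc n) y) = \<zero>\<^bsub>P n\<^esub>"
  using projective_resolutionD(6)[OF assms] projective_resolutionD(7)[OF assms, of n]
  by (auto simp: a_kernel_eq)

lemma resolution_chain_map:
  fixes P :: "nat \<Rightarrow> ('r, 'p) module" and Q :: "nat \<Rightarrow> ('r, 'q) module"
  assumes A: "left_module R A" and PR: "projective_resolution R A P d \<epsilon>" and QR: "projective_resolution R A Q d' \<epsilon>'"
  obtains \<phi> where "\<And>n. \<phi> n \<in> mod_hom R (P n) (Q n)" "\<And>x. x \<in> carrier (P 0) \<Longrightarrow> \<epsilon>' (\<phi> 0 x) = \<epsilon> x"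
    "\<And>n x. x \<in> carrier (P (Suc n)) \<Longrightarrow> d' n (\<phi> (Suc n) x) = \<phi> n (d n x)"
proof -
  note p = projective_resolutionD[OF PR] and q = projective_resolutionD[OF QR]
  note pz = projective_resolution_comp_zero[OF PR]
  \<comment> \<open>The invariant is what makes the next lift possible: f after the differential
    lands in the cycles of Q. In degree 0 this follows from compatibility with the
    augmentations.\<close>
  let ?I = "\<lambda>n f. f \<in> mod_hom R (P n) (Q n) \<and>
    (case n of 0 \<Rightarrow> \<forall>x \<in> carrier (P 0). \<epsilon>' (f x) = \<epsilon> x
      | Suc m \<Rightarrow> \<forall>x \<in> carrier (P (Suc n)). d' m (f (d n x)) = \<zero>\<^bsub>Q m\<^esub>)"
  have "\<exists>\<phi>. \<forall>n. ?I n (\<phi> n) \<and> (\<forall>x\<in>carrier (P (Suc n)). d' n (\<phi> (Suc n) x) = \<phi> n (d n x))"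
  proof (rule dependent_nat_choice)
    have "\<exists>f\<in>mod_hom R (P 0) (Q 0). \<forall>x\<in>carrier (P 0). \<epsilon>' (f x) = \<epsilon> x"
      by (rule projective_lift[OF p(1) q(2) A q(4) p(4)]) (auto simp: q(5) mod_hom_closed[OF p(4)])
    then show "\<exists>f. ?I 0 f" by auto
  next
    fix f n assume f: "?I n f"
    then have fh: "f \<in> mod_hom R (P n) (Q n)" by blast
    have im: "f (d n x) \<in> d' n ` carrier (Q (Suc n))" if x: "x \<in> carrier (P (Suc n))" for x
    proof (cases n)
      case 0
      then show ?thesis using x f mod_hom_closed[OF fh] mod_hom_closed[OF p(3)]
        by (auto simp: q(6) a_kernel_eq pz(1))
    next
      case (Suc m)
      then show ?thesis using x f mod_hom_closed[OF fh] mod_hom_closed[OF p(3)]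
        by (auto simp: q(7) a_kernel_eq)
    qed
    obtain h where h: "h \<in> mod_hom R (P (Suc n)) (Q (Suc n))" "\<forall>x \<in> carrier (P (Suc n)). d' n (h x) = f (d n x)"
      using projective_lift[OF p(1) q(2) q(2) q(3) mod_hom_comp[OF p(3) fh] im] by blast
    have "d' n (h (d (Suc n) x)) = \<zero>\<^bsub>Q n\<^esub>" if x: "x \<in> carrier (P (Suc (Suc n)))" for x
      using h(2) mod_hom_closed[OF p(3) x] by (simp add: pz(2)[OF x] mod_hom_zero[OF p(2) q(2) fh])
    with h show "\<exists>h. ?I (Suc n) h \<and> (\<forall>x\<in>carrier (P (Suc n)). d' n (h x) = f (d n x))" by auto
  qed
  then obtain \<phi> where \<phi>: "\<And>n. ?I n (\<phi> n)" "\<And>n. \<forall>x\<in>carrier (P (Suc n)). d' n (\<phi> (Suc n) x) = \<phi> n (d n x)" by blast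
  show ?thesis
  proof (rule that[of \<phi>])
    show "\<phi> n \<in> mod_hom R (P n) (Q n)" for n using \<phi>(1) by blast
    show "\<epsilon>' (\<phi> 0 x) = \<epsilon> x" if "x \<in> carrier (P 0)" for x using \<phi>(1)[of 0] that by simp
  qed (use \<phi>(2) in blast)
qed

lemma resolution_null_homotopy:
  fixes P :: "nat \<Rightarrow> ('r, 'p) module"
  assumes A: "left_module R A" and PR: "projective_resolution R A P d \<epsilon>"
    and u: "\<And>n. u n \<in> mod_hom R (P n) (P n)" "\<And>x. x \<in> carrier (P 0) \<Longrightarrow> \<epsilon> (u 0 x) = \<zero>\<^bsub>A\<^esub>"
    and ud: "\<And>n x. x \<in> carrier (P (Suc n)) \<Longrightarrow> d n (u (Suc n) x) = u n (d n x)"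
  obtains k where "\<And>n. k n \<in> mod_hom R (P n) (P (Suc n))"
    "\<And>n x. x \<in> carrier (P (Suc n)) \<Longrightarrow> d (Suc n) (k (Suc n) x) = u (Suc n) x \<ominus>\<^bsub>P (Suc n)\<^esub> k n (d n x)"
proof -
  note p = projective_resolutionD[OF PR]
  note pz = projective_resolution_comp_zero[OF PR]
  have sub0: "a \<ominus>\<^bsub>P n\<^esub> a = \<zero>\<^bsub>P n\<^esub>" "a \<ominus>\<^bsub>P n\<^esub> \<zero>\<^bsub>P n\<^esub> = a" if "a \<in> carrier (P n)" for a n
  proof -
    interpret left_module R "P n" by (rule p(2))
    show "a \<ominus>\<^bsub>P n\<^esub> a = \<zero>\<^bsub>P n\<^esub>" "a \<ominus>\<^bsub>P n\<^esub> \<zero>\<^bsub>P n\<^esub> = a" using that by (simp_all add: M.minus_eq M.r_neg)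
  qed
  \<comment> \<open>Weaker than the homotopy equation in degree n, but just what puts u - k d, one
    degree up, into the cycles, where it lifts. In degree 0 it comes from d k = u.\<close>
  let ?I = "\<lambda>n f. f \<in> mod_hom R (P n) (P (Suc n)) \<and> (\<forall>y \<in> carrier (P (Suc n)). d n (f (d n y)) = u n (d n y))"
  have "\<exists>k. \<forall>n. ?I n (k n) \<and>
      (\<forall>x\<in>carrier (P (Suc n)). d (Suc n) (k (Suc n) x) = u (Suc n) x \<ominus>\<^bsub>P (Suc n)\<^esub> k n (d n x))"
  proof (rule dependent_nat_choice)
    have "\<exists>f\<in>mod_hom R (P 0) (P (Suc 0)). \<forall>x\<in>carrier (P 0). d 0 (f x) = u 0 x"
      by (rule projective_lift[OF p(1) p(2) p(2) p(3) u(1)])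
        (auto simp: p(6) a_kernel_eq mod_hom_closed[OF u(1)] u(2))
    then show "\<exists>f. ?I 0 f" using mod_hom_closed[OF p(3)] by blast
  next
    fix f n assume f: "?I n f"
    then have fh: "f \<in> mod_hom R (P n) (P (Suc n))" by blast
    let ?g = "\<lambda>x. u (Suc n) x \<ominus>\<^bsub>P (Suc n)\<^esub> f (d n x)"
    have g: "?g \<in> mod_hom R (P (Suc n)) (P (Suc n))"
      by (rule mod_hom_minus[OF p(2) u(1) mod_hom_comp[OF p(3) fh]])
    have im: "?g x \<in> d (Suc n) ` carrier (P (Suc (Suc n)))" if x: "x \<in> carrier (P (Suc n))" for x
    proof -
      have "d n (?g x) = d n (u (Suc n) x) \<ominus>\<^bsub>P n\<^esub> d n (f (d n x))"
        by (rule mod_hom_diff[OF p(2) p(2) p(3)])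
          (use x in \<open>auto intro!: mod_hom_closed[OF u(1)] mod_hom_closed[OF fh] mod_hom_closed[OF p(3)]\<close>)
      also have "\<dots> = \<zero>\<^bsub>P n\<^esub>"
        using f x by (simp add: ud sub0 mod_hom_closed[OF u(1)] mod_hom_closed[OF p(3)])
      finally show ?thesis unfolding p(7) a_kernel_eq using mod_hom_closed[OF g x] by simp
    qed
    obtain h where h: "h \<in> mod_hom R (P (Suc n)) (P (Suc (Suc n)))" "\<forall>x \<in> carrier (P (Suc n)). d (Suc n) (h x) = ?g x"
      using projective_lift[OF p(1) p(2) p(2) p(3) g im] by blast
    have "d (Suc n) (h (d (Suc n) x)) = u (Suc n) (d (Suc n) x)" if x: "x \<in> carrier (P (Suc (Suc n)))" for x
      using h(2) mod_hom_closed[OF p(3) x]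
      by (simp add: pz(2)[OF x] mod_hom_zero[OF p(2) p(2) fh] sub0 mod_hom_closed[OF u(1)])
    with h show "\<exists>h. ?I (Suc n) h \<and> (\<forall>x\<in>carrier (P (Suc n)). d (Suc n) (h x) = ?g x)" by blast
  qed
  then show ?thesis using that by blast
qed

text \<open>A homotopy on one side suffices: \<psi> \<phi> being homotopic to the identity of P lets
  vanishing pass from Q to P, and exchanging the two resolutions gives the other direction.\<close>

lemma resolution_comparison:
  fixes P :: "nat \<Rightarrow> ('r, 'p) module" and Q :: "nat \<Rightarrow> ('r, 'q) module"
  assumes A: "left_module R A" and PR: "projective_resolution R A P d \<epsilon>" and QR: "projective_resolution R A Q d' \<epsilon>'"
  obtains \<phi> \<psi> k where "\<And>n. \<phi> n \<in> mod_hom R (P n) (Q n)" "\<And>n. \<psi> n \<in> mod_hom R (Q n) (P n)"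
    "\<And>n. k n \<in> mod_hom R (P n) (P (Suc n))"
    "\<And>n x. x \<in> carrier (P (Suc n)) \<Longrightarrow> d' n (\<phi> (Suc n) x) = \<phi> n (d n x)"
    "\<And>n x. x \<in> carrier (Q (Suc n)) \<Longrightarrow> d n (\<psi> (Suc n) x) = \<psi> n (d' n x)"
    "\<And>n x. x \<in> carrier (P (Suc n)) \<Longrightarrow>
       x = \<psi> (Suc n) (\<phi> (Suc n) x) \<oplus>\<^bsub>P (Suc n)\<^esub> (d (Suc n) (k (Suc n) x) \<oplus>\<^bsub>P (Suc n)\<^esub> k n (d n x))"
proof -
  note p = projective_resolutionD[OF PR] and q = projective_resolutionD[OF QR]
  obtain \<phi> where \<phi>: "\<And>n. \<phi> n \<in> mod_hom R (P n) (Q n)" "\<And>x. x \<in> carrier (P 0) \<Longrightarrow> \<epsilon>' (\<phi> 0 x) = \<epsilon> x"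
    "\<And>n x. x \<in> carrier (P (Suc n)) \<Longrightarrow> d' n (\<phi> (Suc n) x) = \<phi> n (d n x)"
    using resolution_chain_map[OF A PR QR] by blast
  obtain \<psi> where \<psi>: "\<And>n. \<psi> n \<in> mod_hom R (Q n) (P n)" "\<And>x. x \<in> carrier (Q 0) \<Longrightarrow> \<epsilon> (\<psi> 0 x) = \<epsilon>' x"
    "\<And>n x. x \<in> carrier (Q (Suc n)) \<Longrightarrow> d n (\<psi> (Suc n) x) = \<psi> n (d' n x)"
    using resolution_chain_map[OF A QR PR] by blast
  define u where "u n x = x \<ominus>\<^bsub>P n\<^esub> \<psi> n (\<phi> n x)" for n x
  have u: "u n \<in> mod_hom R (P n) (P n)" for n
    unfolding u_def by (rule mod_hom_minus[OF p(2) mod_hom_ident mod_hom_comp[OF \<phi>(1) \<psi>(1)]])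
  note c = mod_hom_closed[OF \<phi>(1)] mod_hom_closed[OF \<psi>(1)] mod_hom_closed[OF p(3)] mod_hom_closed[OF p(4)] mod_hom_closed[OF u]
  have u0: "\<epsilon> (u 0 x) = \<zero>\<^bsub>A\<^esub>" if "x \<in> carrier (P 0)" for x
  proof -
    interpret A: left_module R A by fact
    show ?thesis unfolding u_def using that
      by (simp add: mod_hom_diff[OF p(2) A p(4)] c \<phi>(2) \<psi>(2) A.M.minus_eq A.M.r_neg)
  qed
  have ud: "d n (u (Suc n) x) = u n (d n x)" if "x \<in> carrier (P (Suc n))" for n x
    unfolding u_def using that by (simp add: mod_hom_diff[OF p(2) p(2) p(3)] c \<phi>(3) \<psi>(3))
  obtain k where k: "\<And>n. k n \<in> mod_hom R (P n) (P (Suc n))"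
    "\<And>n x. x \<in> carrier (P (Suc n)) \<Longrightarrow> d (Suc n) (k (Suc n) x) = u (Suc n) x \<ominus>\<^bsub>P (Suc n)\<^esub> k n (d n x)"
    using resolution_null_homotopy[OF A PR u u0 ud] by blast
  show ?thesis
  proof (rule that[OF \<phi>(1) \<psi>(1) k(1) \<phi>(3) \<psi>(3)])
    fix n x assume x: "x \<in> carrier (P (Suc n))"
    interpret left_module R "P (Suc n)" by (rule p(2))
    have kd: "k n (d n x) \<in> carrier (P (Suc n))" and pp: "\<psi> (Suc n) (\<phi> (Suc n) x) \<in> carrier (P (Suc n))"
      using x c mod_hom_closed[OF k(1)] by auto
    have "d (Suc n) (k (Suc n) x) \<oplus>\<^bsub>P (Suc n)\<^esub> k n (d n x) = u (Suc n) x"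
      using kd c(5)[OF x] by (simp add: k(2)[OF x] M.minus_eq M.a_assoc M.l_neg)
    also have "\<psi> (Suc n) (\<phi> (Suc n) x) \<oplus>\<^bsub>P (Suc n)\<^esub> \<dots> = x"
      using x pp by (simp add: u_def M.minus_eq M.a_lcomm M.r_neg)
    finally show "x = \<psi> (Suc n) (\<phi> (Suc n) x) \<oplus>\<^bsub>P (Suc n)\<^esub> (d (Suc n) (k (Suc n) x) \<oplus>\<^bsub>P (Suc n)\<^esub> k n (d n x))"
      by simp
  qed
qed

text \<open>\<open>ext_vanishes R P d B n\<close> is exactness of \<open>Hom(P, B)\<close> in degree \<open>n + 1\<close>.\<close>

definition ext_vanishes ::
  "'r ring \<Rightarrow> (nat \<Rightarrow> ('r, 'p) module) \<Rightarrow> (nat \<Rightarrow> 'p \<Rightarrow> 'p) \<Rightarrow> ('r, 'b, 'y) module_scheme \<Rightarrow> nat \<Rightarrow> bool" where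
  "ext_vanishes R P d B n \<longleftrightarrow>
     (\<forall>g \<in> mod_hom R (P (Suc n)) B. (\<forall>x \<in> carrier (P (Suc (Suc n))). g (d (Suc n) x) = \<zero>\<^bsub>B\<^esub>) \<longrightarrow>
        (\<exists>h \<in> mod_hom R (P n) B. \<forall>x \<in> carrier (P (Suc n)). g x = h (d n x)))"

text \<open>A cocycle g equals g \<psi> \<phi> + g k d, as it kills d k. The cocycle g \<psi> on Q
  has the form h0 d', so g = (h0 \<phi> + g k) d.\<close>

lemma ext_vanishes_resolution:
  fixes P :: "nat \<Rightarrow> ('r, 'p) module" and Q :: "nat \<Rightarrow> ('r, 'q) module"
  assumes A: "left_module R A" and B: "left_module R B"
    and PR: "projective_resolution R A P d \<epsilon>" and QR: "projective_resolution R A Q d' \<epsilon>'"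
    and van: "ext_vanishes R Q d' B n"
  shows "ext_vanishes R P d B n"
  unfolding ext_vanishes_def
proof (intro ballI impI)
  obtain \<phi> \<psi> k where \<phi>: "\<And>n. \<phi> n \<in> mod_hom R (P n) (Q n)" and \<psi>: "\<And>n. \<psi> n \<in> mod_hom R (Q n) (P n)"
    and k: "\<And>n. k n \<in> mod_hom R (P n) (P (Suc n))"
    and \<phi>d: "\<And>n x. x \<in> carrier (P (Suc n)) \<Longrightarrow> d' n (\<phi> (Suc n) x) = \<phi> n (d n x)"
    and \<psi>d: "\<And>n x. x \<in> carrier (Q (Suc n)) \<Longrightarrow> d n (\<psi> (Suc n) x) = \<psi> n (d' n x)"
    and h: "\<And>n x. x \<in> carrier (P (Suc n)) \<Longrightarrow>
       x = \<psi> (Suc n) (\<phi> (Suc n) x) \<oplus>\<^bsub>P (Suc n)\<^esub> (d (Suc n) (k (Suc n) x) \<oplus>\<^bsub>P (Suc n)\<^esub> k n (d n x))"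
    using resolution_comparison[OF A PR QR] by blast
  note p = projective_resolutionD[OF PR] and q = projective_resolutionD[OF QR]
  interpret B: left_module R B by fact
  fix g assume g: "g \<in> mod_hom R (P (Suc n)) B" and cocyc: "\<forall>x \<in> carrier (P (Suc (Suc n))). g (d (Suc n) x) = \<zero>\<^bsub>B\<^esub>"
  note c = mod_hom_closed[OF \<phi>] mod_hom_closed[OF \<psi>] mod_hom_closed[OF k] mod_hom_closed[OF p(3)] mod_hom_closed[OF q(3)] mod_hom_closed[OF g]
  have "\<forall>x \<in> carrier (Q (Suc (Suc n))). g (\<psi> (Suc n) (d' (Suc n) x)) = \<zero>\<^bsub>B\<^esub>"
    using cocyc c by (simp add: \<psi>d[symmetric])
  then obtain h0 where h0: "h0 \<in> mod_hom R (Q n) B" "\<And>x. x \<in> carrier (Q (Suc n)) \<Longrightarrow> g (\<psi> (Suc n) x) = h0 (d' n x)"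
    using van[unfolded ext_vanishes_def, THEN bspec, OF mod_hom_comp[OF \<psi> g]] by blast
  show "\<exists>h \<in> mod_hom R (P n) B. \<forall>x \<in> carrier (P (Suc n)). g x = h (d n x)"
  proof (intro bexI ballI)
    fix x assume x: "x \<in> carrier (P (Suc n))"
    interpret left_module R "P (Suc n)" by (rule p(2))
    have "g x = g (\<psi> (Suc n) (\<phi> (Suc n) x)) \<oplus>\<^bsub>B\<^esub> (g (d (Suc n) (k (Suc n) x)) \<oplus>\<^bsub>B\<^esub> g (k n (d n x)))"
      by (subst h[OF x]) (use x c in \<open>simp add: mod_hom_add[OF g]\<close>)
    also have "\<dots> = h0 (\<phi> n (d n x)) \<oplus>\<^bsub>B\<^esub> g (k n (d n x))"
      using cocyc x c by (simp add: h0(2) \<phi>d)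
    finally show "g x = h0 (\<phi> n (d n x)) \<oplus>\<^bsub>B\<^esub> g (k n (d n x))" .
  qed (rule mod_hom_plus[OF B mod_hom_comp[OF \<phi> h0(1)] mod_hom_comp[OF k g]])
qed

text \<open>On formal sums, a pointwise sum of maps does not induce the sum of the induced maps; the
  two agree modulo additivity in the left factor.\<close>

lemma frag_map_plus_left:
  assumes A: "left_module (opp_ring S) A" and N: "left_module S N" and z: "z \<in> frags B N"
    and fg: "\<And>b. b \<in> carrier B \<Longrightarrow> f b \<in> carrier A \<and> g b \<in> carrier A"
  shows "frag_map (\<lambda>x. f x \<oplus>\<^bsub>A\<^esub> g x) (\<lambda>x. x) z - frag_map f (\<lambda>x. x) z - frag_map g (\<lambda>x. x) z \<in> tensor_null S A N"
  using z
proof (induction rule: frags_induct)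
  case (of a n)
  then show ?case using fg by (auto intro!: tensor_null_rel_left[OF A N])
next
  case (diff z w)
  from tensor_null_diff[OF A N diff(3,4)] show ?case by (simp add: algebra_simps)
qed (simp add: tensor_null_0[OF A N])

text \<open>Modulo null sums, z is \<psi> \<phi> z + d k z + k d z. For a cycle the last term is
  null and \<phi> z is the boundary of some w over Q, so z is the boundary of k z + \<psi>
  w.\<close>

lemma tor_vanishes_resolution:
  fixes P :: "nat \<Rightarrow> ('s, 'p) module" and Q :: "nat \<Rightarrow> ('s, 'q) module"
  assumes A: "left_module (opp_ring S) A" and N: "left_module S N"
    and PR: "projective_resolution (opp_ring S) A P d \<epsilon>" and QR: "projective_resolution (opp_ring S) A Q d' \<epsilon>'"
    and van: "tor_vanishes S Q d' N n"
  shows "tor_vanishes S P d N n"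
  unfolding tor_vanishes_def
proof (intro ballI impI)
  let ?m = "\<lambda>f. frag_map f (\<lambda>x. x)"
  obtain \<phi> \<psi> k where \<phi>: "\<And>n. \<phi> n \<in> mod_hom (opp_ring S) (P n) (Q n)" and \<psi>: "\<And>n. \<psi> n \<in> mod_hom (opp_ring S) (Q n) (P n)"
    and k: "\<And>n. k n \<in> mod_hom (opp_ring S) (P n) (P (Suc n))"
    and \<phi>d: "\<And>n x. x \<in> carrier (P (Suc n)) \<Longrightarrow> d' n (\<phi> (Suc n) x) = \<phi> n (d n x)"
    and \<psi>d: "\<And>n x. x \<in> carrier (Q (Suc n)) \<Longrightarrow> d n (\<psi> (Suc n) x) = \<psi> n (d' n x)"
    and h: "\<And>n x. x \<in> carrier (P (Suc n)) \<Longrightarrow>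
       x = \<psi> (Suc n) (\<phi> (Suc n) x) \<oplus>\<^bsub>P (Suc n)\<^esub> (d (Suc n) (k (Suc n) x) \<oplus>\<^bsub>P (Suc n)\<^esub> k n (d n x))"
    using resolution_comparison[OF A PR QR] by blast
  note p = projective_resolutionD[OF PR] and q = projective_resolutionD[OF QR]
  fix z assume z: "z \<in> frags (P (Suc n)) N" and cyc: "?m (d n) z \<in> tensor_null S (P n) N"
  note c = mod_hom_closed[OF \<phi>] mod_hom_closed[OF \<psi>] mod_hom_closed[OF k] mod_hom_closed[OF p(3)] mod_hom_closed[OF q(3)]
  note null = frag_map_null[OF _ N _ N _ mod_hom_ident]
  have "?m (d' n) (?m (\<phi> (Suc n)) z) = ?m (\<phi> n) (?m (d n) z)"
    unfolding frag_map_comp by (rule frag_map_cong[OF z]) (simp_all add: \<phi>d)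
  also have "\<dots> \<in> tensor_null S (Q n) N" by (rule null[OF p(2) q(2) \<phi> cyc])
  finally have "?m (d' n) (?m (\<phi> (Suc n)) z) \<in> tensor_null S (Q n) N" .
  moreover have "?m (\<phi> (Suc n)) z \<in> frags (Q (Suc n)) N" by (rule frag_map_frags[OF z]) (auto simp: c)
  ultimately obtain w where w: "w \<in> frags (Q (Suc (Suc n))) N"
      "?m (\<phi> (Suc n)) z - ?m (d' (Suc n)) w \<in> tensor_null S (Q (Suc n)) N"
    using van unfolding tor_vanishes_def by blast
  have "?m (\<psi> (Suc n)) (?m (\<phi> (Suc n)) z - ?m (d' (Suc n)) w) \<in> tensor_null S (P (Suc n)) N"
    by (rule null[OF q(2) p(2) \<psi> w(2)])
  moreover have "?m (\<psi> (Suc n)) (?m (d' (Suc n)) w) = ?m (d (Suc n)) (?m (\<psi> (Suc (Suc n))) w)"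
    unfolding frag_map_comp by (rule frag_map_cong[OF w(1)]) (simp_all add: \<psi>d)
  ultimately have 1: "?m (\<psi> (Suc n)) (?m (\<phi> (Suc n)) z) - ?m (d (Suc n)) (?m (\<psi> (Suc (Suc n))) w) \<in> tensor_null S (P (Suc n)) N"
    by simp
  interpret Pn: left_module "opp_ring S" "P (Suc n)" by (rule p(2))
  let ?f = "\<lambda>x. \<psi> (Suc n) (\<phi> (Suc n) x)" and ?g = "\<lambda>x. d (Suc n) (k (Suc n) x)" and ?h = "\<lambda>x. k n (d n x)"
  have 2: "?m (\<lambda>x. ?f x \<oplus>\<^bsub>P (Suc n)\<^esub> (?g x \<oplus>\<^bsub>P (Suc n)\<^esub> ?h x)) z - ?m ?f z - ?m (\<lambda>x. ?g x \<oplus>\<^bsub>P (Suc n)\<^esub> ?h x) z \<in> tensor_null S (P (Suc n)) N"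
    by (rule frag_map_plus_left[OF p(2) N z]) (auto simp: c)
  have 3: "?m (\<lambda>x. ?g x \<oplus>\<^bsub>P (Suc n)\<^esub> ?h x) z - ?m ?g z - ?m ?h z \<in> tensor_null S (P (Suc n)) N"
    by (rule frag_map_plus_left[OF p(2) N z]) (auto simp: c)
  have 4: "?m ?h z \<in> tensor_null S (P (Suc n)) N"
    using null[OF p(2) p(2) k cyc] by (simp add: frag_map_comp)
  have 5: "?m (\<lambda>x. ?f x \<oplus>\<^bsub>P (Suc n)\<^esub> (?g x \<oplus>\<^bsub>P (Suc n)\<^esub> ?h x)) z = z"
    by (rule frag_map_ident[OF z]) (simp_all add: h[symmetric])
  have "((z - ?m ?f z - ?m (\<lambda>x. ?g x \<oplus>\<^bsub>P (Suc n)\<^esub> ?h x) z)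
      + (?m (\<lambda>x. ?g x \<oplus>\<^bsub>P (Suc n)\<^esub> ?h x) z - ?m ?g z - ?m ?h z)) + ?m ?h z +
      (?m ?f z - ?m (d (Suc n)) (?m (\<psi> (Suc (Suc n))) w)) \<in> tensor_null S (P (Suc n)) N"
    using 1 2 3 4 by (intro tensor_null_add[OF p(2) N]) (simp_all add: 5 frag_map_comp)
  then have "z - ?m (d (Suc n)) (?m (k (Suc n)) z + ?m (\<psi> (Suc (Suc n))) w) \<in> tensor_null S (P (Suc n)) N"
    by (simp add: frag_map_comp algebra_simps)
  moreover have "?m (k (Suc n)) z + ?m (\<psi> (Suc (Suc n))) w \<in> frags (P (Suc (Suc n))) N"
    by (intro frags_add frag_map_frags[OF z] frag_map_frags[OF w(1)]) (auto simp: c)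
  ultimately show "\<exists>w \<in> frags (P (Suc (Suc n))) N. z - ?m (d (Suc n)) w \<in> tensor_null S (P (Suc n)) N" by blast
qed

section \<open>Modules of homomorphisms\<close>

lemma module_of_group_simps [simp]:
  "carrier (module_of_group G act) = carrier G" "\<zero>\<^bsub>module_of_group G act\<^esub> = \<one>\<^bsub>G\<^esub>"
  "x \<oplus>\<^bsub>module_of_group G act\<^esub> y = x \<otimes>\<^bsub>G\<^esub> y" "r \<odot>\<^bsub>module_of_group G act\<^esub> x = act r x"
  by (simp_all add: module_of_group_def)

lemma left_module_module_of_group:
  assumes R: "ring R" and G: "comm_group G"
    and "\<And>a x. a \<in> carrier R \<Longrightarrow> x \<in> carrier G \<Longrightarrow> act a x \<in> carrier G"
    and "\<And>a b x. a \<in> carrier R \<Longrightarrow> b \<in> carrier R \<Longrightarrow> x \<in> carrier G \<Longrightarrow> act (a \<oplus>\<^bsub>R\<^esub> b) x = act a x \<otimes>\<^bsub>G\<^esub> act b x"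
    and "\<And>a x y. a \<in> carrier R \<Longrightarrow> x \<in> carrier G \<Longrightarrow> y \<in> carrier G \<Longrightarrow> act a (x \<otimes>\<^bsub>G\<^esub> y) = act a x \<otimes>\<^bsub>G\<^esub> act a y"
    and "\<And>a b x. a \<in> carrier R \<Longrightarrow> b \<in> carrier R \<Longrightarrow> x \<in> carrier G \<Longrightarrow> act (a \<otimes>\<^bsub>R\<^esub> b) x = act a (act b x)"
    and "\<And>x. x \<in> carrier G \<Longrightarrow> act \<one>\<^bsub>R\<^esub> x = x"
  shows "left_module R (module_of_group G act)"
proof -
  interpret G: comm_group G by fact
  have "abelian_group (module_of_group G act)"
  proof (rule abelian_groupI)
    fix x assume "x \<in> carrier (module_of_group G act)"
    then show "\<exists>y\<in>carrier (module_of_group G act). y \<oplus>\<^bsub>module_of_group G act\<^esub> x = \<zero>\<^bsub>module_of_group G act\<^esub>"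
      by (intro bexI[of _ "inv\<^bsub>G\<^esub> x"]) auto
  qed (auto simp: G.m_assoc intro: G.m_comm)
  then show ?thesis
    unfolding left_module_def left_module_axioms_def using assms by auto
qed

lemma hom_group_simps [simp]:
  "f \<in> carrier (hom_group R A B) \<longleftrightarrow> f \<in> mod_hom R A B \<and> f \<in> extensional (carrier A)"
  "f \<otimes>\<^bsub>hom_group R A B\<^esub> g = (\<lambda>x \<in> carrier A. f x \<oplus>\<^bsub>B\<^esub> g x)"
  "\<one>\<^bsub>hom_group R A B\<^esub> = (\<lambda>x \<in> carrier A. \<zero>\<^bsub>B\<^esub>)"
  by (auto simp: hom_group_def)

lemma mod_hom_restrict:
  assumes "left_module R A" "f \<in> mod_hom R A B"
  shows "restrict f (carrier A) \<in> mod_hom R A B"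
proof -
  interpret A: left_module R A by fact
  show ?thesis by (rule mod_homI) (auto simp: mod_homD[OF assms(2)])
qed

lemma mod_hom_zero_map:
  assumes "left_module R B"
  shows "(\<lambda>x. \<zero>\<^bsub>B\<^esub>) \<in> mod_hom R A B"
proof -
  interpret B: left_module R B by fact
  show ?thesis by (rule mod_homI) (auto simp: B.smult_r_null)
qed

lemma comm_group_hom_group:
  assumes A: "left_module R A" and B: "left_module R B"
  shows "comm_group (hom_group R A B)"
proof -
  interpret A: left_module R A by fact
  interpret B: left_module R B by fact
  note res = mod_hom_restrict[OF A]
  show ?thesis
  proof (rule comm_groupI)
    fix f g assume f: "f \<in> carrier (hom_group R A B)" and g: "g \<in> carrier (hom_group R A B)"
    then show "f \<otimes>\<^bsub>hom_group R A B\<^esub> g \<in> carrier (hom_group R A B)"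
      by (auto intro!: res mod_hom_plus[OF B])
    show "f \<otimes>\<^bsub>hom_group R A B\<^esub> g = g \<otimes>\<^bsub>hom_group R A B\<^esub> f"
      using f g by (auto simp: fun_eq_iff mod_homD B.M.a_comm)
  next
    show "\<one>\<^bsub>hom_group R A B\<^esub> \<in> carrier (hom_group R A B)"
      by (auto intro!: res mod_hom_zero_map[OF B])
  next
    fix f g h assume "f \<in> carrier (hom_group R A B)" "g \<in> carrier (hom_group R A B)" "h \<in> carrier (hom_group R A B)"
    then show "f \<otimes>\<^bsub>hom_group R A B\<^esub> g \<otimes>\<^bsub>hom_group R A B\<^esub> h = f \<otimes>\<^bsub>hom_group R A B\<^esub> (g \<otimes>\<^bsub>hom_group R A B\<^esub> h)"
      by (auto simp: fun_eq_iff mod_homD B.M.a_assoc)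
  next
    fix f assume f: "f \<in> carrier (hom_group R A B)"
    then show "\<one>\<^bsub>hom_group R A B\<^esub> \<otimes>\<^bsub>hom_group R A B\<^esub> f = f"
      by (auto simp: fun_eq_iff mod_homD extensional_def)
    have "(\<lambda>x. \<zero>\<^bsub>B\<^esub> \<ominus>\<^bsub>B\<^esub> f x) \<in> mod_hom R A B"
      using f by (intro mod_hom_minus[OF B] mod_hom_zero_map[OF B]) auto
    with f show "\<exists>g\<in>carrier (hom_group R A B). g \<otimes>\<^bsub>hom_group R A B\<^esub> f = \<one>\<^bsub>hom_group R A B\<^esub>"
      by (intro bexI[of _ "\<lambda>x\<in>carrier A. \<zero>\<^bsub>B\<^esub> \<ominus>\<^bsub>B\<^esub> f x"])
        (auto simp: fun_eq_iff mod_homD B.M.minus_eq B.M.l_neg intro!: res)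
  qed
qed

lemma right_module_simps [simp]:
  "carrier (right_module C) = carrier C" "\<zero>\<^bsub>right_module C\<^esub> = \<zero>\<^bsub>C\<^esub>"
  "x \<oplus>\<^bsub>right_module C\<^esub> y = x \<oplus>\<^bsub>C\<^esub> y" "s \<odot>\<^bsub>right_module C\<^esub> x = rsmult C x s"
  by (simp_all add: right_module_def)

lemma star_simps [simp]:
  "f \<in> carrier (star R C M) \<longleftrightarrow> f \<in> mod_hom R C M \<and> f \<in> extensional (carrier C)"
  "f \<oplus>\<^bsub>star R C M\<^esub> g = (\<lambda>x \<in> carrier C. f x \<oplus>\<^bsub>M\<^esub> g x)"
  "\<zero>\<^bsub>star R C M\<^esub> = (\<lambda>x \<in> carrier C. \<zero>\<^bsub>M\<^esub>)"
  "s \<odot>\<^bsub>star R C M\<^esub> f = (\<lambda>x \<in> carrier C. f (rsmult C x s))"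
  by (simp_all add: star_def)

text \<open>The inner Hom of Hom(Hom(P,C),I): maps of right S-modules, with R acting on their
  values.\<close>

definition dual_module ::
  "'s ring \<Rightarrow> ('r, 's, 'c) bimodule \<Rightarrow> ('s, 'p) module \<Rightarrow> ('r, 'p \<Rightarrow> 'c) module" where
  "dual_module S C P =
     module_of_group (hom_group (opp_ring S) P (right_module C)) (\<lambda>r g. \<lambda>x \<in> carrier P. r \<odot>\<^bsub>C\<^esub> g x)"

lemma dual_module_simps [simp]:
  "f \<in> carrier (dual_module S C P) \<longleftrightarrow> f \<in> mod_hom (opp_ring S) P (right_module C) \<and> f \<in> extensional (carrier P)"
  "f \<oplus>\<^bsub>dual_module S C P\<^esub> g = (\<lambda>x \<in> carrier P. f x \<oplus>\<^bsub>C\<^esub> g x)"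
  "\<zero>\<^bsub>dual_module S C P\<^esub> = (\<lambda>x \<in> carrier P. \<zero>\<^bsub>C\<^esub>)"
  "r \<odot>\<^bsub>dual_module S C P\<^esub> f = (\<lambda>x \<in> carrier P. r \<odot>\<^bsub>C\<^esub> f x)"
  by (simp_all add: dual_module_def)

locale bimodule_pair =
  fixes R :: "'r ring" and S :: "'s ring" and C :: "('r, 's, 'c) bimodule"
  assumes S: "ring S" and bimod: "is_bimodule R S C"
begin

lemma C: "left_module R C" and CS: "left_module (opp_ring S) (right_module C)"
  using bimod by (simp_all add: is_bimodule_def)

sublocale C: left_module R C by (rule C)
sublocale CS: left_module "opp_ring S" "right_module C" by (rule CS)

lemma rsmult_closed [simp]: "x \<in> carrier C \<Longrightarrow> s \<in> carrier S \<Longrightarrow> rsmult C x s \<in> carrier C"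
  using CS.smult_closed[of s x] by simp

lemma rsmult_add: "x \<in> carrier C \<Longrightarrow> y \<in> carrier C \<Longrightarrow> s \<in> carrier S \<Longrightarrow>
    rsmult C (x \<oplus>\<^bsub>C\<^esub> y) s = rsmult C x s \<oplus>\<^bsub>C\<^esub> rsmult C y s"
  using CS.smult_r_distr[of s x y] by simp

lemma rsmult_add_right: "x \<in> carrier C \<Longrightarrow> s \<in> carrier S \<Longrightarrow> t \<in> carrier S \<Longrightarrow>
    rsmult C x (s \<oplus>\<^bsub>S\<^esub> t) = rsmult C x s \<oplus>\<^bsub>C\<^esub> rsmult C x t"
  using CS.smult_l_distr[of s t x] by simp

lemma rsmult_assoc: "x \<in> carrier C \<Longrightarrow> s \<in> carrier S \<Longrightarrow> t \<in> carrier S \<Longrightarrow>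
    rsmult C x (s \<otimes>\<^bsub>S\<^esub> t) = rsmult C (rsmult C x s) t"
  using CS.smult_assoc1[of t s x] by simp

lemma rsmult_one [simp]: "x \<in> carrier C \<Longrightarrow> rsmult C x \<one>\<^bsub>S\<^esub> = x"
  using CS.smult_one[of x] by simp

lemma rsmult_smult: "r \<in> carrier R \<Longrightarrow> x \<in> carrier C \<Longrightarrow> s \<in> carrier S \<Longrightarrow>
    rsmult C (r \<odot>\<^bsub>C\<^esub> x) s = r \<odot>\<^bsub>C\<^esub> rsmult C x s"
  using bimod by (simp add: is_bimodule_def)

lemma left_module_star:
  assumes M: "left_module R M"
  shows "left_module S (star R C M)"
proof -
  interpret M: left_module R M by fact
  show ?thesis
    unfolding star_def
  proof (rule left_module_module_of_group[OF S comm_group_hom_group[OF C M]], goal_cases)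
    case (1 s f)
    have "(\<lambda>x. rsmult C x s) \<in> mod_hom R C C"
      by (rule mod_homI) (use 1 in \<open>auto simp: rsmult_add rsmult_smult\<close>)
    from mod_hom_restrict[OF C mod_hom_comp[OF this, of f M]] show ?case using 1 by simp
  qed (auto simp: fun_eq_iff mod_homD rsmult_add_right rsmult_assoc extensional_def)
qed

lemma star_map_hom:
  assumes M: "left_module R M" "left_module R M'" and g: "g \<in> mod_hom R M M'"
  shows "star_map C g \<in> mod_hom S (star R C M) (star R C M')"
proof (rule mod_homI)
  fix f assume "f \<in> carrier (star R C M)"
  then show "star_map C g f \<in> carrier (star R C M')"
    using mod_hom_restrict[OF C mod_hom_comp[OF _ g], of f] by (simp add: star_map_def)
qed (auto simp: star_map_def fun_eq_iff mod_homD[OF g] mod_homD)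

lemma smult_hom: "r \<in> carrier R \<Longrightarrow> (\<lambda>x. r \<odot>\<^bsub>C\<^esub> x) \<in> mod_hom (opp_ring S) (right_module C) (right_module C)"
  by (rule mod_homI) (auto simp: C.smult_r_distr rsmult_smult)

lemma left_module_dual:
  assumes P: "left_module (opp_ring S) P"
  shows "left_module R (dual_module S C P)"
  unfolding dual_module_def
proof (rule left_module_module_of_group[OF C.ring_axioms comm_group_hom_group[OF P CS]], goal_cases)
  case (1 r f)
  from mod_hom_restrict[OF P mod_hom_comp[OF _ smult_hom[OF 1(1)], of f]] show ?case using 1 by simp
next
  case (2 a b x)
  then have "x p \<in> carrier C" if "p \<in> carrier P" for p using mod_hom_closed[of x] that by force
  with 2 show ?case by (auto simp: fun_eq_iff C.smult_l_distr)
next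
  case (3 a x y)
  then have "x p \<in> carrier C" "y p \<in> carrier C" if "p \<in> carrier P" for p
    using mod_hom_closed[of x] mod_hom_closed[of y] that by force+
  with 3 show ?case by (auto simp: fun_eq_iff C.smult_r_distr)
next
  case (4 a b x)
  then have "x p \<in> carrier C" if "p \<in> carrier P" for p using mod_hom_closed[of x] that by force
  with 4 show ?case by (auto simp: fun_eq_iff C.smult_assoc1)
next
  case (5 x)
  then have "x p \<in> carrier C" if "p \<in> carrier P" for p using mod_hom_closed[of x] that by force
  with 5 show ?case by (auto simp: fun_eq_iff extensional_def)
qed

end

section \<open>Ext and Tor\<close>

lemma ext_vanishes_std:
  assumes A: "left_module R A" and B: "left_module R B" and triv: "trivial_group (Ext R A B (Suc n))"
  shows "ext_vanishes R (std_res R A) (std_diff R A) B n"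
  unfolding ext_vanishes_def
proof (intro ballI impI)
  let ?P = "std_res R A" and ?d = "std_diff R A"
  let ?H = "\<lambda>n. hom_group R (?P n) B"
  let ?I = "ext_diff R A n ` carrier (?H n)"
  note p = projective_resolutionD[OF projective_resolution_std_res[OF A]]
  interpret B: left_module R B by fact
  fix g assume g: "g \<in> mod_hom R (?P (Suc n)) B" and cocyc: "\<forall>x \<in> carrier (?P (Suc (Suc n))). g (?d (Suc n) x) = \<zero>\<^bsub>B\<^esub>"
  \<comment> \<open>\<open>hom_group\<close> consists of extensional functions, so g is represented
    by its restriction.\<close>
  define f where "f = restrict g (carrier (?P (Suc n)))"
  have f: "f \<in> carrier (?H (Suc n))" using mod_hom_restrict[OF p(2) g] by (simp add: f_def)
  have "f \<in> kernel (?H (Suc n)) (?H (Suc (Suc n))) (ext_diff R A (Suc n))"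
    unfolding kernel_def using f cocyc mod_hom_closed[OF p(3)] by (auto simp: ext_diff_def f_def)
  then have "?I #>\<^bsub>?H (Suc n)\<^esub> f \<in> carrier (Ext R A B (Suc n))"
    by (force simp: Ext_def Let_def FactGroup_def RCOSETS_def r_coset_def)
  moreover have "carrier (Ext R A B (Suc n)) = {?I}"
    using triv by (simp add: trivial_group_def Ext_def Let_def FactGroup_def)
  ultimately have coset: "?I #>\<^bsub>?H (Suc n)\<^esub> f = ?I" by simp
  \<comment> \<open>The trivial quotient has a single coset. As the neutral element is a coboundary,
    f lies in its own coset and is therefore a coboundary.\<close>
  have one: "\<one>\<^bsub>?H (Suc n)\<^esub> \<in> ?I"
  proof (rule image_eqI[of _ _ "\<one>\<^bsub>?H n\<^esub>"])
    show "\<one>\<^bsub>?H n\<^esub> \<in> carrier (?H n)" using mod_hom_restrict[OF p(2) mod_hom_zero_map[OF B]] by simp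
  qed (auto simp: ext_diff_def fun_eq_iff mod_hom_closed[OF p(3)])
  interpret H: comm_group "?H (Suc n)" by (rule comm_group_hom_group[OF p(2) B])
  have "\<one>\<^bsub>?H (Suc n)\<^esub> \<otimes>\<^bsub>?H (Suc n)\<^esub> f \<in> ?I #>\<^bsub>?H (Suc n)\<^esub> f"
    unfolding r_coset_def using one by blast
  then have "f \<in> ?I" unfolding H.l_one[OF f] coset .
  then obtain h where h: "h \<in> mod_hom R (?P n) B" "f = ext_diff R A n h" by auto
  show "\<exists>h \<in> mod_hom R (?P n) B. \<forall>x \<in> carrier (?P (Suc n)). g x = h (?d n x)"
  proof (rule bexI[OF _ h(1)], intro ballI)
    fix x assume x: "x \<in> carrier (?P (Suc n))"
    have "f x = ext_diff R A n h x" using h(2) by simp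
    then show "g x = h (?d n x)" using x by (simp add: f_def ext_diff_def)
  qed
qed

definition tensor_class ::
  "'s ring \<Rightarrow> ('s, 'a, 'x) module_scheme \<Rightarrow> ('s, 'n, 'y) module_scheme \<Rightarrow> ('a \<times> 'n \<Rightarrow>\<^sub>0 int) \<Rightarrow> ('a \<times> 'n \<Rightarrow>\<^sub>0 int) set" where
  "tensor_class S A N z = tensor_null S A N #>\<^bsub>free_Abelian_group (carrier A \<times> carrier N)\<^esub> z"

lemma tensor_class_mem: "w \<in> tensor_class S A N z \<longleftrightarrow> w - z \<in> tensor_null S A N"
proof
  assume "w - z \<in> tensor_null S A N"
  then show "w \<in> tensor_class S A N z" by (auto simp: tensor_class_def r_coset_def intro!: bexI[of _ "w - z"])
qed (auto simp: tensor_class_def r_coset_def)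

lemma carrier_tensor: "carrier (tensor S A N) = tensor_class S A N ` frags A N"
  by (auto simp: tensor_def FactGroup_def RCOSETS_def tensor_class_def frags_def)

context
  fixes S :: "'s ring" and A :: "('s, 'a, 'x) module_scheme" and N :: "('s, 'n, 'y) module_scheme"
  assumes A: "left_module (opp_ring S) A" and N: "left_module S N"
begin

lemma tensor_class_eq: "tensor_class S A N z = tensor_class S A N w \<longleftrightarrow> z - w \<in> tensor_null S A N"
proof
  assume "tensor_class S A N z = tensor_class S A N w"
  moreover have "z \<in> tensor_class S A N z" by (simp add: tensor_class_mem tensor_null_0[OF A N])
  ultimately show "z - w \<in> tensor_null S A N" by (simp add: tensor_class_mem)
next
  assume zw: "z - w \<in> tensor_null S A N"
  show "tensor_class S A N z = tensor_class S A N w"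
  proof (rule Set.set_eqI)
    fix y
    show "y \<in> tensor_class S A N z \<longleftrightarrow> y \<in> tensor_class S A N w"
      unfolding tensor_class_mem
      using tensor_null_add[OF A N _ zw, of "y - z"] tensor_null_diff[OF A N _ zw, of "y - w"] by auto
  qed
qed

lemma comm_group_tensor: "comm_group (tensor S A N)"
  unfolding tensor_def
  by (rule comm_group.abelian_FactGroup[OF abelian_free_Abelian_group subgroup_tensor_null[OF A N]])

lemma tensor_class_mult:
  assumes "z \<in> frags A N" "w \<in> frags A N"
  shows "tensor_class S A N z \<otimes>\<^bsub>tensor S A N\<^esub> tensor_class S A N w = tensor_class S A N (z + w)"
proof -
  have "normal (tensor_null S A N) (free_Abelian_group (carrier A \<times> carrier N))"
    by (rule comm_group.subgroup_imp_normal[OF abelian_free_Abelian_group subgroup_tensor_null[OF A N]])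
  from normal.rcos_sum[OF this, of z w] assms show ?thesis
    by (simp add: tensor_def FactGroup_def tensor_class_def frags_def)
qed

lemma tensor_class_one: "\<one>\<^bsub>tensor S A N\<^esub> = tensor_class S A N 0"
  by (auto simp: tensor_def FactGroup_def tensor_class_mem)

lemma tensor_class_eq_one: "tensor_class S A N z = \<one>\<^bsub>tensor S A N\<^esub> \<longleftrightarrow> z \<in> tensor_null S A N"
  unfolding tensor_class_one tensor_class_eq by simp

end

text \<open>\<open>tensor_map\<close> is a union over representatives; the cosets of their images
  all coincide, so the union collapses to one of them.\<close>

lemma tensor_map_class:
  assumes A: "left_module (opp_ring S) A" and N: "left_module S N"
    and A': "left_module (opp_ring S) A'" and f: "f \<in> mod_hom (opp_ring S) A A'"
  shows "tensor_map S A' N f (tensor_class S A N z) = tensor_class S A' N (frag_map f (\<lambda>x. x) z)"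
proof -
  have *: "tensor_class S A' N (frag_map f (\<lambda>x. x) y) = tensor_class S A' N (frag_map f (\<lambda>x. x) z)"
    if "y \<in> tensor_class S A N z" for y
    using frag_map_null[OF A N A' N f mod_hom_ident, of "y - z"] that
    by (subst tensor_class_eq[OF A' N]) (simp add: tensor_class_mem)
  have "z \<in> tensor_class S A N z" by (simp add: tensor_class_mem tensor_null_0[OF A N])
  have "tensor_map S A' N f (tensor_class S A N z) =
      (\<Union>y\<in>tensor_class S A N z. tensor_class S A' N (frag_map f (\<lambda>x. x) y))"
    by (simp add: tensor_map_def tensor_class_def frag_map_def)
  also have "\<dots> = tensor_class S A' N (frag_map f (\<lambda>x. x) z)"
    using * \<open>z \<in> tensor_class S A N z\<close> by blast
  finally show ?thesis .
qed

text \<open>K enters as a mere set between H and the carrier: once K is contained in H the quotient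
  has the single element H, and the group axioms are checked on it directly.\<close>

lemma trivial_quotient_iff:
  assumes G: "group G" and H: "subgroup H G" "H \<subseteq> K" "K \<subseteq> carrier G"
  shows "trivial_group (G\<lparr>carrier := K\<rparr> Mod H) \<longleftrightarrow> K \<subseteq> H"
proof -
  interpret G: group G by fact
  have car: "carrier (G\<lparr>carrier := K\<rparr> Mod H) = (\<lambda>x. H #>\<^bsub>G\<^esub> x) ` K"
    by (auto simp: FactGroup_def RCOSETS_def r_coset_def)
  have one: "\<one>\<^bsub>G\<lparr>carrier := K\<rparr> Mod H\<^esub> = H" by (simp add: FactGroup_def)
  have eq: "H #>\<^bsub>G\<^esub> x = H \<longleftrightarrow> x \<in> H" if "x \<in> K" for x
    using that H by (meson G.coset_join1 G.coset_join2 subsetD subgroup.subset)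
  show ?thesis
  proof
    assume "trivial_group (G\<lparr>carrier := K\<rparr> Mod H)"
    then show "K \<subseteq> H" using eq by (auto simp: trivial_group_def car one)
  next
    assume "K \<subseteq> H"
    then have c: "carrier (G\<lparr>carrier := K\<rparr> Mod H) = {H}"
      using eq H subgroup.one_closed[OF H(1)] unfolding car by auto
    have "group (G\<lparr>carrier := K\<rparr> Mod H)"
      by (rule groupI) (auto simp: c one G.subgroup_mult_id[OF H(1)])
    with c one show "trivial_group (G\<lparr>carrier := K\<rparr> Mod H)" by (simp add: trivial_group_def)
  qed
qed

text \<open>The passage from cosets of cosets to formal sums; the homological arguments can then be
  carried out with \<open>tor_vanishes\<close> alone.\<close>

lemma trivial_Tor_iff:
  assumes A: "left_module (opp_ring S) A" and N: "left_module S N"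
  shows "trivial_group (Tor S A N (Suc n)) \<longleftrightarrow>
    tor_vanishes S (std_res (opp_ring S) A) (std_diff (opp_ring S) A) N n"
proof -
  let ?P = "std_res (opp_ring S) A" and ?d = "std_diff (opp_ring S) A"
  let ?\<delta> = "\<lambda>n. tensor_map S (?P n) N (?d n)"
  let ?K = "kernel (tensor S (?P (Suc n)) N) (tensor S (?P n) N) (?\<delta> n)"
  let ?H = "?\<delta> (Suc n) ` carrier (tensor S (?P (Suc (Suc n))) N)"
  let ?c = "\<lambda>n. tensor_class S (?P n) N"
  note p = projective_resolutionD[OF projective_resolution_std_res[OF A]]
  note pz = projective_resolution_comp_zero[OF projective_resolution_std_res[OF A]]
  note tm = tensor_map_class[OF p(2) N p(2) p(3)]
  have fr: "frag_map (?d m) (\<lambda>x. x) z \<in> frags (?P m) N" if "z \<in> frags (?P (Suc m)) N" for z m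
    by (rule frag_map_frags[OF that]) (auto simp: mod_hom_closed[OF p(3)])
  have hom: "group_hom (tensor S (?P (Suc m)) N) (tensor S (?P m) N) (?\<delta> m)" for m
  proof (rule group_hom.intro)
    show "group (tensor S (?P (Suc m)) N)" "group (tensor S (?P m) N)"
      using comm_group_tensor[OF p(2) N] by (simp_all add: comm_group_def)
    show "group_hom_axioms (tensor S (?P (Suc m)) N) (tensor S (?P m) N) (?\<delta> m)"
      by (auto simp: group_hom_axioms_def hom_def carrier_tensor tm tensor_class_mult[OF p(2) N] fr frags_add)
  qed
  have HK: "?H \<subseteq> ?K"
  proof
    fix X assume "X \<in> ?H"
    then obtain z where z: "z \<in> frags (?P (Suc (Suc n))) N" "X = ?c (Suc n) (frag_map (?d (Suc n)) (\<lambda>x. x) z)"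
      by (auto simp: carrier_tensor tm)
    have "frag_map (?d n) (\<lambda>x. x) (frag_map (?d (Suc n)) (\<lambda>x. x) z) \<in> tensor_null S (?P n) N"
      unfolding frag_map_comp
      by (rule frag_map_null_if_zero[OF p(2) N z(1)]) (auto simp: pz left_module_zero_closed[OF p(2)])
    then show "X \<in> ?K" using z fr by (auto simp: kernel_def carrier_tensor tm tensor_class_eq_one[OF p(2) N])
  qed
  have "trivial_group (Tor S A N (Suc n)) \<longleftrightarrow> ?K \<subseteq> ?H"
    unfolding Tor_def Let_def nat.case
    by (rule trivial_quotient_iff)
      (use HK group_hom.img_is_subgroup[OF hom] comm_group_tensor[OF p(2) N] in \<open>auto simp: comm_group_def kernel_def\<close>)
  also have "\<dots> \<longleftrightarrow> tor_vanishes S ?P ?d N n"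
  proof
    assume sub: "?K \<subseteq> ?H"
    show "tor_vanishes S ?P ?d N n"
      unfolding tor_vanishes_def
    proof (intro ballI impI)
      fix z assume z: "z \<in> frags (?P (Suc n)) N" "frag_map (?d n) (\<lambda>x. x) z \<in> tensor_null S (?P n) N"
      then have "?c (Suc n) z \<in> ?K" by (auto simp: kernel_def carrier_tensor tm tensor_class_eq_one[OF p(2) N])
      with sub have "?c (Suc n) z \<in> ?H" by blast
      then show "\<exists>w\<in>frags (?P (Suc (Suc n))) N. z - frag_map (?d (Suc n)) (\<lambda>x. x) w \<in> tensor_null S (?P (Suc n)) N"
        by (auto simp: carrier_tensor tm tensor_class_eq[OF p(2) N])
    qed
  next
    assume van: "tor_vanishes S ?P ?d N n"
    show "?K \<subseteq> ?H"
    proof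
      fix X assume "X \<in> ?K"
      then obtain z where z: "X = ?c (Suc n) z" "z \<in> frags (?P (Suc n)) N"
          "frag_map (?d n) (\<lambda>x. x) z \<in> tensor_null S (?P n) N"
        by (auto simp: kernel_def carrier_tensor tm tensor_class_eq_one[OF p(2) N])
      then obtain w where w: "w \<in> frags (?P (Suc (Suc n))) N"
          "z - frag_map (?d (Suc n)) (\<lambda>x. x) w \<in> tensor_null S (?P (Suc n)) N"
        using van unfolding tor_vanishes_def by blast
      have "X = ?\<delta> (Suc n) (?c (Suc (Suc n)) w)"
        unfolding z(1) tm tensor_class_eq[OF p(2) N] by (rule w(2))
      then show "X \<in> ?H" using w(1) by (simp add: carrier_tensor)
    qed
  qed
  finally show ?thesis .
qed

section \<open>Extension into injective modules and the evaluation pairing\<close>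

lemma (in abelian_group) minus_eq_iff:
  assumes "x \<in> carrier G" "y \<in> carrier G" "z \<in> carrier G"
  shows "x \<ominus> y = z \<longleftrightarrow> x = z \<oplus> y"
  using assms by (metis a_assoc a_inv_closed l_neg minus_eq r_neg r_zero)

lemma (in abelian_group) minus_eq_zero_iff:
  assumes "x \<in> carrier G" "y \<in> carrier G"
  shows "x \<ominus> y = \<zero> \<longleftrightarrow> x = y"
  using assms by (simp add: minus_eq_iff)

lemma mod_hom_right_module_closed:
  "g \<in> mod_hom T P (right_module C) \<Longrightarrow> x \<in> carrier P \<Longrightarrow> g x \<in> carrier C"
  using mod_hom_closed[of g T P "right_module C"] by simp

lemma additive_finsum:
  assumes "abelian_group G" "abelian_group H" "g \<in> carrier G \<rightarrow> carrier H"
    and add: "\<And>x y. x \<in> carrier G \<Longrightarrow> y \<in> carrier G \<Longrightarrow> g (x \<oplus>\<^bsub>G\<^esub> y) = g x \<oplus>\<^bsub>H\<^esub> g y"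
    and F: "finite F" "h \<in> F \<rightarrow> carrier G"
  shows "g (\<Oplus>\<^bsub>G\<^esub>x\<in>F. h x) = (\<Oplus>\<^bsub>H\<^esub>x\<in>F. g (h x))"
proof -
  interpret G: abelian_group G by fact
  interpret H: abelian_group H by fact
  show ?thesis using F
  proof (induction F)
    case empty then show ?case using additive_map_zero[OF assms(1-4)] by simp
  next
    case (insert x F)
    then have "(\<lambda>x. g (h x)) \<in> F \<rightarrow> carrier H" "g (h x) \<in> carrier H" using assms(3) by auto
    then show ?case using insert by (simp add: add Pi_iff)
  qed
qed

text \<open>As h kills the kernel of f, it descends to the image of f, and from this submodule
  injectivity extends it to B.\<close>

lemma injective_extend:
  fixes A :: "('r, 'a) module" and B :: "('r, 'b) module"
  assumes I: "injective_module R I" and A: "left_module R A" and B: "left_module R B"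
    and f: "f \<in> mod_hom R A B" and h: "h \<in> mod_hom R A I"
    and ker: "\<And>x. x \<in> carrier A \<Longrightarrow> f x = \<zero>\<^bsub>B\<^esub> \<Longrightarrow> h x = \<zero>\<^bsub>I\<^esub>"
  shows "\<exists>k \<in> mod_hom R B I. \<forall>x \<in> carrier A. k (f x) = h x"
proof -
  have Im: "left_module R I" using I by (simp add: injective_module_def)
  interpret A: left_module R A by fact
  interpret B: left_module R B by fact
  interpret I: left_module R I by (rule Im)
  let ?T = "B\<lparr>carrier := f ` carrier A\<rparr>"
  define h' where "h' t = h (inv_into (carrier A) f t)" for t
  have h': "h' (f x) = h x" if x: "x \<in> carrier A" for x
  proof -
    define y where "y = inv_into (carrier A) f (f x)"
    have y: "y \<in> carrier A" "f y = f x"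
      using x by (auto simp: y_def f_inv_into_f intro: inv_into_into)
    have "f (y \<ominus>\<^bsub>A\<^esub> x) = \<zero>\<^bsub>B\<^esub>"
      using x y mod_hom_closed[OF f] by (simp add: mod_hom_diff[OF A B f] B.M.minus_eq B.M.r_neg)
    then have "h (y \<ominus>\<^bsub>A\<^esub> x) = \<zero>\<^bsub>I\<^esub>" using x y by (intro ker) auto
    then have "h y \<ominus>\<^bsub>I\<^esub> h x = \<zero>\<^bsub>I\<^esub>" using x y by (simp add: mod_hom_diff[OF A Im h])
    then have "h y = h x" using x y mod_hom_closed[OF h] by (simp add: I.M.minus_eq_zero_iff)
    then show ?thesis by (simp add: h'_def y_def)
  qed
  have "h' \<in> mod_hom R ?T I"
  proof (rule mod_homI)
    fix x y assume "x \<in> carrier ?T" "y \<in> carrier ?T"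
    then obtain a b where "a \<in> carrier A" "b \<in> carrier A" "x = f a" "y = f b" by auto
    then show "h' (x \<oplus>\<^bsub>?T\<^esub> y) = h' x \<oplus>\<^bsub>I\<^esub> h' y"
      using h'[of "a \<oplus>\<^bsub>A\<^esub> b"] by (simp add: h' mod_hom_add[OF f] mod_hom_add[OF h])
  next
    fix r x assume "r \<in> carrier R" "x \<in> carrier ?T"
    then obtain a where "r \<in> carrier R" "a \<in> carrier A" "x = f a" by auto
    then show "h' (r \<odot>\<^bsub>?T\<^esub> x) = r \<odot>\<^bsub>I\<^esub> h' x"
      using h'[of "r \<odot>\<^bsub>A\<^esub> a"] by (simp add: h' mod_hom_smult[OF f] mod_hom_smult[OF h])
  qed (auto simp: h' mod_hom_closed[OF h])
  moreover have "(\<lambda>x. x) \<in> mod_hom R ?T B"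
    by (rule mod_homI) (auto simp: mod_hom_closed[OF f])
  ultimately obtain k where "k \<in> mod_hom R B I" "\<forall>x \<in> carrier ?T. k x = h' x"
    using injective_moduleD[OF I left_module_image[OF B A B f] B] by (metis inj_on_id2)
  then show ?thesis using h' by (intro bexI[of _ k]) auto
qed

lemma frag_map_right_module: "g \<in> mod_hom (T) P (right_module C) \<Longrightarrow> z \<in> frags P N \<Longrightarrow>
    frag_map g (\<lambda>x. x) z \<in> frags (right_module C) N"
  by (rule frag_map_frags) (auto simp: mod_hom_right_module_closed)

text \<open>The map \<open>theta\<close> on a single representative; the underlying sum has the same
  shape as in \<open>theta\<close>, so the two unfold to each other.\<close>

definition ev :: "('r, 'm) module \<Rightarrow> ('c \<times> ('c \<Rightarrow> 'm) \<Rightarrow>\<^sub>0 int) \<Rightarrow> 'm" where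
  "ev M = frag_eval M (\<lambda>p. snd p (fst p))"

context bimodule_pair begin

context
  fixes M :: "('r, 'm) module"
  assumes M: "left_module R M"
begin

interpretation M: left_module R M by (rule M)

lemma star_closed: "f \<in> carrier (star R C M) \<Longrightarrow> x \<in> carrier C \<Longrightarrow> f x \<in> carrier M"
  using mod_hom_closed[of f] by auto

lemma ev_fun: "(\<lambda>p. snd p (fst p)) \<in> carrier (right_module C) \<times> carrier (star R C M) \<rightarrow> carrier M"
  by (auto simp: mod_homD)

lemmas ev_closed = frag_eval_frags_closed[OF M.M.abelian_group_axioms ev_fun, folded ev_def]
lemmas ev_diff = frag_eval_frags_diff[OF M.M.abelian_group_axioms ev_fun, folded ev_def]
lemmas ev_add = frag_eval_frags_add[OF M.M.abelian_group_axioms ev_fun, folded ev_def]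

lemma ev_of: "x \<in> carrier C \<Longrightarrow> f \<in> carrier (star R C M) \<Longrightarrow> ev M (frag_of (x, f)) = f x"
  unfolding ev_def by (subst M.M.frag_eval_of) (auto simp: mod_homD)

lemma ev_0: "ev M 0 = \<zero>\<^bsub>M\<^esub>" by (simp add: ev_def M.M.frag_eval_0)

lemma ev_null: "z \<in> tensor_null S (right_module C) (star R C M) \<Longrightarrow> ev M z = \<zero>\<^bsub>M\<^esub>"
  unfolding ev_def
  by (rule frag_eval_null[OF M.M.abelian_group_axioms CS left_module_star[OF M] _ ev_fun])
    (auto simp: mod_homD)

lemma ev_smult:
  assumes r: "r \<in> carrier R" and z: "z \<in> frags (right_module C) (star R C M)"
  shows "ev M (frag_map (\<lambda>x. r \<odot>\<^bsub>C\<^esub> x) (\<lambda>x. x) z) = r \<odot>\<^bsub>M\<^esub> ev M z"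
proof -
  have "ev M (frag_map (\<lambda>x. r \<odot>\<^bsub>C\<^esub> x) (\<lambda>x. x) z) = frag_eval M (\<lambda>p. snd p (r \<odot>\<^bsub>C\<^esub> fst p)) z"
    unfolding ev_def by (subst frag_eval_map[OF M.M.abelian_group_axioms z _ _ ev_fun]) (use r in auto)
  also have "\<dots> = frag_eval M (\<lambda>p. r \<odot>\<^bsub>M\<^esub> snd p (fst p)) z"
    by (rule frag_eval_cong[OF M.M.abelian_group_axioms z]) (use r in \<open>auto simp: mod_homD\<close>)
  also have "\<dots> = r \<odot>\<^bsub>M\<^esub> ev M z"
    unfolding ev_def
    by (rule additive_frag_eval[symmetric, OF M.M.abelian_group_axioms M.M.abelian_group_axioms _ _ z ev_fun])
      (use r in \<open>auto simp: M.smult_r_distr\<close>)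
  finally show ?thesis .
qed

lemma ev_sum:
  assumes "finite F" "\<And>x. x \<in> F \<Longrightarrow> h x \<in> frags (right_module C) (star R C M)"
  shows "ev M (\<Sum>x\<in>F. h x) = (\<Oplus>\<^bsub>M\<^esub>x\<in>F. ev M (h x))"
  using assms
proof (induction F)
  case (insert x F)
  then have "(\<lambda>x. ev M (h x)) \<in> F \<rightarrow> carrier M" "ev M (h x) \<in> carrier M" by (auto intro: ev_closed)
  then show ?case using insert by (simp add: ev_add frags_sum)
qed (simp add: ev_0)

context
  fixes P :: "('s, 'p) module" and X s
  assumes db: "dual_basis (opp_ring S) P X s"
begin

private lemma mod_P: "left_module (opp_ring S) P" and sub_X: "X \<subseteq> carrier P"
  and hom_s: "s \<in> mod_hom (opp_ring S) P (free_module (opp_ring S) X)"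
  by (fact dual_basisD(1-3)[OF db])+

private lemma coeff [simp]: "p \<in> carrier P \<Longrightarrow> s p x \<in> carrier S"
  using dual_basis_coeff_closed[OF db] by simp

text \<open>With x' the functional dual to x, these are the maps p -> c x'(p). They suffice to
  detect null sums, and for finite X every map P -> C is a sum of them.\<close>

lemma dual_basis_hom:
  assumes c: "c \<in> carrier C"
  shows "(\<lambda>p. rsmult C c (s p x)) \<in> mod_hom (opp_ring S) P (right_module C)"
  by (rule mod_homI)
    (use c in \<open>auto simp: mod_hom_add[OF hom_s] mod_hom_smult[OF hom_s] free_module_simps rsmult_add_right rsmult_assoc\<close>)

text \<open>
  The next two lemmas are injectivity and surjectivity of
  \<open>P \<otimes> Hom(C, M) \<rightarrow> Hom(Hom(P, C), M)\<close>, \<open>p \<otimes> f \<mapsto> (g \<mapsto> f (g p))\<close>.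
\<close>

lemma tensor_null_if_ev:
  assumes z: "z \<in> frags P (star R C M)"
    and ev: "\<And>g. g \<in> mod_hom (opp_ring S) P (right_module C) \<Longrightarrow> ev M (frag_map g (\<lambda>x. x) z) = \<zero>\<^bsub>M\<^esub>"
  shows "z \<in> tensor_null S P (star R C M)"
proof (rule tensor_null_if_coord[OF db left_module_star[OF M] z])
  fix x
  interpret N: left_module S "star R C M" by (rule left_module_star[OF M])
  note cf = coord_fun[OF db left_module_star[OF M]]
  let ?k = "coord (star R C M) s x z"
  have k: "?k \<in> carrier (star R C M)" by (rule coord_closed[OF db left_module_star[OF M] z])
  \<comment> \<open>The value of the coordinate at c is obtained by pushing z to C along p -> c
    x'(p), where x' is dual to x, and evaluating there.\<close>
  have "?k c = \<zero>\<^bsub>M\<^esub>" if c: "c \<in> carrier C" for c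
  proof -
    have "?k c = frag_eval M (\<lambda>p. (s (fst p) x \<odot>\<^bsub>star R C M\<^esub> snd p) c) z"
      unfolding coord_def
      by (rule additive_frag_eval[of "star R C M" M "\<lambda>f. f c", OF N.M.abelian_group_axioms M.M.abelian_group_axioms _ _ z cf])
        (use c in \<open>auto simp: mod_homD\<close>)
    also have "\<dots> = frag_eval M (\<lambda>p. snd p (rsmult C c (s (fst p) x))) z"
      by (rule frag_eval_cong[OF M.M.abelian_group_axioms z]) (use c in \<open>auto simp: mod_homD\<close>)
    also have "\<dots> = ev M (frag_map (\<lambda>p. rsmult C c (s p x)) (\<lambda>x. x) z)"
      unfolding ev_def by (subst frag_eval_map[OF M.M.abelian_group_axioms z _ _ ev_fun]) (use c in auto)
    also have "\<dots> = \<zero>\<^bsub>M\<^esub>" by (rule ev[OF dual_basis_hom[OF c]])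
    finally show ?thesis .
  qed
  then show "?k = \<zero>\<^bsub>star R C M\<^esub>" using k by (auto simp: fun_eq_iff extensional_def)
qed

lemma ev_realize:
  assumes fin: "finite X" and H: "H \<in> mod_hom R (dual_module S C P) M"
  shows "\<exists>z \<in> frags P (star R C M). \<forall>g \<in> mod_hom (opp_ring S) P (right_module C).
    ev M (frag_map g (\<lambda>x. x) z) = H (restrict g (carrier P))"
proof -
  let ?D = "dual_module S C P"
  have D: "left_module R ?D" by (rule left_module_dual[OF mod_P])
  interpret D: left_module R ?D by (rule D)
  interpret P: left_module "opp_ring S" P by (rule mod_P)
  define \<gamma> where "\<gamma> x c = (\<lambda>p\<in>carrier P. rsmult C c (s p x))" for x c
  have \<gamma>: "\<gamma> x c \<in> carrier ?D" if "c \<in> carrier C" for x c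
    using mod_hom_restrict[OF mod_P dual_basis_hom[OF that]] by (simp add: \<gamma>_def)
  \<comment> \<open>For fixed x the values of H on the maps \<open>\<gamma> x c\<close> form an
    element of Hom(C,M), the x-th coordinate of the wanted tensor.\<close>
  define F where "F x = (\<lambda>c\<in>carrier C. H (\<gamma> x c))" for x
  have "\<gamma> x \<in> mod_hom R C ?D" for x
    by (rule mod_homI) (use \<gamma> in \<open>auto simp: \<gamma>_def fun_eq_iff rsmult_add rsmult_smult\<close>)
  from mod_hom_restrict[OF C mod_hom_comp[OF this H]] have F: "F x \<in> carrier (star R C M)" for x
    by (simp add: F_def)
  show ?thesis
  proof (rule bexI[of _ "\<Sum>x\<in>X. frag_of (x, F x)"], intro ballI)
    show "(\<Sum>x\<in>X. frag_of (x, F x)) \<in> frags P (star R C M)" using F sub_X by (intro frags_sum) auto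
    fix g assume g: "g \<in> mod_hom (opp_ring S) P (right_module C)"
    have gX: "g x \<in> carrier C" if "x \<in> X" for x using mod_hom_closed[OF g, of x] that sub_X by auto
    have "ev M (frag_map g (\<lambda>x. x) (\<Sum>x\<in>X. frag_of (x, F x))) = (\<Oplus>\<^bsub>M\<^esub>x\<in>X. ev M (frag_of (g x, F x)))"
      unfolding frag_map_sum frag_map_simps by (rule ev_sum[OF fin]) (use gX F in auto)
    also have "\<dots> = (\<Oplus>\<^bsub>M\<^esub>x\<in>X. H (\<gamma> x (g x)))"
      by (rule M.M.finsum_cong') (use gX F in \<open>auto simp: ev_of F_def mod_hom_closed[OF H \<gamma>]\<close>)
    also have "\<dots> = H (\<Oplus>\<^bsub>?D\<^esub>x\<in>X. \<gamma> x (g x))"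
      by (rule mod_hom_finsum[OF D M H fin, symmetric]) (use gX \<gamma> in auto)
    \<comment> \<open>Dual basis expansion: applying g to p, written as the sum of x'(p) x, shows
      that g is the sum of the maps g(x) x', which are \<open>\<gamma> x (g x)\<close>.\<close>
    also have "(\<Oplus>\<^bsub>?D\<^esub>x\<in>X. \<gamma> x (g x)) = restrict g (carrier P)"
    proof
      fix p
      have "(\<Oplus>\<^bsub>?D\<^esub>x\<in>X. \<gamma> x (g x)) \<in> carrier ?D" by (rule D.M.finsum_closed) (use gX \<gamma> in auto)
      then have ext: "(\<Oplus>\<^bsub>?D\<^esub>x\<in>X. \<gamma> x (g x)) \<in> extensional (carrier P)" by simp
      show "(\<Oplus>\<^bsub>?D\<^esub>x\<in>X. \<gamma> x (g x)) p = restrict g (carrier P) p"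
      proof (cases "p \<in> carrier P")
        case p: True
        have "(\<Oplus>\<^bsub>?D\<^esub>x\<in>X. \<gamma> x (g x)) p = (\<Oplus>\<^bsub>C\<^esub>x\<in>X. \<gamma> x (g x) p)"
          by (rule additive_finsum[of ?D C "\<lambda>f. f p", OF D.M.abelian_group_axioms C.M.abelian_group_axioms])
            (use p fin \<gamma> gX in \<open>auto simp: mod_hom_right_module_closed\<close>)
        also have "\<dots> = (\<Oplus>\<^bsub>C\<^esub>x\<in>X. g (s p x \<odot>\<^bsub>P\<^esub> x))"
          by (rule C.M.finsum_cong') (use p sub_X gX mod_homD[OF g] P.smult_closed in \<open>auto simp: \<gamma>_def\<close>)
        also have "\<dots> = g (\<Oplus>\<^bsub>P\<^esub>x\<in>X. s p x \<odot>\<^bsub>P\<^esub> x)"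
          by (rule additive_finsum[symmetric, of P C g, OF P.M.abelian_group_axioms C.M.abelian_group_axioms])
            (use p sub_X fin mod_homD[OF g] P.smult_closed in auto)
        also have "(\<Oplus>\<^bsub>P\<^esub>x\<in>X. s p x \<odot>\<^bsub>P\<^esub> x) = free_lift (opp_ring S) P (\<lambda>x. x) (s p)"
          by (rule free_lift_alt[symmetric, OF mod_P mod_hom_closed[OF hom_s p]])
            (use sub_X fin mod_hom_closed[OF hom_s p] in \<open>auto simp: free_module_simps\<close>)
        also have "\<dots> = p" using db p by (simp add: dual_basis_def)
        finally show ?thesis using p by simp
      qed (use ext in \<open>auto simp: extensional_def\<close>)
    qed
    finally show "ev M (frag_map g (\<lambda>x. x) (\<Sum>x\<in>X. frag_of (x, F x))) = H (restrict g (carrier P))" .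
  qed
qed

end

text \<open>The functional on Hom(P,C) attached to z, later extended by injectivity. Additivity in g
  comes from \<open>ev\<close>, which kills the relations between the formal sums.\<close>

lemma ev_pairing_hom:
  assumes P: "left_module (opp_ring S) P" and z: "z \<in> frags P (star R C M)"
  shows "(\<lambda>g. ev M (frag_map g (\<lambda>x. x) z)) \<in> mod_hom R (dual_module S C P) M"
proof (rule mod_homI)
  note N = left_module_star[OF M]
  have fr: "frag_map g (\<lambda>x. x) z \<in> frags (right_module C) (star R C M)" if "g \<in> carrier (dual_module S C P)" for g
    by (rule frag_map_frags[OF z]) (use that in \<open>auto simp: mod_hom_right_module_closed\<close>)
  show cl: "ev M (frag_map g (\<lambda>x. x) z) \<in> carrier M" if "g \<in> carrier (dual_module S C P)" for g
    by (rule ev_closed[OF fr[OF that]])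
  have gc: "g x \<in> carrier C" if "g \<in> carrier (dual_module S C P)" "x \<in> carrier P" for g x
    using that mod_hom_closed[of g] by force
  fix g assume g: "g \<in> carrier (dual_module S C P)"
  {
    fix h assume h: "h \<in> carrier (dual_module S C P)"
    have gh: "g \<oplus>\<^bsub>dual_module S C P\<^esub> h \<in> carrier (dual_module S C P)"
      by (rule abelian_monoid.a_closed[OF _ g h])
        (use left_module_dual[OF P] in \<open>simp add: left_module_def abelian_group_def\<close>)
    have eq: "frag_map (g \<oplus>\<^bsub>dual_module S C P\<^esub> h) (\<lambda>x. x) z = frag_map (\<lambda>x. g x \<oplus>\<^bsub>right_module C\<^esub> h x) (\<lambda>x. x) z"
      by (rule frag_map_cong[OF z]) auto
    have "ev M (frag_map (g \<oplus>\<^bsub>dual_module S C P\<^esub> h) (\<lambda>x. x) z - frag_map g (\<lambda>x. x) z - frag_map h (\<lambda>x. x) z) = \<zero>\<^bsub>M\<^esub>"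
      unfolding eq by (rule ev_null[OF frag_map_plus_left[OF CS N z]]) (use gc g h in auto)
    then have "ev M (frag_map (g \<oplus>\<^bsub>dual_module S C P\<^esub> h) (\<lambda>x. x) z) \<ominus>\<^bsub>M\<^esub> ev M (frag_map g (\<lambda>x. x) z)
        \<ominus>\<^bsub>M\<^esub> ev M (frag_map h (\<lambda>x. x) z) = \<zero>\<^bsub>M\<^esub>"
      by (simp only: ev_diff fr[OF g] fr[OF h] fr[OF gh] frags_diff)
    then show "ev M (frag_map (g \<oplus>\<^bsub>dual_module S C P\<^esub> h) (\<lambda>x. x) z) =
        ev M (frag_map g (\<lambda>x. x) z) \<oplus>\<^bsub>M\<^esub> ev M (frag_map h (\<lambda>x. x) z)"
      using cl[OF g] cl[OF h] cl[OF gh]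
      by (simp only: M.M.minus_eq_zero_iff M.M.minus_eq_iff M.M.minus_closed M.M.a_comm)
  next
    fix r assume r: "r \<in> carrier R"
    have "frag_map (r \<odot>\<^bsub>dual_module S C P\<^esub> g) (\<lambda>x. x) z = frag_map (\<lambda>x. r \<odot>\<^bsub>C\<^esub> x) (\<lambda>x. x) (frag_map g (\<lambda>x. x) z)"
      unfolding frag_map_comp by (rule frag_map_cong[OF z]) auto
    then show "ev M (frag_map (r \<odot>\<^bsub>dual_module S C P\<^esub> g) (\<lambda>x. x) z) = r \<odot>\<^bsub>M\<^esub> ev M (frag_map g (\<lambda>x. x) z)"
      by (simp add: ev_smult[OF r fr[OF g]])
  }
qed

end

text \<open>Naturality of \<open>theta\<close> in the module, stated on representatives.\<close>

lemma ev_star_map: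
  assumes M: "left_module R M" and M': "left_module R M'" and g: "g \<in> mod_hom R M M'"
    and z: "z \<in> frags (right_module C) (star R C M)"
  shows "ev M' (frag_map (\<lambda>x. x) (star_map C g) z) = g (ev M z)"
proof -
  note ab = left_module_abelian_group[OF M] left_module_abelian_group[OF M']
  have "ev M' (frag_map (\<lambda>x. x) (star_map C g) z) = frag_eval M' (\<lambda>p. star_map C g (snd p) (fst p)) z"
    unfolding ev_def
    by (subst frag_eval_map[OF ab(2) z _ _ ev_fun[OF M']])
      (use mod_hom_closed[OF star_map_hom[OF M M' g]] in auto)
  also have "\<dots> = frag_eval M' (\<lambda>p. g (snd p (fst p))) z"
    by (rule frag_eval_cong[OF ab(2) z]) (auto simp: star_map_def mod_homD[OF g] mod_homD)
  also have "\<dots> = g (ev M z)"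
    unfolding ev_def
    by (rule additive_frag_eval[symmetric, OF ab _ _ z ev_fun[OF M]]) (auto simp: mod_homD[OF g])
  finally show ?thesis .
qed

text \<open>By \<open>cyc\<close>, the functional of z on Hom(A,C) vanishes on the kernel of
  composition with d. Injectivity of I extends it along Hom(A,C) -> Hom(B,C) to a functional k, and
  the finite dual basis of B realizes k by a tensor w. Then z and d w pair equally with all maps A
  -> C, hence agree modulo null sums.\<close>

lemma tensor_exact_star_injective:
  assumes I: "injective_module R I"
    and A: "dual_basis (opp_ring S) A Y t" and B: "dual_basis (opp_ring S) B X s" "finite X"
    and d: "d \<in> mod_hom (opp_ring S) B A"
    and z: "z \<in> frags A (star R C I)"
    and cyc: "\<And>g. g \<in> mod_hom (opp_ring S) A (right_module C) \<Longrightarrow> (\<And>x. x \<in> carrier B \<Longrightarrow> g (d x) = \<zero>\<^bsub>C\<^esub>) \<Longrightarrow>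
      ev I (frag_map g (\<lambda>x. x) z) = \<zero>\<^bsub>I\<^esub>"
  shows "\<exists>w \<in> frags B (star R C I). z - frag_map d (\<lambda>x. x) w \<in> tensor_null S A (star R C I)"
proof -
  have Im: "left_module R I" using I by (simp add: injective_module_def)
  interpret I: left_module R I by (rule Im)
  have Am: "left_module (opp_ring S) A" and Bm: "left_module (opp_ring S) B"
    using A B by (simp_all add: dual_basis_def)
  let ?d = "\<lambda>g. \<lambda>x\<in>carrier B. g (d x)"
  have "?d \<in> mod_hom R (dual_module S C A) (dual_module S C B)"
  proof (rule mod_homI)
    fix g assume "g \<in> carrier (dual_module S C A)"
    then show "?d g \<in> carrier (dual_module S C B)"
      using mod_hom_restrict[OF Bm mod_hom_comp[OF d, of g "right_module C"]] by simp
  qed (auto simp: fun_eq_iff mod_homD[OF d])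
  from injective_extend[OF I left_module_dual[OF Am] left_module_dual[OF Bm] this ev_pairing_hom[OF Im Am z]]
  obtain k where k: "k \<in> mod_hom R (dual_module S C B) I"
    "\<And>g. g \<in> carrier (dual_module S C A) \<Longrightarrow> k (?d g) = ev I (frag_map g (\<lambda>x. x) z)"
  proof (atomize_elim, goal_cases)
    case 1
    have "ev I (frag_map g (\<lambda>x. x) z) = \<zero>\<^bsub>I\<^esub>"
      if "g \<in> carrier (dual_module S C A)" "?d g = \<zero>\<^bsub>dual_module S C B\<^esub>" for g
    proof (rule cyc)
      show "g (d x) = \<zero>\<^bsub>C\<^esub>" if "x \<in> carrier B" for x
        using fun_cong[OF \<open>?d g = _\<close>, of x] that by simp
    qed (use that in simp)
    with 1 show ?case by blast
  qed
  obtain w where w: "w \<in> frags B (star R C I)"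
    "\<And>g. g \<in> mod_hom (opp_ring S) B (right_module C) \<Longrightarrow> ev I (frag_map g (\<lambda>x. x) w) = k (restrict g (carrier B))"
    using ev_realize[OF Im B k(1)] by blast
  have dw: "frag_map d (\<lambda>x. x) w \<in> frags A (star R C I)"
    by (rule frag_map_frags[OF w(1)]) (auto simp: mod_homD[OF d])
  have "z - frag_map d (\<lambda>x. x) w \<in> tensor_null S A (star R C I)"
  proof (rule tensor_null_if_ev[OF Im A frags_diff[OF z dw]])
    fix g assume g: "g \<in> mod_hom (opp_ring S) A (right_module C)"
    let ?g = "restrict g (carrier A)"
    have rg: "?g \<in> carrier (dual_module S C A)" using mod_hom_restrict[OF Am g] by simp
    have "ev I (frag_map g (\<lambda>x. x) (frag_map d (\<lambda>x. x) w)) = k (restrict (\<lambda>x. g (d x)) (carrier B))"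
      unfolding frag_map_comp by (rule w(2)[OF mod_hom_comp[OF d g]])
    also have "restrict (\<lambda>x. g (d x)) (carrier B) = ?d ?g"
      by (auto simp: fun_eq_iff mod_homD[OF d])
    also have "k (?d ?g) = ev I (frag_map ?g (\<lambda>x. x) z)" by (rule k(2)[OF rg])
    also have "frag_map ?g (\<lambda>x. x) z = frag_map g (\<lambda>x. x) z" by (rule frag_map_cong[OF z]) auto
    finally show "ev I (frag_map g (\<lambda>x. x) (z - frag_map d (\<lambda>x. x) w)) = \<zero>\<^bsub>I\<^esub>"
      using ev_closed[OF Im frag_map_right_module[OF g z]] unfolding frag_map_simps
      by (simp add: ev_diff[OF Im] frag_map_right_module[OF g z] frag_map_right_module[OF g dw] I.M.minus_eq_zero_iff)
  qed
  with w(1) show ?thesis by blast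
qed

end

section \<open>Quotients of left modules\<close>

context
  fixes R :: "'r ring" and A :: "('r, 'a, 'x) module_scheme" and K
  assumes A: "left_module R A" and K: "submodule K R A"
begin

interpretation A: left_module R A by (rule A)

interpretation K: abelian_subgroup K A
  by (rule abelian_subgroupI3)
    (use K in \<open>auto simp: additive_subgroup_def submodule_def A.M.abelian_group_axioms\<close>)

private lemma K_subgroup: "subgroup K (add_monoid A)"
  using K by (simp add: submodule_def)

lemma quot_module_simps:
  "carrier (quot_module A K) = (\<lambda>a. K +>\<^bsub>A\<^esub> a) ` carrier A"
  "\<zero>\<^bsub>quot_module A K\<^esub> = K"
  "x \<in> carrier A \<Longrightarrow> y \<in> carrier A \<Longrightarrow> (K +>\<^bsub>A\<^esub> x) \<oplus>\<^bsub>quot_module A K\<^esub> (K +>\<^bsub>A\<^esub> y) = K +>\<^bsub>A\<^esub> (x \<oplus>\<^bsub>A\<^esub> y)"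
  "r \<in> carrier R \<Longrightarrow> x \<in> carrier A \<Longrightarrow> r \<odot>\<^bsub>quot_module A K\<^esub> (K +>\<^bsub>A\<^esub> x) = K +>\<^bsub>A\<^esub> (r \<odot>\<^bsub>A\<^esub> x)"
proof -
  show "carrier (quot_module A K) = (\<lambda>a. K +>\<^bsub>A\<^esub> a) ` carrier A"
    by (auto simp: quot_module_def A_FactGroup_def FactGroup_def RCOSETS_def a_r_coset_def)
  show "\<zero>\<^bsub>quot_module A K\<^esub> = K"
    by (simp add: quot_module_def A_FactGroup_def FactGroup_def)
  show "(K +>\<^bsub>A\<^esub> x) \<oplus>\<^bsub>quot_module A K\<^esub> (K +>\<^bsub>A\<^esub> y) = K +>\<^bsub>A\<^esub> (x \<oplus>\<^bsub>A\<^esub> y)"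
    if "x \<in> carrier A" "y \<in> carrier A"
    using K.a_rcos_sum[OF that] by (simp add: quot_module_def A_FactGroup_def FactGroup_def set_add_def)
  show "r \<odot>\<^bsub>quot_module A K\<^esub> (K +>\<^bsub>A\<^esub> x) = K +>\<^bsub>A\<^esub> (r \<odot>\<^bsub>A\<^esub> x)"
    if r: "r \<in> carrier R" and x: "x \<in> carrier A"
  proof -
    \<comment> \<open>The scalar action on the quotient is a union over representatives; all of them
      give the same coset because K absorbs scalars.\<close>
    have "K +>\<^bsub>A\<^esub> (r \<odot>\<^bsub>A\<^esub> y) = K +>\<^bsub>A\<^esub> (r \<odot>\<^bsub>A\<^esub> x)" if "y \<in> K +>\<^bsub>A\<^esub> x" for y
    proof -
      obtain h where h: "h \<in> K" "y = h \<oplus>\<^bsub>A\<^esub> x" using \<open>y \<in> _\<close> by (auto simp: a_r_coset_def r_coset_def)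
      then have hA: "h \<in> carrier A" using K.a_subset by blast
      have "r \<odot>\<^bsub>A\<^esub> y = r \<odot>\<^bsub>A\<^esub> h \<oplus>\<^bsub>A\<^esub> r \<odot>\<^bsub>A\<^esub> x" using r x h hA by (simp add: A.smult_r_distr)
      moreover have "r \<odot>\<^bsub>A\<^esub> h \<in> K" by (rule submodule.smult_closed[OF K r h(1)])
      ultimately have "r \<odot>\<^bsub>A\<^esub> y \<in> K +>\<^bsub>A\<^esub> (r \<odot>\<^bsub>A\<^esub> x)" by (auto simp: a_r_coset_def r_coset_def)
      then show ?thesis using A.M.a_repr_independence[OF _ _ K_subgroup] r x by simp
    qed
    then have "(\<Union>y\<in>K +>\<^bsub>A\<^esub> x. K +>\<^bsub>A\<^esub> (r \<odot>\<^bsub>A\<^esub> y)) = (\<Union>y\<in>K +>\<^bsub>A\<^esub> x. K +>\<^bsub>A\<^esub> (r \<odot>\<^bsub>A\<^esub> x))"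
      by (rule SUP_cong[OF refl])
    also have "\<dots> = K +>\<^bsub>A\<^esub> (r \<odot>\<^bsub>A\<^esub> x)" using K.a_rcos_self[OF x] by blast
    finally show ?thesis by (simp add: quot_module_def)
  qed
qed

lemma left_module_quot: "left_module R (quot_module A K)"
proof -
  have car: "(K +>\<^bsub>A\<^esub> x) \<in> carrier (quot_module A K)" if "x \<in> carrier A" for x
    using that by (simp add: quot_module_simps)
  have z: "\<zero>\<^bsub>quot_module A K\<^esub> = K +>\<^bsub>A\<^esub> \<zero>\<^bsub>A\<^esub>"
    using K.a_subset by (simp add: quot_module_simps)
  have E: "\<exists>x \<in> carrier A. X = K +>\<^bsub>A\<^esub> x" if "X \<in> carrier (quot_module A K)" for X
    using that by (auto simp: quot_module_simps)
  have "abelian_group (quot_module A K)"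
  proof (rule abelian_groupI)
    fix X assume "X \<in> carrier (quot_module A K)"
    then obtain x where "x \<in> carrier A" "X = K +>\<^bsub>A\<^esub> x" using E by blast
    then show "\<exists>Y\<in>carrier (quot_module A K). Y \<oplus>\<^bsub>quot_module A K\<^esub> X = \<zero>\<^bsub>quot_module A K\<^esub>"
      unfolding z by (intro bexI[of _ "K +>\<^bsub>A\<^esub> (\<ominus>\<^bsub>A\<^esub> x)"]) (auto simp: quot_module_simps(3) A.M.l_neg car)
  next
    show "\<zero>\<^bsub>quot_module A K\<^esub> \<in> carrier (quot_module A K)" unfolding z by (rule car) simp
  next
    fix X assume "X \<in> carrier (quot_module A K)"
    then obtain x where "x \<in> carrier A" "X = K +>\<^bsub>A\<^esub> x" using E by blast
    then show "\<zero>\<^bsub>quot_module A K\<^esub> \<oplus>\<^bsub>quot_module A K\<^esub> X = X" unfolding z by (simp add: quot_module_simps(3))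
  qed (auto dest!: E simp: quot_module_simps(3) A.M.a_ac car)
  then show ?thesis
    unfolding left_module_def left_module_axioms_def
    using A.ring_axioms
    by (auto dest!: E simp: quot_module_simps(3,4) A.smult_l_distr A.smult_r_distr A.smult_assoc1 car)
qed

lemma quot_map:
  shows "(\<lambda>a. K +>\<^bsub>A\<^esub> a) \<in> mod_hom R A (quot_module A K)"
    and "(\<lambda>a. K +>\<^bsub>A\<^esub> a) ` carrier A = carrier (quot_module A K)"
    and "a_kernel A (quot_module A K) (\<lambda>a. K +>\<^bsub>A\<^esub> a) = K"
proof -
  show "(\<lambda>a. K +>\<^bsub>A\<^esub> a) \<in> mod_hom R A (quot_module A K)"
    by (rule mod_homI) (auto simp: quot_module_simps)
  show "(\<lambda>a. K +>\<^bsub>A\<^esub> a) ` carrier A = carrier (quot_module A K)"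
    by (simp add: quot_module_simps)
  show "a_kernel A (quot_module A K) (\<lambda>a. K +>\<^bsub>A\<^esub> a) = K"
    using A.M.a_coset_join1[OF _ _ K_subgroup] A.M.a_coset_join2[OF _ K_subgroup] K.a_subset
    by (auto simp: a_kernel_eq quot_module_simps)
qed

end

lemma fin_gen_projective_dual_basis:
  assumes "projective_module R P" "fin_gen_module R P"
  obtains X s where "finite X" "dual_basis R P X s"
  using assms projective_module_dual_basis[OF assms(1)] unfolding fin_gen_module_def by metis

context bimodule_pair begin

section \<open>Injective modules lie in the Bass class\<close>

text \<open>The three conclusions share a finitely generated projective resolution P of C over S.
  For the first two, \<open>exact\<close> reduces exactness of P \<otimes> Hom(C,I) to tests against
  maps g from P to C; for the third, a functional on Hom(P 0, C) is realized by a tensor.\<close>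

lemma injective_Bass:
  assumes sd: "semidualizing R S C" and I: "injective_module R I"
  shows injective_star_tor: "tor_vanishes S (std_res (opp_ring S) (right_module C)) (std_diff (opp_ring S) (right_module C)) (star R C I) n"
    and injective_ev_inj: "z \<in> frags (right_module C) (star R C I) \<Longrightarrow> ev I z = \<zero>\<^bsub>I\<^esub> \<Longrightarrow>
          z \<in> tensor_null S (right_module C) (star R C I)"
    and injective_ev_surj: "y \<in> carrier I \<Longrightarrow> \<exists>z \<in> frags (right_module C) (star R C I). ev I z = y"
proof -
  have Im: "left_module R I" using I by (simp add: injective_module_def)
  interpret I: left_module R I by (rule Im)
  note N = left_module_star[OF Im]
  obtain P :: "nat \<Rightarrow> ('s, nat \<Rightarrow> 's) module" and d \<epsilon>
    where PR: "projective_resolution (opp_ring S) (right_module C) P d \<epsilon>"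
    and fg: "\<And>n. fin_gen_module (opp_ring S) (P n)"
    using sd unfolding semidualizing_def has_fg_projective_resolution_def by blast
  note p = projective_resolutionD[OF PR] and pz = projective_resolution_comp_zero[OF PR]
  have "\<exists>X s. finite X \<and> dual_basis (opp_ring S) (P n) X s" for n
    using fin_gen_projective_dual_basis[OF p(1) fg] by blast
  then obtain X s where db: "\<And>n. finite (X n)" "\<And>n. dual_basis (opp_ring S) (P n) (X n) (s n)" by metis
  have lh: "inj_on (left_homothety C) (carrier R)"
    "carrier (hom_group (opp_ring S) (right_module C) (right_module C)) = left_homothety C ` carrier R"
    using sd by (simp_all add: semidualizing_def iso_def bij_betw_def del: hom_group_simps)
  have exact: "\<exists>w \<in> frags (P (Suc n)) (star R C I). z - frag_map (d n) (\<lambda>x. x) w \<in> tensor_null S (P n) (star R C I)"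
    if "z \<in> frags (P n) (star R C I)"
      "\<And>g. g \<in> mod_hom (opp_ring S) (P n) (right_module C) \<Longrightarrow> (\<And>x. x \<in> carrier (P (Suc n)) \<Longrightarrow> g (d n x) = \<zero>\<^bsub>C\<^esub>) \<Longrightarrow>
        ev I (frag_map g (\<lambda>x. x) z) = \<zero>\<^bsub>I\<^esub>" for n z
    by (rule tensor_exact_star_injective[OF I db(2) db(2) db(1) p(3) that])
  \<comment> \<open>Ext is given on the standard resolution and is moved here to P; the resulting
    vanishing of Tor is moved back afterwards.\<close>
  have ext: "ext_vanishes (opp_ring S) P d (right_module C) n" for n
    by (rule ext_vanishes_resolution[OF CS CS PR projective_resolution_std_res[OF CS] ext_vanishes_std[OF CS CS]])
      (use sd in \<open>simp add: semidualizing_def\<close>)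
  have "tor_vanishes S P d (star R C I) n" for n
    unfolding tor_vanishes_def
  proof (intro ballI impI)
    fix z assume z: "z \<in> frags (P (Suc n)) (star R C I)"
      and cyc: "frag_map (d n) (\<lambda>x. x) z \<in> tensor_null S (P n) (star R C I)"
    show "\<exists>w\<in>frags (P (Suc (Suc n))) (star R C I).
        z - frag_map (d (Suc n)) (\<lambda>x. x) w \<in> tensor_null S (P (Suc n)) (star R C I)"
    proof (rule exact[OF z])
      \<comment> \<open>Vanishing of Ext writes g as h d, so g sends z to the image under h of its
        boundary, which is null.\<close>
      fix g assume "g \<in> mod_hom (opp_ring S) (P (Suc n)) (right_module C)"
        "\<And>x. x \<in> carrier (P (Suc (Suc n))) \<Longrightarrow> g (d (Suc n) x) = \<zero>\<^bsub>C\<^esub>"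
      then obtain h where h: "h \<in> mod_hom (opp_ring S) (P n) (right_module C)"
        "\<And>x. x \<in> carrier (P (Suc n)) \<Longrightarrow> g x = h (d n x)"
        using ext[of n] unfolding ext_vanishes_def by (metis right_module_simps(2))
      have "frag_map g (\<lambda>x. x) z = frag_map h (\<lambda>x. x) (frag_map (d n) (\<lambda>x. x) z)"
        unfolding frag_map_comp by (rule frag_map_cong[OF z]) (simp_all add: h(2))
      then show "ev I (frag_map g (\<lambda>x. x) z) = \<zero>\<^bsub>I\<^esub>"
        using ev_null[OF Im frag_map_null[OF p(2) N CS N h(1) mod_hom_ident cyc]] by simp
    qed
  qed
  then show "tor_vanishes S (std_res (opp_ring S) (right_module C)) (std_diff (opp_ring S) (right_module C)) (star R C I) n"
    by (rule tor_vanishes_resolution[OF CS N projective_resolution_std_res[OF CS] PR])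
  {
    assume z: "z \<in> frags (right_module C) (star R C I)" "ev I z = \<zero>\<^bsub>I\<^esub>"
    obtain y where y: "y \<in> frags (P 0) (star R C I)" "frag_map \<epsilon> (\<lambda>x. x) y = z"
      using frag_map_surj[OF z(1) p(5), of "\<lambda>x. x" "star R C I"] by auto
    have "\<exists>w \<in> frags (P (Suc 0)) (star R C I). y - frag_map (d 0) (\<lambda>x. x) w \<in> tensor_null S (P 0) (star R C I)"
    proof (rule exact[OF y(1)])
      fix g assume g: "g \<in> mod_hom (opp_ring S) (P 0) (right_module C)"
        and gd: "\<And>x. x \<in> carrier (P (Suc 0)) \<Longrightarrow> g (d 0 x) = \<zero>\<^bsub>C\<^esub>"
      \<comment> \<open>As g kills the image of \<open>d 0\<close>, the kernel of \<epsilon>, it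
        descends to an endomorphism h of C over S. By the homothety isomorphism h is multiplication
        by some r, so the pairing of g with y is r times \<open>ev I z\<close>, which is
        zero.\<close>
      define h where "h = (\<lambda>c\<in>carrier C. g (inv_into (carrier (P 0)) \<epsilon> c))"
      have eps: "\<epsilon> x \<in> carrier C" if "x \<in> carrier (P 0)" for x
        using mod_hom_closed[OF p(4) that] by simp
      have h: "h (\<epsilon> x) = g x" if x: "x \<in> carrier (P 0)" for x
      proof -
        define x' where "x' = inv_into (carrier (P 0)) \<epsilon> (\<epsilon> x)"
        have x': "x' \<in> carrier (P 0)" "\<epsilon> x' = \<epsilon> x" using x by (auto simp: x'_def f_inv_into_f intro: inv_into_into)
        interpret P0: left_module "opp_ring S" "P 0" by (rule p(2))
        have "\<epsilon> (x' \<ominus>\<^bsub>P 0\<^esub> x) = \<zero>\<^bsub>right_module C\<^esub>"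
          using x x' mod_hom_closed[OF p(4)]
          by (simp only: mod_hom_diff[OF p(2) CS p(4)] CS.M.minus_eq_zero_iff)
        then have "x' \<ominus>\<^bsub>P 0\<^esub> x \<in> d 0 ` carrier (P (Suc 0))" using x x' by (simp add: p(6) a_kernel_eq)
        then have "g (x' \<ominus>\<^bsub>P 0\<^esub> x) = \<zero>\<^bsub>right_module C\<^esub>" using gd by auto
        then have "g x' = g x"
          using x x' mod_hom_closed[OF g]
          by (simp only: mod_hom_diff[OF p(2) CS g] CS.M.minus_eq_zero_iff)
        then show ?thesis using eps[OF x] by (simp add: h_def x'_def)
      qed
      have "h \<in> mod_hom (opp_ring S) (right_module C) (right_module C)"
      proof (rule mod_homI)
        fix a b assume "a \<in> carrier (right_module C)" "b \<in> carrier (right_module C)"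
        then obtain x y where "x \<in> carrier (P 0)" "y \<in> carrier (P 0)" "a = \<epsilon> x" "b = \<epsilon> y"
          using p(5) by blast
        then show "h (a \<oplus>\<^bsub>right_module C\<^esub> b) = h a \<oplus>\<^bsub>right_module C\<^esub> h b"
          using h left_module.axioms(2)[OF p(2), of 0] abelian_groupE(1)[of "P 0" x y]
          by (simp only: mod_hom_add[OF p(4), symmetric] mod_hom_add[OF g])
      next
        fix t a assume t: "t \<in> carrier (opp_ring S)" and "a \<in> carrier (right_module C)"
        then obtain x where "x \<in> carrier (P 0)" "a = \<epsilon> x" using p(5) by blast
        then show "h (t \<odot>\<^bsub>right_module C\<^esub> a) = t \<odot>\<^bsub>right_module C\<^esub> h a"
          using t h left_module.smult_closed[OF p(2) t, of x 0]
          by (simp only: mod_hom_smult[OF p(4), symmetric] mod_hom_smult[OF g])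
      next
        fix a assume "a \<in> carrier (right_module C)"
        then obtain x where "x \<in> carrier (P 0)" "a = \<epsilon> x" using p(5) by blast
        then show "h a \<in> carrier (right_module C)" using h mod_hom_closed[OF g] by simp
      qed
      then have "h \<in> carrier (hom_group (opp_ring S) (right_module C) (right_module C))"
        by (simp add: h_def)
      then obtain r where r: "r \<in> carrier R" "h = left_homothety C r"
        unfolding lh(2) by blast
      have "frag_map g (\<lambda>x. x) y = frag_map (\<lambda>x. r \<odot>\<^bsub>C\<^esub> x) (\<lambda>x. x) (frag_map \<epsilon> (\<lambda>x. x) y)"
        unfolding frag_map_comp
        by (rule frag_map_cong[OF y(1)]) (use eps in \<open>simp_all add: h[symmetric] r(2) left_homothety_def\<close>)
      then show "ev I (frag_map g (\<lambda>x. x) y) = \<zero>\<^bsub>I\<^esub>"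
        using ev_smult[OF Im r(1) z(1)] z(2) r(1) by (simp add: y(2) I.smult_r_null)
    qed
    then obtain w where w: "w \<in> frags (P (Suc 0)) (star R C I)"
      "y - frag_map (d 0) (\<lambda>x. x) w \<in> tensor_null S (P 0) (star R C I)" by blast
    have "frag_map \<epsilon> (\<lambda>x. x) (y - frag_map (d 0) (\<lambda>x. x) w) + frag_map \<epsilon> (\<lambda>x. x) (frag_map (d 0) (\<lambda>x. x) w)
      \<in> tensor_null S (right_module C) (star R C I)"
    proof (rule tensor_null_add[OF CS N])
      show "frag_map \<epsilon> (\<lambda>x. x) (y - frag_map (d 0) (\<lambda>x. x) w) \<in> tensor_null S (right_module C) (star R C I)"
        by (rule frag_map_null[OF p(2) N CS N p(4) mod_hom_ident w(2)])
      show "frag_map \<epsilon> (\<lambda>x. x) (frag_map (d 0) (\<lambda>x. x) w) \<in> tensor_null S (right_module C) (star R C I)"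
        unfolding frag_map_comp
        by (rule frag_map_null_if_zero[OF CS N w(1)]) (use pz(1) in auto)
    qed
    then show "z \<in> tensor_null S (right_module C) (star R C I)" using y(2) by simp
  }
  {
    assume y: "y \<in> carrier I"
    \<comment> \<open>R as a left module. The map r -> r \<epsilon> embeds it in Hom(P 0, C),
      because \<epsilon> is onto and the homothety map is injective. Extending r -> r y along it
      gives a functional with value y at \<epsilon>, and a tensor realizing it evaluates to
      y.\<close>
    let ?R = "module_of_group (add_monoid R) (\<lambda>r x. r \<otimes>\<^bsub>R\<^esub> x)"
    have Rm: "left_module R ?R"
      by (rule left_module_module_of_group[OF C.ring_axioms C.R.a_comm_group])
        (auto simp: C.R.l_distr C.R.r_distr C.R.m_assoc)
    have eps: "\<epsilon> x \<in> carrier C" if "x \<in> carrier (P 0)" for x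
      using mod_hom_closed[OF p(4) that] by simp
    let ?f = "\<lambda>r. \<lambda>x\<in>carrier (P 0). r \<odot>\<^bsub>C\<^esub> \<epsilon> x"
    have f: "?f \<in> mod_hom R ?R (dual_module S C (P 0))"
    proof (rule mod_homI)
      fix r assume "r \<in> carrier ?R"
      then show "?f r \<in> carrier (dual_module S C (P 0))"
        using mod_hom_restrict[OF p(2) mod_hom_comp[OF p(4) smult_hom[of r]]] by simp
    qed (use eps in \<open>auto simp: fun_eq_iff C.smult_l_distr C.smult_assoc1\<close>)
    have h: "(\<lambda>r. r \<odot>\<^bsub>I\<^esub> y) \<in> mod_hom R ?R I"
      by (rule mod_homI) (use y in \<open>auto simp: I.smult_l_distr I.smult_assoc1\<close>)
    have "\<exists>k \<in> mod_hom R (dual_module S C (P 0)) I. \<forall>r \<in> carrier ?R. k (?f r) = r \<odot>\<^bsub>I\<^esub> y"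
    proof (rule injective_extend[OF I Rm left_module_dual[OF p(2)] f h])
      fix r assume r: "r \<in> carrier ?R" and f0: "?f r = \<zero>\<^bsub>dual_module S C (P 0)\<^esub>"
      have "r \<odot>\<^bsub>C\<^esub> c = \<zero>\<^bsub>C\<^esub>" if "c \<in> carrier C" for c
      proof -
        have "c \<in> \<epsilon> ` carrier (P 0)" using that p(5) by simp
        then obtain x where "x \<in> carrier (P 0)" "c = \<epsilon> x" by blast
        then show ?thesis using fun_cong[OF f0, of x] by simp
      qed
      then have "left_homothety C r = left_homothety C \<zero>\<^bsub>R\<^esub>"
        by (auto simp: left_homothety_def fun_eq_iff C.smult_l_null)
      then have "r = \<zero>\<^bsub>R\<^esub>"
        using inj_onD[OF lh(1)] r by simp
      then show "r \<odot>\<^bsub>I\<^esub> y = \<zero>\<^bsub>I\<^esub>" using y by (simp add: I.smult_l_null)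
    qed
    then obtain k where k: "k \<in> mod_hom R (dual_module S C (P 0)) I" "k (?f \<one>\<^bsub>R\<^esub>) = y"
      using y by force
    obtain z where z: "z \<in> frags (P 0) (star R C I)"
      "ev I (frag_map \<epsilon> (\<lambda>x. x) z) = k (restrict \<epsilon> (carrier (P 0)))"
      using ev_realize[OF Im db(2) db(1) k(1)] p(4) by blast
    have "?f \<one>\<^bsub>R\<^esub> = restrict \<epsilon> (carrier (P 0))" using eps by (auto simp: fun_eq_iff)
    then show "\<exists>z \<in> frags (right_module C) (star R C I). ev I z = y"
      using z k(2) frag_map_right_module[OF p(4) z(1)] by auto
  }
qed

section \<open>Bijectivity of \<open>theta\<close> and left exactness of Hom(C,-)\<close>

lemma theta_class:
  assumes M: "left_module R M" and z: "z \<in> frags (right_module C) (star R C M)"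
  shows "theta M (tensor_class S (right_module C) (star R C M) z) = ev M z"
proof -
  let ?X = "tensor_class S (right_module C) (star R C M) z"
  interpret M: left_module R M by fact
  have "ev M w = ev M z" if "w \<in> ?X" for w
  proof -
    have w: "w - z \<in> tensor_null S (right_module C) (star R C M)" using that by (simp add: tensor_class_mem)
    have "ev M ((w - z) + z) = ev M (w - z) \<oplus>\<^bsub>M\<^esub> ev M z"
      by (rule ev_add[OF M tensor_null_frags[OF CS left_module_star[OF M] w] z])
    then show ?thesis using ev_closed[OF M z] by (simp add: ev_null[OF M w])
  qed
  moreover have "z \<in> ?X" by (simp add: tensor_class_mem tensor_null_0[OF CS left_module_star[OF M]])
  ultimately have "ev M ` ?X = {ev M z}" by blast
  moreover have "theta M ?X = the_elem (ev M ` ?X)"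
    unfolding theta_def ev_def frag_eval_def ..
  ultimately show ?thesis by simp
qed

text \<open>Bijectivity is split into a condition on the kernel and one on the cokernel, which Tor
  of the cotranspose in degrees 2 and 1 will match separately.\<close>

lemma theta_iso_iff:
  assumes M: "left_module R M"
  shows "theta M \<in> mod_iso R (tensor_left_module S C (star R C M)) M \<longleftrightarrow>
    (\<forall>z \<in> frags (right_module C) (star R C M). ev M z = \<zero>\<^bsub>M\<^esub> \<longrightarrow> z \<in> tensor_null S (right_module C) (star R C M)) \<and>
    (\<forall>y \<in> carrier M. \<exists>z \<in> frags (right_module C) (star R C M). ev M z = y)"
proof -
  interpret M: left_module R M by fact
  note N = left_module_star[OF M]
  let ?F = "frags (right_module C) (star R C M)" and ?c = "tensor_class S (right_module C) (star R C M)"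
  let ?T = "tensor_left_module S C (star R C M)"
  have car: "carrier ?T = ?c ` ?F" by (simp add: tensor_left_module_def carrier_tensor)
  note th = theta_class[OF M]
  have sm: "r \<odot>\<^bsub>?T\<^esub> ?c z = ?c (frag_map (\<lambda>x. r \<odot>\<^bsub>C\<^esub> x) (\<lambda>x. x) z)" if "r \<in> carrier R" for r z
    by (simp add: tensor_left_module_def tensor_map_class[OF CS N CS smult_hom[OF that]])
  have "theta M \<in> mod_hom R ?T M"
  proof (rule mod_homI)
    fix X Y assume "X \<in> carrier ?T" "Y \<in> carrier ?T"
    then obtain z w where zw: "z \<in> ?F" "w \<in> ?F" "X = ?c z" "Y = ?c w" by (auto simp: car)
    have "X \<oplus>\<^bsub>?T\<^esub> Y = ?c (z + w)" using tensor_class_mult[OF CS N zw(1,2)] zw by (simp add: tensor_left_module_def)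
    then show "theta M (X \<oplus>\<^bsub>?T\<^esub> Y) = theta M X \<oplus>\<^bsub>M\<^esub> theta M Y"
      using zw by (simp add: th frags_add ev_add[OF M])
  next
    fix r X assume r: "r \<in> carrier R" and "X \<in> carrier ?T"
    then obtain z where z: "z \<in> ?F" "X = ?c z" by (auto simp: car)
    then show "theta M (r \<odot>\<^bsub>?T\<^esub> X) = r \<odot>\<^bsub>M\<^esub> theta M X"
      by (simp add: sm[OF r] th frag_map_right_module[OF smult_hom[OF r]] ev_smult[OF M r])
  qed (auto simp: car th ev_closed[OF M])
  then have "theta M \<in> mod_iso R ?T M \<longleftrightarrow> inj_on (theta M) (carrier ?T) \<and> theta M ` carrier ?T = carrier M"
    by (simp add: mod_iso_def bij_betw_def)
  also have "theta M ` carrier ?T = carrier M \<longleftrightarrow> (\<forall>y \<in> carrier M. \<exists>z \<in> ?F. ev M z = y)"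
  proof -
    have "theta M ` carrier ?T = ev M ` ?F" by (auto simp: car th image_image)
    moreover have "ev M ` ?F \<subseteq> carrier M" using ev_closed[OF M] by blast
    ultimately have "theta M ` carrier ?T = carrier M \<longleftrightarrow> carrier M \<subseteq> ev M ` ?F" by blast
    also have "\<dots> \<longleftrightarrow> (\<forall>y \<in> carrier M. \<exists>z \<in> ?F. ev M z = y)"
      unfolding subset_iff image_iff Ball_def by metis
    finally show ?thesis .
  qed
  also have "inj_on (theta M) (carrier ?T) \<longleftrightarrow>
      (\<forall>z \<in> ?F. ev M z = \<zero>\<^bsub>M\<^esub> \<longrightarrow> z \<in> tensor_null S (right_module C) (star R C M))"
  proof
    assume inj: "inj_on (theta M) (carrier ?T)"
    show "\<forall>z \<in> ?F. ev M z = \<zero>\<^bsub>M\<^esub> \<longrightarrow> z \<in> tensor_null S (right_module C) (star R C M)"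
    proof (intro ballI impI)
      fix z assume z: "z \<in> ?F" "ev M z = \<zero>\<^bsub>M\<^esub>"
      then have "theta M (?c z) = theta M (?c 0)" by (simp add: th ev_0[OF M])
      then have "?c z = ?c 0" using inj z(1) by (auto simp: car dest: inj_onD)
      then show "z \<in> tensor_null S (right_module C) (star R C M)" by (simp add: tensor_class_eq[OF CS N])
    qed
  next
    assume k: "\<forall>z \<in> ?F. ev M z = \<zero>\<^bsub>M\<^esub> \<longrightarrow> z \<in> tensor_null S (right_module C) (star R C M)"
    show "inj_on (theta M) (carrier ?T)"
    proof (rule inj_onI)
      fix X Y assume "X \<in> carrier ?T" "Y \<in> carrier ?T" and eq: "theta M X = theta M Y"
      then obtain z w where zw: "z \<in> ?F" "w \<in> ?F" "X = ?c z" "Y = ?c w" by (auto simp: car)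
      have "ev M (z - w) = \<zero>\<^bsub>M\<^esub>"
        using eq zw ev_closed[OF M] by (simp add: th ev_diff[OF M] M.M.minus_eq_zero_iff)
      then show "X = Y" using k zw by (simp add: tensor_class_eq[OF CS N] frags_diff)
    qed
  qed
  finally show ?thesis by blast
qed

lemma star_left_exact:
  assumes M: "left_module R M" and A: "left_module R A" and B: "left_module R B"
    and i: "i \<in> mod_hom R M A" "inj_on i (carrier M)" and g: "g \<in> mod_hom R A B"
    and ig: "i ` carrier M = a_kernel A B g"
  shows "inj_on (star_map C i) (carrier (star R C M))"
    and "star_map C i ` carrier (star R C M) = a_kernel (star R C A) (star R C B) (star_map C g)"
proof -
  interpret M: left_module R M by fact
  note si = star_map_hom[OF M A i(1)]
  show "inj_on (star_map C i) (carrier (star R C M))"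
  proof (rule inj_onI)
    fix h k assume h: "h \<in> carrier (star R C M)" and k: "k \<in> carrier (star R C M)"
      and eq: "star_map C i h = star_map C i k"
    have "h x = k x" if x: "x \<in> carrier C" for x
      using fun_cong[OF eq, of x] x inj_onD[OF i(2)] star_closed[OF M h x] star_closed[OF M k x]
      by (simp add: star_map_def)
    then show "h = k" using h k by (auto intro: extensionalityI)
  qed
  show "star_map C i ` carrier (star R C M) = a_kernel (star R C A) (star R C B) (star_map C g)"
  proof (intro equalityI subsetI)
    fix k assume "k \<in> star_map C i ` carrier (star R C M)"
    then obtain h where h: "h \<in> carrier (star R C M)" "k = star_map C i h" by blast
    have "g (i x) = \<zero>\<^bsub>B\<^esub>" if "x \<in> carrier M" for x using that ig by (auto simp: a_kernel_eq)
    then show "k \<in> a_kernel (star R C A) (star R C B) (star_map C g)"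
      using h mod_hom_closed[OF si h(1)] star_closed[OF M h(1)]
      by (simp add: a_kernel_eq) (auto simp: star_map_def)
  next
    fix k assume k: "k \<in> a_kernel (star R C A) (star R C B) (star_map C g)"
    then have kA: "k \<in> mod_hom R C A" "k \<in> extensional (carrier C)" and g0: "star_map C g k = (\<lambda>x\<in>carrier C. \<zero>\<^bsub>B\<^esub>)"
      by (auto simp: a_kernel_eq)
    have im: "k x \<in> i ` carrier M" if x: "x \<in> carrier C" for x
      using fun_cong[OF g0, of x] x mod_hom_closed[OF kA(1) x] unfolding ig by (simp add: star_map_def a_kernel_eq)
    \<comment> \<open>Pointwise preimages under i; their uniqueness makes h linear.\<close>
    define h where "h = (\<lambda>x\<in>carrier C. inv_into (carrier M) i (k x))"
    have h: "h x \<in> carrier M" "i (h x) = k x" if "x \<in> carrier C" for x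
      using im[OF that] that by (auto simp: h_def f_inv_into_f inv_into_into)
    have "h \<in> mod_hom R C M"
    proof (rule mod_homI)
      fix x y assume "x \<in> carrier C" "y \<in> carrier C"
      then show "h (x \<oplus>\<^bsub>C\<^esub> y) = h x \<oplus>\<^bsub>M\<^esub> h y"
        by (intro inj_onD[OF i(2)]) (auto simp: h mod_hom_add[OF i(1)] mod_hom_add[OF kA(1)])
    next
      fix r x assume "r \<in> carrier R" "x \<in> carrier C"
      then show "h (r \<odot>\<^bsub>C\<^esub> x) = r \<odot>\<^bsub>M\<^esub> h x"
        by (intro inj_onD[OF i(2)]) (auto simp: h mod_hom_smult[OF i(1)] mod_hom_smult[OF kA(1)])
    qed (rule h(1))
    then have "h \<in> carrier (star R C M)" by (simp add: h_def)
    moreover have "k = star_map C i h"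
      using kA(2) by (auto simp: star_map_def fun_eq_iff h(2) extensional_def)
    ultimately show "k \<in> star_map C i ` carrier (star R C M)" by blast
  qed
qed

end

section \<open>Tor of the cotranspose in degrees one, two and above\<close>

theorem theorem3p8:
  fixes R :: "'r ring" and S :: "'s ring" and C :: "('r, 's, 'c) bimodule"
    and M :: "('r, 'm) module"
    and I :: "nat \<Rightarrow> ('r, 'i) module" and \<eta> :: "'m \<Rightarrow> 'i" and f :: "nat \<Rightarrow> 'i \<Rightarrow> 'i"
  assumes "ring R" and "ring S" and "semidualizing R S C"
    and "left_module R M"
    and "minimal_injective_resolution R M I \<eta> f"
  shows "inf_cotorsionfree R S C I f \<and> inf_cospherical R C M \<longleftrightarrow> M \<in> Bass_class R S C"
proof -
  interpret bimodule_pair R S C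
    using assms(2,3) by (simp add: bimodule_pair_def semidualizing_def)
  note M = assms(4)
  have inj: "injective_module R (I n)" and \<eta>: "\<eta> \<in> mod_hom R M (I 0)" "inj_on \<eta> (carrier M)"
    and f: "f 0 \<in> mod_hom R (I 0) (I 1)" and ker: "\<eta> ` carrier M = a_kernel (I 0) (I 1) (f 0)" for n
    using assms(5) by (simp_all add: minimal_injective_resolution_def)
  have I: "left_module R (I n)" for n using inj[of n] by (simp add: injective_module_def)
  let ?C = "right_module C" and ?P = "std_res (opp_ring S) (right_module C)"
    and ?d = "std_diff (opp_ring S) (right_module C)"
  let ?N = "\<lambda>n. star R C (I n)" and ?a = "star_map C \<eta>" and ?b = "star_map C (f 0)"
  let ?K = "?b ` carrier (?N 0)"
  let ?L = "?N 1\<lparr>carrier := ?K\<rparr>" and ?T = "cTr R C I f"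
  note N = left_module_star[OF I] and N0 = left_module_star[OF M]
  note p = projective_resolutionD[OF projective_resolution_std_res[OF CS]] and pz = projective_resolution_comp_zero[OF projective_resolution_std_res[OF CS]]
  note a = star_map_hom[OF M I \<eta>(1)] and b = star_map_hom[OF I I f]
  have sub: "submodule ?K S (?N 1)" by (rule submodule_image[OF N N b])
  have L: "left_module S ?L" by (rule left_module_image[OF N N N b])
  have T: "?T = quot_module (?N 1) ?K" by (simp add: cTr_def)
  have Tm: "left_module S ?T" unfolding T by (rule left_module_quot[OF N sub])
  have KL: "?K \<subseteq> carrier (?N 1)" using mod_hom_closed[OF b] by blast
  \<comment> \<open>The four-term sequence is cut at L: A is 0 -> Hom(C,M) -> Hom(C,I 0) -> L -> 0,
    and B below is 0 -> L -> Hom(C,I 1) -> cTr -> 0.\<close>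
  interpret A: short_exact_tensor S ?P ?d "star R C M" "?N 0" ?L ?a ?b
  proof (rule short_exact_tensor.intro)
    show "?b \<in> mod_hom S (?N 0) ?L" using b by (auto simp: mod_hom_def)
    show "?a ` carrier (star R C M) = a_kernel (?N 0) ?L ?b"
      using star_left_exact(2)[OF M I I \<eta> f ker] by (simp add: a_kernel_eq)
    show "left_module S ?L" by (rule L)
  qed (simp_all add: p(1,3) pz(2) N N0 a star_left_exact(1)[OF M I I \<eta> f ker] del: star_simps)
  interpret B: short_exact_tensor S ?P ?d ?L "?N 1" ?T "\<lambda>x. x" "\<lambda>x. ?K +>\<^bsub>?N 1\<^esub> x"
  proof (rule short_exact_tensor.intro)
    show "(\<lambda>x. x) \<in> mod_hom S ?L (?N 1)" using KL by (auto simp: mod_hom_def)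
    show "(\<lambda>x. x) ` carrier ?L = a_kernel (?N 1) ?T (\<lambda>x. ?K +>\<^bsub>?N 1\<^esub> x)"
      using quot_map(3)[OF N sub] by (simp add: T)
    show "(\<lambda>x. ?K +>\<^bsub>?N 1\<^esub> x) \<in> mod_hom S (?N 1) ?T"
      "(\<lambda>x. ?K +>\<^bsub>?N 1\<^esub> x) ` carrier (?N 1) = carrier ?T"
      unfolding T by (fact quot_map[OF N sub])+
    show "left_module S ?L" "left_module S (?N 1)" "left_module S ?T" by (fact L N Tm)+
  qed (simp_all add: p(1,3) pz(2))
  note van = injective_star_tor[OF assms(3) inj]
  \<comment> \<open>\<open>tor_vanishes\<close> at n is about degree n + 1. Degree n + 3 of the
    cotranspose passes to degree n + 2 of L by B and to degree n + 1 of Hom(C,M) by A.\<close>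
  have high: "tor_vanishes S ?P ?d ?T (Suc (Suc n)) \<longleftrightarrow> tor_vanishes S ?P ?d (star R C M) n" for n
    using A.tor_shift[OF van] B.tor_shift[OF van] by simp
  have two: "tor_vanishes S ?P ?d ?T (Suc 0) \<longleftrightarrow>
      (\<forall>z \<in> frags ?C (star R C M). ev M z = \<zero>\<^bsub>M\<^esub> \<longrightarrow> z \<in> tensor_null S ?C (star R C M))"
  proof -
    \<comment> \<open>\<open>ev\<close> detects null sums over I 0; naturality and injectivity of
      \<eta> carry the test back to M.\<close>
    have "A.co ?a z \<in> tensor_null S ?C (?N 0) \<longleftrightarrow> ev M z = \<zero>\<^bsub>M\<^esub>" if z: "z \<in> frags ?C (star R C M)" for z
    proof -
      have az: "A.co ?a z \<in> frags ?C (?N 0)"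
        by (rule frag_map_frags[OF z _ mod_hom_closed[OF a]])
      have "A.co ?a z \<in> tensor_null S ?C (?N 0) \<longleftrightarrow> ev (I 0) (A.co ?a z) = \<zero>\<^bsub>I 0\<^esub>"
        using injective_ev_inj[OF assms(3) inj az] ev_null[OF I] by blast
      also have "\<dots> \<longleftrightarrow> \<eta> (ev M z) = \<eta> \<zero>\<^bsub>M\<^esub>"
        by (simp add: ev_star_map[OF M I \<eta>(1) z] mod_hom_zero[OF M I \<eta>(1)])
      also have "\<dots> \<longleftrightarrow> ev M z = \<zero>\<^bsub>M\<^esub>"
        by (rule inj_on_eq_iff[OF \<eta>(2) ev_closed[OF M z] left_module_zero_closed[OF M]])
      finally show ?thesis .
    qed
    then show ?thesis
      using B.tor_shift[OF van] A.tor_connecting[OF van] A.tor_inj_0_iff[OF CS p(4,5,6)]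
      by simp
  qed
  have one: "tor_vanishes S ?P ?d ?T 0 \<longleftrightarrow> (\<forall>y \<in> carrier M. \<exists>z \<in> frags ?C (star R C M). ev M z = y)"
  proof -
    \<comment> \<open>With codomain L instead of \<open>?N 1\<close> the map is onto, as right
      exactness and the lifting of z below require.\<close>
    have bL: "?b \<in> mod_hom S (?N 0) ?L" "?b ` carrier (?N 0) = carrier ?L" by (fact A.q)+
    have "tor_vanishes S ?P ?d ?T 0 \<longleftrightarrow>
        (\<forall>z \<in> frags ?C ?L. B.co (\<lambda>x. x) z \<in> tensor_null S ?C (?N 1) \<longrightarrow> z \<in> tensor_null S ?C ?L)"
      using B.tor_connecting[OF van] B.tor_inj_0_iff[OF CS p(4,5,6)] by simp
    also have "\<dots> \<longleftrightarrow> (\<forall>y \<in> carrier M. \<exists>z \<in> frags ?C (star R C M). ev M z = y)"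
    proof (intro iffI ballI impI)
      \<comment> \<open>Choose u over I 0 evaluating to \<eta> y. Its image over I 1 evaluates to f
        0 (\<eta> y) = 0, so it is null there and, by hypothesis, already over L. Right exactness
        then gives v over M with the same class as u, and \<open>ev M v\<close> is y since \<eta> is
        injective.\<close>
      fix y assume inj_L: "\<forall>z \<in> frags ?C ?L. B.co (\<lambda>x. x) z \<in> tensor_null S ?C (?N 1) \<longrightarrow> z \<in> tensor_null S ?C ?L"
        and y: "y \<in> carrier M"
      have fy: "f 0 (\<eta> y) = \<zero>\<^bsub>I 1\<^esub>" "\<eta> y \<in> carrier (I 0)" using y ker by (auto simp: a_kernel_eq)
      obtain u where u: "u \<in> frags ?C (?N 0)" "ev (I 0) u = \<eta> y"
        using injective_ev_surj[OF assms(3) inj fy(2)] by blast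
      have bu: "A.co ?b u \<in> frags ?C ?L" "A.co ?b u \<in> frags ?C (?N 1)"
        by (rule frag_map_frags[OF u(1)]; use mod_hom_closed[OF bL(1)] mod_hom_closed[OF b] in blast)+
      have "ev (I 1) (A.co ?b u) = \<zero>\<^bsub>I 1\<^esub>"
        unfolding ev_star_map[OF I I f u(1)] u(2) by (rule fy(1))
      then have "A.co ?b u \<in> tensor_null S ?C (?N 1)" by (rule injective_ev_inj[OF assms(3) inj bu(2)])
      then have "A.co ?b u \<in> tensor_null S ?C ?L"
        using inj_L bu(1) frag_map_ident[OF bu(1), of "\<lambda>x. x" "\<lambda>x. x"] by simp
      from tensor_right_exact_right[OF CS N L N0 bL a A.iq u(1) this]
      obtain v where v: "v \<in> frags ?C (star R C M)" "u - A.co ?a v \<in> tensor_null S ?C (?N 0)" by blast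
      have av: "A.co ?a v \<in> frags ?C (?N 0)" by (rule frag_map_frags[OF v(1) _ mod_hom_closed[OF a]])
      have "ev (I 0) u \<ominus>\<^bsub>I 0\<^esub> ev (I 0) (A.co ?a v) = \<zero>\<^bsub>I 0\<^esub>"
        using ev_null[OF I v(2)] by (simp add: ev_diff[OF I u(1) av])
      then have "\<eta> y = \<eta> (ev M v)"
        using abelian_group.minus_eq_zero_iff[OF left_module_abelian_group[OF I] ev_closed[OF I u(1)] ev_closed[OF I av]]
        by (simp add: u(2) ev_star_map[OF M I \<eta>(1) v(1)])
      then have "ev M v = y" using inj_onD[OF \<eta>(2)] y ev_closed[OF M v(1)] by metis
      then show "\<exists>z \<in> frags ?C (star R C M). ev M z = y" using v(1) by blast
    next
      \<comment> \<open>Lift z to u over I 0. As z is null over \<open>?N 1\<close>, the value of u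
        lies in the kernel of \<open>f 0\<close>, hence is \<eta> of an element hit by some v over
        M. So u and the image of v agree modulo null sums, and the image of v vanishes over
        L.\<close>
      fix z assume surj: "\<forall>y \<in> carrier M. \<exists>z \<in> frags ?C (star R C M). ev M z = y"
        and z: "z \<in> frags ?C ?L" "B.co (\<lambda>x. x) z \<in> tensor_null S ?C (?N 1)"
      have z1: "z \<in> tensor_null S ?C (?N 1)" using z frag_map_ident[OF z(1), of "\<lambda>x. x" "\<lambda>x. x"] by simp
      obtain u where u: "u \<in> frags ?C (?N 0)" "A.co ?b u = z"
        using frag_map_surj[OF z(1) _ bL(2), of "\<lambda>x. x" ?C] by auto
      have "f 0 (ev (I 0) u) = \<zero>\<^bsub>I 1\<^esub>"
        unfolding ev_star_map[OF I I f u(1), symmetric] u(2) by (rule ev_null[OF I z1])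
      then have "ev (I 0) u \<in> \<eta> ` carrier M" using ker ev_closed[OF I u(1)] by (simp add: a_kernel_eq)
      then obtain y where y: "y \<in> carrier M" "ev (I 0) u = \<eta> y" by (rule imageE)
      from bspec[OF surj y(1)] obtain v where "v \<in> frags ?C (star R C M)" "ev M v = y" by (rule bexE)
      then have v: "v \<in> frags ?C (star R C M)" "ev (I 0) u = \<eta> (ev M v)" using y(2) by simp_all
      have av: "A.co ?a v \<in> frags ?C (?N 0)" by (rule frag_map_frags[OF v(1) _ mod_hom_closed[OF a]])
      have "ev (I 0) (u - A.co ?a v) = \<zero>\<^bsub>I 0\<^esub>"
        using abelian_group.minus_eq_zero_iff[OF left_module_abelian_group[OF I] ev_closed[OF I u(1)] ev_closed[OF I av]]
        by (simp add: ev_diff[OF I u(1) av] v(2) ev_star_map[OF M I \<eta>(1) v(1)])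
      then have "u - A.co ?a v \<in> tensor_null S ?C (?N 0)"
        by (rule injective_ev_inj[OF assms(3) inj frags_diff[OF u(1) av]])
      from frag_map_null[OF CS N CS L mod_hom_ident bL(1) this]
      have "z - A.co ?b (A.co ?a v) \<in> tensor_null S ?C ?L" by (simp add: u(2))
      moreover have "A.co ?b (A.co ?a v) \<in> tensor_null S ?C ?L"
      proof -
        have "?a x \<in> a_kernel (?N 0) ?L ?b" if "x \<in> carrier (star R C M)" for x
          using that A.iq by blast
        then show ?thesis
          unfolding frag_map_comp
          by (intro frag_map_null_if_zero[OF CS L v(1)]) (use left_module_zero_closed[OF L] in \<open>auto simp: a_kernel_eq\<close>)
      qed
      ultimately show "z \<in> tensor_null S ?C ?L" using tensor_null_add[OF CS L] by fastforce
    qed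
    finally show ?thesis .
  qed
  have all: "(\<forall>i\<ge>1. trivial_group (Tor S ?C K i)) \<longleftrightarrow> (\<forall>n. tor_vanishes S ?P ?d K n)"
    if "left_module S K" for K :: "('s, 'k) module"
    unfolding trivial_Tor_iff[OF CS that, symmetric] by (metis One_nat_def Suc_le_D Suc_le_mono zero_le)
  have "inf_cotorsionfree R S C I f \<longleftrightarrow> (\<forall>i\<ge>1. trivial_group (Tor S ?C ?T i))"
    unfolding inf_cotorsionfree_def cotorsionfree_def by (meson order_refl order_trans)
  also have "\<dots> \<longleftrightarrow> (\<forall>n. tor_vanishes S ?P ?d ?T n)" by (rule all[OF Tm])
  also have "\<dots> \<longleftrightarrow> tor_vanishes S ?P ?d ?T 0 \<and> tor_vanishes S ?P ?d ?T (Suc 0) \<and>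
      (\<forall>n. tor_vanishes S ?P ?d ?T (Suc (Suc n)))" by (metis not0_implies_Suc)
  also have "\<dots> \<longleftrightarrow> theta M \<in> mod_iso R (tensor_left_module S C (star R C M)) M \<and>
      (\<forall>i\<ge>1. trivial_group (Tor S ?C (star R C M) i))"
    unfolding theta_iso_iff[OF M] all[OF N0] one two high by blast
  finally have "inf_cotorsionfree R S C I f \<longleftrightarrow> theta M \<in> mod_iso R (tensor_left_module S C (star R C M)) M \<and>
      (\<forall>i\<ge>1. trivial_group (Tor S ?C (star R C M) i))" .
  moreover have "inf_cospherical R C M \<longleftrightarrow> (\<forall>i\<ge>1. trivial_group (Ext R C M i))"
    unfolding inf_cospherical_def cospherical_def by (meson order_refl order_trans)
  ultimately show ?thesis using M unfolding Bass_class_def by blast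
qed

end
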